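(* Let $0<p,q\le\infty$ with $p\ne q$. Let $0<u\le\min(1,p,q)$ and $t>0$. Then there exists $m\in L^\infty(\mathbb{R}^d)$ such that $\mathcal{K}_u^{0,t}[m]<\infty$, but $T_m$ is not bounded on $\dot F_p^{0,q}$.
   Context: Convention: $1/\infty=0$. Fourier transform: $\widehat f(\xi)=\int_{\mathbb{R}^d} f(x)e^{-2\pi i\langle x,\xi\rangle}dx$; $f^\vee$ is the inverse Fourier transform. Cutoff: $\varphi$ is a fixed smooth function on $\mathbb{R}^d$ with $0\le\varphi\le1$, $\varphi=1$ on $\{1/2\le|\xi|\le2\}$, $\mathrm{supp}\,\varphi\subset\{1/4\le|\xi|\le4\}$. Herz spaces: let $B_0=\{x:|x|\le2\}$ and $B_k=\{x\in\mathbb{R}^d:2^k<|x|\le2^{k+1}\}$ for $k\ge1$. For $0<u\le\infty$, $t>0$ ($t=\infty$ allowed), $s\in\mathbb{R}$, $\|f\|_{K_u^{s,t}}:=\big(\sum_{k=0}^\infty 2^{skt}\|f\|_{L^u(B_k)}^t\big)^{1/t}$ (supremum if $t=\infty$). Put $\mathcal{K}_u^{s,t}[m]:=\sup_{k\in\mathbb{Z}}\big\|(m(2^k\cdot)\varphi)^\vee\big\|_{K_u^{s,t}}$. Littlewood–Paley pieces: $\phi$ is a fixed smooth function with $\widehat\phi$ supported in $\{1/2\le|\xi|\le2\}$ and $\sum_{k\in\mathbb{Z}}\widehat{\phi_k}(\xi)=1$ for $\xi\ne0$, where $\phi_k=2^{kd}\phi(2^k\cdot)$; $\Pi_kf:=\phi_k*f$.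 Triebel–Lizorkin space: $\dot F_p^{0,q}$ is the space of $f\in S'/\mathcal{P}$ (tempered distributions modulo polynomials) with finite (quasi-)norm $\|f\|_{\dot F_p^{0,q}}:=\big\|\big(\sum_{k\in\mathbb{Z}}|\Pi_kf|^q\big)^{1/q}\big\|_{L^p}$ if $p<\infty$ or $p=q=\infty$ (supremum over $k$ if $q=\infty$), and $\|f\|_{\dot F_\infty^{0,q}}:=\sup_{P}\big(\frac1{|P|}\int_P\sum_{k=-\log_2 l(P)}^\infty|\Pi_kf(x)|^q\,dx\big)^{1/q}$ if $p=\infty$, $q<\infty$, the supremum being over all dyadic cubes $P\subset\mathbb{R}^d$ with side length $l(P)$. Multiplier operator: $T_mf=(m\widehat f)^\vee$ for $f\in S_\infty$, the space of Schwartz functions all of whose moments vanish. "$T_m$ is not bounded on $\dot F_p^{0,q}$" means that there is no constant $C<\infty$ with $\|T_mf\|_{\dot F_p^{0,q}}\le C\|f\|_{\dot F_p^{0,q}}$ for all $f\in S_\infty$ (the left side being $\infty$ if $T_mf\notin\dot F_p^{0,q}$). *)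

theory Defs
  imports "HOL-Analysis.Analysis" "HOL-Probability.Essential_Supremum"
begin

section \<open>Smooth functions, Schwartz functions and tempered distributions\<close>

definition partial_deriv ::
    "'n::finite \<Rightarrow> (real^'n \<Rightarrow> 'b::real_normed_vector) \<Rightarrow> real^'n \<Rightarrow> 'b" where
  "partial_deriv i f x = frechet_derivative f (at x) (axis i 1)"

definition iterated_deriv ::
    "'n::finite list \<Rightarrow> (real^'n \<Rightarrow> 'b::real_normed_vector) \<Rightarrow> real^'n \<Rightarrow> 'b" where
  "iterated_deriv js f = foldr partial_deriv js f"

definition smooth :: "(real^'n::finite \<Rightarrow> 'b::real_normed_vector) \<Rightarrow> bool" where
  "smooth f \<longleftrightarrow> (\<forall>js x. iterated_deriv js f differentiable (at x))"

definition supp :: "('a::topological_space \<Rightarrow> 'b::zero) \<Rightarrow> 'a set" where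
  "supp f = closure {x. f x \<noteq> 0}"

definition schwartz :: "(real^'n::finite \<Rightarrow> complex) set" where
  "schwartz = {f. smooth f \<and>
     (\<forall>N js. \<exists>C. \<forall>x. (1 + norm x) ^ N * norm (iterated_deriv js f x) \<le> C)}"

definition schwartz_vanishing_moments :: "(real^'n::finite \<Rightarrow> complex) set" where
  "schwartz_vanishing_moments = {f \<in> schwartz.
     \<forall>\<alpha>::'n \<Rightarrow> nat. (\<integral>x. complex_of_real (\<Prod>i\<in>UNIV. (x $ i) ^ \<alpha> i) * f x \<partial>lborel) = 0}"

definition schwartz_seminorm :: "nat \<Rightarrow> (real^'n::finite \<Rightarrow> complex) \<Rightarrow> real" where
  "schwartz_seminorm N f =
     (SUP (js, x)\<in>{js. length js \<le> N} \<times> UNIV. (1 + norm x) ^ N * norm (iterated_deriv js f x))"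

text \<open>A distribution is a functional on all functions, of which only the values on Schwartz
  functions are meaningful.\<close>

definition tempered_distribution :: "((real^'n::finite \<Rightarrow> complex) \<Rightarrow> complex) \<Rightarrow> bool" where
  "tempered_distribution \<Lambda> \<longleftrightarrow>
     (\<forall>f\<in>schwartz. \<forall>g\<in>schwartz. \<forall>a b. \<Lambda> (\<lambda>x. a * f x + b * g x) = a * \<Lambda> f + b * \<Lambda> g) \<and>
     (\<exists>C N. \<forall>f\<in>schwartz. norm (\<Lambda> f) \<le> C * schwartz_seminorm N f)"

definition distribution_of ::
    "(real^'n::finite \<Rightarrow> complex) \<Rightarrow> (real^'n \<Rightarrow> complex) \<Rightarrow> complex" where
  "distribution_of f = (\<lambda>g. \<integral>x. f x * g x \<partial>lborel)"

definition equal_mod_polynomials ::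
    "((real^'n::finite \<Rightarrow> complex) \<Rightarrow> complex) rel" where
  "equal_mod_polynomials = {(\<Lambda>, \<Lambda>'). tempered_distribution \<Lambda> \<and> tempered_distribution \<Lambda>' \<and>
     (\<exists>P. polynomial_function P \<and> (\<forall>g\<in>schwartz. \<Lambda>' g - \<Lambda> g = distribution_of P g))}"

text \<open>The element of \<open>S'/P\<close> determined by a function.\<close>

definition class_of :: "(real^'n::finite \<Rightarrow> complex) \<Rightarrow> ((real^'n \<Rightarrow> complex) \<Rightarrow> complex) set" where
  "class_of f = equal_mod_polynomials `` {distribution_of f}"


section \<open>Fourier transform and multiplier operators\<close>

definition fourier :: "(real^'n::finite \<Rightarrow> complex) \<Rightarrow> real^'n \<Rightarrow> complex" where
  "fourier f \<xi> = (\<integral>x. f x * cis (- 2 * pi * (x \<bullet> \<xi>)) \<partial>lborel)"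

definition inv_fourier :: "(real^'n::finite \<Rightarrow> complex) \<Rightarrow> real^'n \<Rightarrow> complex" where
  "inv_fourier g x = (\<integral>\<xi>. g \<xi> * cis (2 * pi * (x \<bullet> \<xi>)) \<partial>lborel)"

definition multiplier_op ::
    "(real^'n::finite \<Rightarrow> complex) \<Rightarrow> (real^'n \<Rightarrow> complex) \<Rightarrow> real^'n \<Rightarrow> complex" where
  "multiplier_op m f = inv_fourier (\<lambda>\<xi>. m \<xi> * fourier f \<xi>)"


section \<open>Quasi-norms with values in the extended half-line\<close>

text \<open>Intended for exponents \<open>a > 0\<close> only.\<close>

definition ennpowr :: "ennreal \<Rightarrow> real \<Rightarrow> ennreal" where
  "ennpowr x a = (if x = \<infinity> then \<infinity> else ennreal (enn2real x powr a))"

definition Lp_norm :: "'a measure \<Rightarrow> ennreal \<Rightarrow> ('a \<Rightarrow> ennreal) \<Rightarrow> ennreal" where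
  "Lp_norm M p f = (if p = \<infinity> then esssup M f
     else ennpowr (\<integral>\<^sup>+x. ennpowr (f x) (enn2real p) \<partial>M) (1 / enn2real p))"

definition lp_norm :: "ennreal \<Rightarrow> ('i \<Rightarrow> ennreal) \<Rightarrow> ennreal" where
  "lp_norm p a = (if p = \<infinity> then (SUP i. a i)
     else ennpowr (\<Sum>\<^sub>\<infinity>i. ennpowr (a i) (enn2real p)) (1 / enn2real p))"

definition Linfty :: "(real^'n::finite \<Rightarrow> complex) set" where
  "Linfty = {m \<in> borel_measurable lborel. Lp_norm lborel \<infinity> (\<lambda>\<xi>. ennreal (norm (m \<xi>))) < \<infinity>}"


section \<open>Herz spaces\<close>

definition herz_shell :: "nat \<Rightarrow> (real^'n::finite) set" where
  "herz_shell k = (if k = 0 then {x. norm x \<le> 2} else {x. 2 ^ k < norm x \<and> norm x \<le> 2 ^ (k + 1)})"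

definition herz_norm :: "ennreal \<Rightarrow> real \<Rightarrow> ennreal \<Rightarrow> (real^'n::finite \<Rightarrow> complex) \<Rightarrow> ennreal" where
  "herz_norm u s t f = lp_norm t (\<lambda>k::nat. ennreal (2 powr (s * real k)) *
     Lp_norm (restrict_space lborel (herz_shell k)) u (\<lambda>x. ennreal (norm (f x))))"

definition herz_cutoff :: "(real^'n::finite \<Rightarrow> real) \<Rightarrow> bool" where
  "herz_cutoff \<eta> \<longleftrightarrow> smooth \<eta> \<and> (\<forall>\<xi>. 0 \<le> \<eta> \<xi> \<and> \<eta> \<xi> \<le> 1) \<and>
     (\<forall>\<xi>. 1/2 \<le> norm \<xi> \<and> norm \<xi> \<le> 2 \<longrightarrow> \<eta> \<xi> = 1) \<and>
     supp \<eta> \<subseteq> {\<xi>. 1/4 \<le> norm \<xi> \<and> norm \<xi> \<le> 4}"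

definition herz_multiplier_norm ::
    "(real^'n::finite \<Rightarrow> real) \<Rightarrow> ennreal \<Rightarrow> real \<Rightarrow> ennreal \<Rightarrow> (real^'n \<Rightarrow> complex) \<Rightarrow> ennreal" where
  "herz_multiplier_norm \<eta> u s t m =
     (SUP k::int. herz_norm u s t (inv_fourier (\<lambda>\<xi>. m ((2 powi k) *\<^sub>R \<xi>) * complex_of_real (\<eta> \<xi>))))"


section \<open>Homogeneous Triebel--Lizorkin spaces of smoothness zero\<close>

definition dyadic_dilate :: "(real^'n::finite \<Rightarrow> complex) \<Rightarrow> int \<Rightarrow> real^'n \<Rightarrow> complex" where
  "dyadic_dilate \<phi> k x = (2 powi (k * int CARD('n))) *\<^sub>R \<phi> ((2 powi k) *\<^sub>R x)"

text \<open>The function is required to be Schwartz, so that its Fourier transform is given by the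
  integral and its convolution with a tempered distribution is defined.\<close>

definition littlewood_paley :: "(real^'n::finite \<Rightarrow> complex) \<Rightarrow> bool" where
  "littlewood_paley \<phi> \<longleftrightarrow> \<phi> \<in> schwartz \<and>
     supp (fourier \<phi>) \<subseteq> {\<xi>. 1/2 \<le> norm \<xi> \<and> norm \<xi> \<le> 2} \<and>
     (\<forall>\<xi>. \<xi> \<noteq> 0 \<longrightarrow> ((\<lambda>k::int. fourier (dyadic_dilate \<phi> k) \<xi>) has_sum 1) UNIV)"

text \<open>The convolution of \<open>\<phi>\<^sub>k\<close> with a tempered distribution, as a function.\<close>

definition LP_piece ::
    "(real^'n::finite \<Rightarrow> complex) \<Rightarrow> int \<Rightarrow> ((real^'n \<Rightarrow> complex) \<Rightarrow> complex) \<Rightarrow> real^'n \<Rightarrow> complex" where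
  "LP_piece \<phi> k \<Lambda> x = \<Lambda> (\<lambda>y. dyadic_dilate \<phi> k (x - y))"

text \<open>The dyadic cube of side length \<open>2\<^sup>j\<close> with lower corner \<open>2\<^sup>j n\<close>.\<close>

definition dyadic_cube :: "int \<Rightarrow> ('n::finite \<Rightarrow> int) \<Rightarrow> (real^'n) set" where
  "dyadic_cube j n = {x. \<forall>i. 2 powi j * of_int (n i) \<le> x $ i \<and> x $ i < 2 powi j * (of_int (n i) + 1)}"

definition TL_norm_distribution ::
    "(real^'n::finite \<Rightarrow> complex) \<Rightarrow> ennreal \<Rightarrow> ennreal \<Rightarrow> ((real^'n \<Rightarrow> complex) \<Rightarrow> complex) \<Rightarrow> ennreal" where
  "TL_norm_distribution \<phi> p q \<Lambda> =
     (if p < \<infinity> \<or> q = \<infinity> then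
        Lp_norm lborel p (\<lambda>x. lp_norm q (\<lambda>k::int. ennreal (norm (LP_piece \<phi> k \<Lambda> x))))
      else
        (SUP (j, n)\<in>UNIV. ennpowr
          ((\<integral>\<^sup>+x\<in>dyadic_cube j n.
              (\<Sum>\<^sub>\<infinity>k\<in>{-j..}. ennpowr (ennreal (norm (LP_piece \<phi> k \<Lambda> x))) (enn2real q)) \<partial>lborel)
            / emeasure lborel (dyadic_cube j n :: (real^'n) set))
          (1 / enn2real q)))"

text \<open>The quasi-norm of an element of \<open>S'/P\<close>. All representatives have the same quasi-norm, since
  \<open>\<phi>\<^sub>k\<close> has vanishing moments and hence annihilates polynomials; the infimum selects
  this common value. The space consists of the classes whose quasi-norm is finite.\<close>

definition TL_norm ::
    "(real^'n::finite \<Rightarrow> complex) \<Rightarrow> ennreal \<Rightarrow> ennreal \<Rightarrow> ((real^'n \<Rightarrow> complex) \<Rightarrow> complex) set \<Rightarrow> ennreal" where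
  "TL_norm \<phi> p q U = (INF \<Lambda>\<in>U. TL_norm_distribution \<phi> p q \<Lambda>)"

definition TL_bounded ::
    "(real^'n::finite \<Rightarrow> complex) \<Rightarrow> ennreal \<Rightarrow> ennreal \<Rightarrow> (real^'n \<Rightarrow> complex) \<Rightarrow> bool" where
  "TL_bounded \<phi> p q m \<longleftrightarrow> (\<exists>C\<ge>0. \<forall>f\<in>schwartz_vanishing_moments.
     TL_norm \<phi> p q (class_of (multiplier_op m f)) \<le> ennreal C * TL_norm \<phi> p q (class_of f))"

end

theory Submission
  imports Defs "HOL-Probability.Sinc_Integral" "HOL-Probability.Characteristic_Functions"
begin

text \<open>
  The multiplier translates the frequency annulus around \<open>2\<^sup>n\<close>, \<open>n = 10 (k + 1)\<close>, by \<open>k v\<close> for a unit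
  vector \<open>v\<close>. After rescaling each piece is a translate of one of finitely many Schwartz
  functions, and for \<open>s = 0\<close> the Herz norm is bounded uniformly over all translates of such a function.
  For the unboundedness test it on sums of \<open>N\<close> modulated bumps of unit width, with one bump in each
  of these annuli. When all the bumps sit at the same place the norm of the sum is of order
  \<open>N\<^bsup>1/q\<^esup>\<close>; when they are far apart it is of order \<open>N\<^bsup>1/p\<^esup>\<close>. Since the multiplier moves the bumps
  independently of each other, it turns either configuration into the other, so that boundedness
  would force \<open>p = q\<close>. The bumps are modulations of the Littlewood--Paley function
  itself: their Fourier transforms have compact support, so that three pieces recover each of them.
\<close>

section \<open>Schwartz functions\<close>

text \<open>A bump translated by \<open>a\<close> has almost all its mass in the at most three Herz
  shells of radius comparable to \<open>norm a\<close>. The shell weight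
  \<open>2 powr (s * real k)\<close> would charge about \<open>norm a powr s\<close> for that; at
  \<open>s = 0\<close> it charges nothing, so translations that grow with the frequency are free.
  The direction follows the larger growth: for p < q stacked bumps are spread out, for q < p bumps
  placed at \<open>c0 - real k *\<^sub>R v\<close> are gathered at \<open>c0\<close>. Compact
  Fourier support makes the action of the multiplier exact, but it leaves the bumps with tails, so
  separated bumps still interact at every point. Controlling their sum uniformly in N for all p,
  including p < 1 and the cube averages at p infinite, is the main analytic difficulty. Translating
  a modulated bump also produces a phase; for this reason every norm estimate is uniform over
  unimodular coefficients \<open>\<omega>\<close>.\<close>

abbreviation wave :: "real^'n::finite \<Rightarrow> real^'n \<Rightarrow> complex" where
  "wave \<xi> x \<equiv> cis (2 * pi * (x \<bullet> \<xi>))"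

lemma partial_deriv_eq:
  "(f has_derivative D) (at x) \<Longrightarrow> partial_deriv i f x = D (axis i 1)"
  unfolding partial_deriv_def using frechet_derivative_at by metis

text \<open>\<open>foldr\<close> applies the last index first, so an appended index differentiates
  before all others. This passes the Schwartz bounds from \<open>f\<close> to its partial
  derivatives.\<close>

lemma iterated_deriv_snoc:
  "iterated_deriv (js @ [j]) f = iterated_deriv js (partial_deriv j f)"
  by (simp add: iterated_deriv_def)

text \<open>The Schwartz conditions quantify over all iterated derivatives. A class closed under one
  partial derivative contains all of them, so decay of its members themselves is enough and no
  Leibniz formula of higher order enters.\<close>

lemma schwartz_closedI:
  assumes "f \<in> V"
    and diff: "\<And>f x. f \<in> V \<Longrightarrow> f differentiable (at x)"
    and deriv: "\<And>f j. f \<in> V \<Longrightarrow> partial_deriv j f \<in> V"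
    and decay: "\<And>f N. f \<in> V \<Longrightarrow> \<exists>C. \<forall>x. (1 + norm x) ^ N * norm (f x) \<le> C"
  shows "f \<in> schwartz"
proof -
  have "iterated_deriv js f \<in> V" for js
    by (induction js) (use assms(1) deriv in \<open>auto simp: iterated_deriv_def\<close>)
  then show ?thesis
    unfolding schwartz_def smooth_def using diff decay by blast
qed

text \<open>If \<open>T\<close> turns each derivative into \<open>T\<close> of another Schwartz
  function, then the image of the Schwartz space under \<open>T\<close> is closed under
  differentiation and can serve as the class in \<open>schwartz_closedI\<close>.\<close>

lemma schwartz_operatorI:
  assumes "f \<in> schwartz"
    and "\<And>f x. f \<in> schwartz \<Longrightarrow> T f differentiable (at x)"
    and "\<And>f j. f \<in> schwartz \<Longrightarrow> \<exists>g\<in>schwartz. partial_deriv j (T f) = T g"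
    and "\<And>f N. f \<in> schwartz \<Longrightarrow> \<exists>C. \<forall>x. (1 + norm x) ^ N * norm (T f x) \<le> C"
  shows "T f \<in> schwartz"
  by (rule schwartz_closedI[where V="T ` schwartz"]) (use assms in blast)+

lemma schwartz_differentiable: "f \<in> schwartz \<Longrightarrow> f differentiable (at x)"
  unfolding schwartz_def smooth_def iterated_deriv_def mem_Collect_eq
  by (metis foldr.simps(1) id_apply)

lemma schwartz_partial_deriv:
  assumes "f \<in> schwartz" shows "partial_deriv j f \<in> schwartz"
  using assms unfolding schwartz_def smooth_def mem_Collect_eq iterated_deriv_snoc[symmetric] by blast

lemma schwartz_decay:
  assumes "f \<in> schwartz"
  obtains C where "C > 0" "\<And>x. (1 + norm x) ^ N * norm (f x) \<le> C"
proof -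
  obtain C where C: "\<And>x. (1 + norm x) ^ N * norm (f x) \<le> C"
    using assms unfolding schwartz_def iterated_deriv_def mem_Collect_eq
    by (metis foldr.simps(1) id_apply)
  show thesis by (rule that[of "max C 1"]) (use C in \<open>auto simp: le_max_iff_disj\<close>)
qed

lemma schwartz_bounded:
  assumes "f \<in> schwartz"
  obtains C where "C > 0" "\<And>x. norm (f x) \<le> C"
  using schwartz_decay[OF assms, of 0] by (metis mult_1 power_0)

lemma schwartz_continuous: "f \<in> schwartz \<Longrightarrow> continuous_on A f"
  by (simp add: continuous_at_imp_continuous_on differentiable_imp_continuous_within schwartz_differentiable)

lemma schwartz_measurable: "f \<in> schwartz \<Longrightarrow> f \<in> borel_measurable borel"
  by (intro borel_measurable_continuous_onI schwartz_continuous)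

lemma has_derivative_schwartz:
  "f \<in> schwartz \<Longrightarrow> (f has_derivative frechet_derivative f (at x)) (at x)"
  using schwartz_differentiable frechet_derivative_works by blast

lemma partial_deriv_add:
  assumes "f differentiable (at x)" "g differentiable (at x)"
  shows "partial_deriv j (\<lambda>x. f x + g x) x = partial_deriv j f x + partial_deriv j g x"
proof -
  have "((\<lambda>x. f x + g x) has_derivative
      (\<lambda>h. frechet_derivative f (at x) h + frechet_derivative g (at x) h)) (at x)"
    using assms by (intro has_derivative_add) (simp_all add: frechet_derivative_works)
  from partial_deriv_eq[OF this] show ?thesis by (simp add: partial_deriv_def)
qed

lemma partial_deriv_mult:
  fixes f g :: "real^'n::finite \<Rightarrow> complex"
  assumes "f differentiable (at x)" "g differentiable (at x)"
  shows "partial_deriv j (\<lambda>x. f x * g x) x = f x * partial_deriv j g x + partial_deriv j f x * g x"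
proof -
  have "((\<lambda>x. f x * g x) has_derivative
      (\<lambda>h. f x * frechet_derivative g (at x) h + frechet_derivative f (at x) h * g x)) (at x)"
    using assms by (intro has_derivative_mult) (simp_all add: frechet_derivative_works)
  from partial_deriv_eq[OF this] show ?thesis by (simp add: partial_deriv_def)
qed

lemma partial_deriv_const: "partial_deriv j (\<lambda>x. c) x = 0"
  by (rule partial_deriv_eq[where D="\<lambda>_. 0", simplified]) simp

lemma has_derivative_wave:
  "(wave \<xi> has_derivative (\<lambda>h. complex_of_real (2 * pi * (h \<bullet> \<xi>)) * (\<i> * wave \<xi> x))) (at x)"
proof -
  have "(wave \<xi> has_derivative (\<lambda>h. (2 * pi * (h \<bullet> \<xi>)) *\<^sub>R (\<i> * cis (2 * pi * (x \<bullet> \<xi>))))) (at x)"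
    by (rule has_derivative_cis) (auto intro!: derivative_eq_intros)
  then show ?thesis by (simp add: scaleR_conv_of_real)
qed

lemma differentiable_wave: "wave \<xi> differentiable (at x)"
  using has_derivative_wave differentiable_def by blast

lemma partial_deriv_wave:
  "partial_deriv j (wave \<xi>) x = complex_of_real (2 * pi * \<xi> $ j) * (\<i> * wave \<xi> x)"
  using partial_deriv_eq[OF has_derivative_wave] by (simp add: inner_axis' )

lemma borel_measurable_cis[measurable (raw)]:
  "f \<in> borel_measurable M \<Longrightarrow> (\<lambda>x. cis (f x)) \<in> borel_measurable M"
  unfolding cis_conv_exp by measurable

lemma borel_measurable_vec_nth[measurable (raw)]:
  fixes f :: "'a \<Rightarrow> real^'n::finite"
  assumes [measurable]: "f \<in> borel_measurable M" shows "(\<lambda>x. f x $ i) \<in> borel_measurable M"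
proof -
  have "(\<lambda>x. f x $ i) = (\<lambda>x. f x \<bullet> axis i 1)" by (simp add: inner_axis)
  then show ?thesis by simp
qed

lemma wave_add: "wave \<xi> (x + y) = wave \<xi> x * wave \<xi> y"
  by (simp add: cis_mult inner_add_left distrib_left)

lemma wave_add_freq: "wave (\<xi> + \<eta>) x = wave \<xi> x * wave \<eta> x"
  by (simp add: cis_mult inner_add_right distrib_left)

section \<open>Closure of the Schwartz space under algebra, modulation, affine maps and
  polynomials\<close>

lemma schwartz_zero: "(\<lambda>x. 0) \<in> schwartz"
  by (rule schwartz_closedI[where V="{\<lambda>x. 0}"]) (auto simp: partial_deriv_const intro: exI[of _ 0])

lemma schwartz_add:
  fixes f :: "real^'n::finite \<Rightarrow> complex"
  assumes "f \<in> schwartz" "g \<in> schwartz" shows "(\<lambda>x. f x + g x) \<in> schwartz"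
proof (rule schwartz_closedI[where V="{\<lambda>x. f x + g x | f g. f \<in> schwartz \<and> g \<in> schwartz}"])
  show "(\<lambda>x. f x + g x) \<in> {\<lambda>x. f x + g x | f g. f \<in> schwartz \<and> g \<in> schwartz}" (is "_ \<in> ?V")
    using assms by blast
  fix h :: "real^'n \<Rightarrow> complex" and j
  assume "h \<in> ?V"
  then obtain f g where h: "h = (\<lambda>x. f x + g x)" and fg: "f \<in> schwartz" "g \<in> schwartz" by blast
  show "h differentiable (at x)" for x
    using fg by (simp add: h schwartz_differentiable)
  have "partial_deriv j h = (\<lambda>x. partial_deriv j f x + partial_deriv j g x)"
    using fg by (auto simp: h fun_eq_iff partial_deriv_add schwartz_differentiable)
  then show "partial_deriv j h \<in> ?V"
    using fg schwartz_partial_deriv by blast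
  fix N
  obtain A where A: "\<And>x. (1 + norm x) ^ N * norm (f x) \<le> A" using schwartz_decay[OF fg(1)] by metis
  obtain B where B: "\<And>x. (1 + norm x) ^ N * norm (g x) \<le> B" using schwartz_decay[OF fg(2)] by metis
  have "(1 + norm x) ^ N * norm (h x) \<le> A + B" for x
  proof -
    have "(1 + norm x) ^ N * norm (h x) \<le> (1 + norm x) ^ N * (norm (f x) + norm (g x))"
      unfolding h by (intro mult_left_mono norm_triangle_ineq) simp
    then show ?thesis using A[of x] B[of x] by (simp add: distrib_left)
  qed
  then show "\<exists>C. \<forall>x. (1 + norm x) ^ N * norm (h x) \<le> C" by blast
qed

text \<open>The Leibniz rule turns one product into a sum of two, so products alone are not closed
  under \<open>partial_deriv\<close>; closing them under sums repairs this.\<close>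

inductive_set schwartz_products :: "(real^'n::finite \<Rightarrow> complex) set" where
  prod: "f \<in> schwartz \<Longrightarrow> g \<in> schwartz \<Longrightarrow> (\<lambda>x. f x * g x) \<in> schwartz_products"
| sum: "f \<in> schwartz_products \<Longrightarrow> g \<in> schwartz_products \<Longrightarrow> (\<lambda>x. f x + g x) \<in> schwartz_products"

lemma schwartz_mult:
  fixes f g :: "real^'n::finite \<Rightarrow> complex"
  assumes "f \<in> schwartz" "g \<in> schwartz" shows "(\<lambda>x. f x * g x) \<in> schwartz"
proof (rule schwartz_closedI[where V=schwartz_products])
  show "(\<lambda>x. f x * g x) \<in> schwartz_products" using assms by (rule schwartz_products.prod)
next
  fix h :: "real^'n \<Rightarrow> complex" and x
  show diff: "h \<in> schwartz_products \<Longrightarrow> h differentiable (at x)" for x h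
  proof (induction rule: schwartz_products.induct)
    case (prod f g)
    then show ?case by (intro differentiable_mult schwartz_differentiable)
  qed (rule differentiable_add)
  fix j
  show "h \<in> schwartz_products \<Longrightarrow> partial_deriv j h \<in> schwartz_products"
  proof (induction rule: schwartz_products.induct)
    case (prod f g)
    then have "partial_deriv j (\<lambda>x. f x * g x) = (\<lambda>x. f x * partial_deriv j g x + partial_deriv j f x * g x)"
      by (auto simp: partial_deriv_mult schwartz_differentiable)
    then show ?case
      using prod by (auto intro!: schwartz_products.intros schwartz_partial_deriv)
  next
    case (sum f g)
    then have "partial_deriv j (\<lambda>x. f x + g x) = (\<lambda>x. partial_deriv j f x + partial_deriv j g x)"
      by (auto simp: partial_deriv_add diff)
    then show ?case
      using sum by (auto intro!: schwartz_products.intros)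
  qed
  fix N
  show "h \<in> schwartz_products \<Longrightarrow> \<exists>C. \<forall>x. (1 + norm x) ^ N * norm (h x) \<le> C"
  proof (induction rule: schwartz_products.induct)
    case (prod f g)
    obtain A where A: "\<And>x. (1 + norm x) ^ N * norm (f x) \<le> A" using schwartz_decay[OF prod(1)] by metis
    obtain B where B: "B > 0" "\<And>x. norm (g x) \<le> B" using schwartz_bounded[OF prod(2)] by metis
    have "(1 + norm x) ^ N * norm (f x) * norm (g x) \<le> A * B" for x
      using B(1) by (intro mult_mono A B order_trans[OF _ A[of x]] mult_nonneg_nonneg) auto
    then show ?case by (auto simp: norm_mult mult.assoc)
  next
    case (sum f g)
    then obtain A B where A: "\<And>x. (1 + norm x) ^ N * norm (f x) \<le> A"
      and B: "\<And>x. (1 + norm x) ^ N * norm (g x) \<le> B" by blast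
    have "(1 + norm x) ^ N * norm (f x + g x) \<le> A + B" for x
    proof -
      have "(1 + norm x) ^ N * norm (f x + g x) \<le> (1 + norm x) ^ N * (norm (f x) + norm (g x))"
        by (intro mult_left_mono norm_triangle_ineq) simp
      then show ?thesis using A[of x] B[of x] by (simp add: distrib_left)
    qed
    then show ?case by blast
  qed
qed

lemma schwartz_cmult:
  fixes f :: "real^'n::finite \<Rightarrow> complex"
  assumes "f \<in> schwartz" shows "(\<lambda>x. c * f x) \<in> schwartz"
proof (rule schwartz_operatorI[where T="\<lambda>f x. c * f x", OF assms])
  fix f :: "real^'n \<Rightarrow> complex" and j assume f: "f \<in> schwartz"
  show "(\<lambda>x. c * f x) differentiable (at x)" for x using f by (simp add: schwartz_differentiable)
  have "partial_deriv j (\<lambda>x. c * f x) = (\<lambda>x. c * partial_deriv j f x)"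
    using f by (auto simp: fun_eq_iff partial_deriv_mult partial_deriv_const schwartz_differentiable)
  then show "\<exists>g\<in>schwartz. partial_deriv j (\<lambda>x. c * f x) = (\<lambda>x. c * g x)"
    using schwartz_partial_deriv[OF f] by blast
  fix N
  obtain A where A: "\<And>x. (1 + norm x) ^ N * norm (f x) \<le> A" using schwartz_decay[OF f] by metis
  have "(1 + norm x) ^ N * norm (c * f x) \<le> norm c * A" for x
    using mult_left_mono[OF A[of x], of "norm c"] by (simp add: norm_mult ac_simps)
  then show "\<exists>C. \<forall>x. (1 + norm x) ^ N * norm (c * f x) \<le> C" by blast
qed

lemma schwartz_sum:
  assumes "\<And>i. i \<in> I \<Longrightarrow> f i \<in> schwartz" shows "(\<lambda>x. \<Sum>i\<in>I. f i x) \<in> schwartz"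
  using assms by (induction I rule: infinite_finite_induct) (auto intro: schwartz_zero schwartz_add)

lemma schwartz_wave_mult:
  fixes f :: "real^'n::finite \<Rightarrow> complex"
  assumes "f \<in> schwartz" shows "(\<lambda>x. wave \<xi> x * f x) \<in> schwartz"
proof (rule schwartz_operatorI[where T="\<lambda>f x. wave \<xi> x * f x", OF assms])
  fix f :: "real^'n \<Rightarrow> complex" and j assume f: "f \<in> schwartz"
  show "(\<lambda>x. wave \<xi> x * f x) differentiable (at x)" for x
    using differentiable_wave schwartz_differentiable[OF f] by (rule differentiable_mult)
  \<comment> \<open>Differentiating \<open>wave \<xi>\<close> only brings down a constant, so the
    derivative is again \<open>wave \<xi>\<close> times a Schwartz function.\<close>
  let ?g = "\<lambda>x. (complex_of_real (2 * pi * \<xi> $ j) * \<i>) * f x + partial_deriv j f x"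
  have "partial_deriv j (\<lambda>x. wave \<xi> x * f x) x = wave \<xi> x * ?g x" for x
    unfolding partial_deriv_mult[OF differentiable_wave schwartz_differentiable[OF f]] partial_deriv_wave
    by (simp only: algebra_simps)
  moreover have "?g \<in> schwartz" by (intro schwartz_add schwartz_cmult schwartz_partial_deriv f)
  ultimately show "\<exists>g\<in>schwartz. partial_deriv j (\<lambda>x. wave \<xi> x * f x) = (\<lambda>x. wave \<xi> x * g x)"
    by (intro bexI[of _ ?g] ext)
  show "\<exists>C. \<forall>x. (1 + norm x) ^ N * norm (wave \<xi> x * f x) \<le> C" for N
    using schwartz_decay[OF f, of N] by (simp add: norm_mult) metis
qed

lemma partial_deriv_affine:
  assumes "f differentiable (at (a *\<^sub>R x + b))"
  shows "partial_deriv j (\<lambda>x. f (a *\<^sub>R x + b)) x = a *\<^sub>R partial_deriv j f (a *\<^sub>R x + b)"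
proof -
  let ?D = "frechet_derivative f (at (a *\<^sub>R x + b))"
  have D: "(f has_derivative ?D) (at (a *\<^sub>R x + b))"
    using assms by (simp add: frechet_derivative_works)
  have "((\<lambda>x. a *\<^sub>R x + b) has_derivative (\<lambda>h. a *\<^sub>R h)) (at x)"
    by (auto intro!: derivative_eq_intros)
  from has_derivative_compose[OF this, of f ?D] D
  have "((\<lambda>x. f (a *\<^sub>R x + b)) has_derivative (\<lambda>h. ?D (a *\<^sub>R h))) (at x)"
    by simp
  from partial_deriv_eq[OF this] show ?thesis
    using linear_scale[OF has_derivative_linear[OF D]] by (simp add: partial_deriv_def)
qed

lemma schwartz_affine:
  fixes f :: "real^'n::finite \<Rightarrow> complex"
  assumes "f \<in> schwartz" "a \<noteq> 0" shows "(\<lambda>x. f (a *\<^sub>R x + b)) \<in> schwartz"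
proof (rule schwartz_operatorI[where T="\<lambda>f x. f (a *\<^sub>R x + b)", OF assms(1)])
  fix f :: "real^'n \<Rightarrow> complex" and j assume f: "f \<in> schwartz"
  show "(\<lambda>x. f (a *\<^sub>R x + b)) differentiable (at x)" for x
    by (rule differentiable_compose[OF schwartz_differentiable[OF f]]) simp
  let ?g = "\<lambda>y. complex_of_real a * partial_deriv j f y"
  have "partial_deriv j (\<lambda>x. f (a *\<^sub>R x + b)) = (\<lambda>x. ?g (a *\<^sub>R x + b))"
    unfolding partial_deriv_affine[OF schwartz_differentiable[OF f]] scaleR_conv_of_real[where 'a=complex] ..
  then show "\<exists>g\<in>schwartz. partial_deriv j (\<lambda>x. f (a *\<^sub>R x + b)) = (\<lambda>x. g (a *\<^sub>R x + b))"
    by (intro bexI[of _ ?g] schwartz_cmult schwartz_partial_deriv f)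
  fix N
  obtain A where A: "\<And>x. (1 + norm x) ^ N * norm (f x) \<le> A" using schwartz_decay[OF f] by metis
  \<comment> \<open>By the triangle inequality \<open>\<bar>a\<bar> * norm x\<close> is at most
    \<open>norm (a *\<^sub>R x + b) + norm b\<close>; \<open>K\<close> compares the weight at
    \<open>x\<close> with the weight at the image point.\<close>
  define K where "K = 1 + (1 + norm b) / \<bar>a\<bar>"
  have K: "1 + norm x \<le> K * (1 + norm (a *\<^sub>R x + b))" for x
  proof -
    have "\<bar>a\<bar> * norm x = norm ((a *\<^sub>R x + b) - b)" by simp
    also have "\<dots> \<le> norm (a *\<^sub>R x + b) + norm b" by (rule norm_triangle_ineq4)
    finally have "norm x \<le> (norm (a *\<^sub>R x + b) + norm b) / \<bar>a\<bar>"
      using assms(2) by (simp add: field_simps)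
    also have "1 + \<dots> \<le> K * (1 + norm (a *\<^sub>R x + b))"
      unfolding K_def using assms(2) by (simp add: field_simps)
    finally show ?thesis by simp
  qed
  have "(1 + norm x) ^ N * norm (f (a *\<^sub>R x + b)) \<le> K ^ N * A" for x
  proof -
    have "(1 + norm x) ^ N \<le> K ^ N * (1 + norm (a *\<^sub>R x + b)) ^ N"
      using power_mono[OF K, of x N] by (simp add: power_mult_distrib)
    then have "(1 + norm x) ^ N * norm (f (a *\<^sub>R x + b)) \<le> K ^ N * (1 + norm (a *\<^sub>R x + b)) ^ N * norm (f (a *\<^sub>R x + b))"
      by (rule mult_right_mono) simp
    also have "\<dots> \<le> K ^ N * A"
      using mult_left_mono[OF A[of "a *\<^sub>R x + b"], of "K ^ N"] by (simp add: K_def mult.assoc)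
    finally show ?thesis .
  qed
  then show "\<exists>C. \<forall>x. (1 + norm x) ^ N * norm (f (a *\<^sub>R x + b)) \<le> C" by blast
qed

lemma has_derivative_of_real_coord:
  "((\<lambda>x::real^'n::finite. complex_of_real (x $ i)) has_derivative (\<lambda>h. complex_of_real (h $ i))) (at x)"
  by (intro bounded_linear_imp_has_derivative bounded_linear_compose[OF bounded_linear_of_real]
      bounded_linear_vec_nth)

text \<open>Differentiation produces a term without the coordinate factor; the free summand
  \<open>g\<close> of the class absorbs it. One extra power of the weight pays for the
  coordinate.\<close>

lemma schwartz_coord_mult:
  fixes f :: "real^'n::finite \<Rightarrow> complex"
  assumes "f \<in> schwartz" shows "(\<lambda>x. complex_of_real (x $ i) * f x) \<in> schwartz"
proof (rule schwartz_closedI[where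
      V="{\<lambda>x. complex_of_real (x $ i) * f x + g x | f g. f \<in> schwartz \<and> g \<in> schwartz}"])
  show "(\<lambda>x. complex_of_real (x $ i) * f x) \<in>
      {\<lambda>x. complex_of_real (x $ i) * f x + g x | f g. f \<in> schwartz \<and> g \<in> schwartz}" (is "_ \<in> ?V")
    using assms schwartz_zero by force
  fix h :: "real^'n \<Rightarrow> complex" and j
  assume "h \<in> ?V"
  then obtain f g where h: "h = (\<lambda>x. complex_of_real (x $ i) * f x + g x)"
    and f: "f \<in> schwartz" and g: "g \<in> schwartz" by blast
  have d: "(\<lambda>x::real^'n. complex_of_real (x $ i)) differentiable (at x)" for x
    using has_derivative_of_real_coord differentiable_def by blast
  have d2: "(\<lambda>x. complex_of_real (x $ i) * f x) differentiable (at x)" for x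
    using d schwartz_differentiable[OF f] by (rule differentiable_mult)
  show "h differentiable (at x)" for x
    unfolding h using d2 schwartz_differentiable[OF g] by (rule differentiable_add)
  have "partial_deriv j h = (\<lambda>x. complex_of_real (x $ i) * partial_deriv j f x
      + (complex_of_real (axis j 1 $ i) * f x + partial_deriv j g x))"
    unfolding h using d d2 f g
    by (auto simp: fun_eq_iff partial_deriv_add partial_deriv_mult schwartz_differentiable
        partial_deriv_eq[OF has_derivative_of_real_coord])
  then show "partial_deriv j h \<in> ?V"
    using schwartz_partial_deriv[OF f] schwartz_add[OF schwartz_cmult[OF f] schwartz_partial_deriv[OF g]]
    by (intro CollectI exI conjI)
  fix N
  obtain A where A: "\<And>x. (1 + norm x) ^ Suc N * norm (f x) \<le> A" using schwartz_decay[OF f] by metis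
  obtain B where B: "\<And>x. (1 + norm x) ^ N * norm (g x) \<le> B" using schwartz_decay[OF g] by metis
  have "(1 + norm x) ^ N * norm (h x) \<le> A + B" for x
  proof -
    have "norm (h x) \<le> (1 + norm x) * norm (f x) + norm (g x)"
      unfolding h using component_le_norm_cart[of x i]
      by (intro order_trans[OF norm_triangle_ineq] add_mono) (auto simp: norm_mult intro!: mult_right_mono)
    from mult_left_mono[OF this, of "(1 + norm x) ^ N"] show ?thesis
      using A[of x] B[of x] by (simp add: algebra_simps)
  qed
  then show "\<exists>C. \<forall>x. (1 + norm x) ^ N * norm (h x) \<le> C" by blast
qed

lemma bounded_linear_cart_sum:
  fixes l :: "real^'n::finite \<Rightarrow> real"
  assumes "bounded_linear l" shows "l x = (\<Sum>i\<in>UNIV. l (axis i 1) * x $ i)"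
proof -
  note lin = bounded_linear.linear[OF assms]
  have "l (\<Sum>i\<in>UNIV. x $ i *\<^sub>R axis i 1) = (\<Sum>i\<in>UNIV. x $ i * l (axis i 1))"
    unfolding linear_sum[OF lin] linear_scale[OF lin] by simp
  then show ?thesis by (simp add: basis_expansion[of x, unfolded scalar_mult_eq_scaleR] mult.commute)
qed

text \<open>\<open>f\<close> stays arbitrary in the induction because in a product
  \<open>P * Q\<close> the factor \<open>Q\<close> is first absorbed into \<open>f\<close>.\<close>

lemma schwartz_real_polynomial_mult:
  assumes "real_polynomial_function P" "f \<in> schwartz"
  shows "(\<lambda>x. complex_of_real (P x) * f x) \<in> schwartz"
  using assms
proof (induction arbitrary: f rule: real_polynomial_function.induct)
  case (linear l)
  have "(\<lambda>x. \<Sum>i\<in>UNIV. complex_of_real (l (axis i 1)) * (complex_of_real (x $ i) * f x)) \<in> schwartz"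
    by (intro schwartz_sum schwartz_cmult schwartz_coord_mult linear)
  moreover have "(\<lambda>x. complex_of_real (l x) * f x) =
      (\<lambda>x. \<Sum>i\<in>UNIV. complex_of_real (l (axis i 1)) * (complex_of_real (x $ i) * f x))"
    by (subst bounded_linear_cart_sum[OF linear(1)]) (simp add: sum_distrib_right mult.assoc)
  ultimately show ?case by simp
next
  case (const c)
  then show ?case by (simp add: schwartz_cmult)
next
  case (add P Q)
  from schwartz_add[OF add.IH(1)[OF add.prems] add.IH(2)[OF add.prems]] show ?case
    by (simp add: distrib_right)
next
  case (mult P Q)
  then show ?case by (simp add: mult.assoc)
qed

lemma iterated_deriv_zero_on_open:
  assumes "open U" "\<And>x. x \<in> U \<Longrightarrow> f x = 0" "x \<in> U"
  shows "iterated_deriv js f x = 0"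
  using assms(3)
proof (induction js arbitrary: x)
  case Nil
  then show ?case using assms by (simp add: iterated_deriv_def)
next
  case (Cons j js)
  have "((\<lambda>x. 0) has_derivative (\<lambda>_. 0)) (at x)" by simp
  then have "(iterated_deriv js f has_derivative (\<lambda>_. 0)) (at x)"
    by (rule has_derivative_transform_within_open[OF _ assms(1) Cons.prems]) (simp add: Cons.IH)
  from partial_deriv_eq[OF this] show ?case by (simp add: iterated_deriv_def)
qed

text \<open>Outside the ball all derivatives vanish, and on it the weighted derivatives are
  continuous on a compact set, hence bounded.\<close>

lemma schwartz_of_real_smooth:
  fixes g :: "real^'n::finite \<Rightarrow> real"
  assumes "smooth g" "supp g \<subseteq> cball 0 R"
  shows "(\<lambda>x. complex_of_real (g x)) \<in> schwartz"
proof (rule schwartz_closedI[where V="{\<lambda>x. complex_of_real (iterated_deriv js g x) | js. True}"])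
  show "(\<lambda>x. complex_of_real (g x)) \<in> {\<lambda>x. complex_of_real (iterated_deriv js g x) | js. True}" (is "_ \<in> ?V")
    by (auto intro!: exI[of _ "[]"] simp: iterated_deriv_def)
  fix h :: "real^'n \<Rightarrow> complex" and j
  assume "h \<in> ?V"
  then obtain js where h: "h = (\<lambda>x. complex_of_real (iterated_deriv js g x))" by blast
  have d: "iterated_deriv js g differentiable (at x)" for x
    using assms(1) by (simp add: smooth_def)
  have D: "(h has_derivative (\<lambda>v. complex_of_real (frechet_derivative (iterated_deriv js g) (at x) v))) (at x)" for x
    unfolding h using d[of x]
    by (intro bounded_linear.has_derivative[OF bounded_linear_of_real]) (simp add: frechet_derivative_works)
  show h_diff: "h differentiable (at x)" for x using D differentiable_def by blast
  have "partial_deriv j h = (\<lambda>x. complex_of_real (iterated_deriv (j # js) g x))"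
    using partial_deriv_eq[OF D] by (auto simp: fun_eq_iff iterated_deriv_def partial_deriv_def)
  then show "partial_deriv j h \<in> ?V" by blast
  fix N
  have zero: "h x = 0" if "x \<notin> cball 0 R" for x
  proof -
    have "iterated_deriv js g x = 0"
    proof (rule iterated_deriv_zero_on_open[of "- cball 0 R"])
      show "g y = 0" if "y \<in> - cball 0 R" for y
        using that assms(2) closure_subset[of "{x. g x \<noteq> 0}"] by (auto simp: supp_def)
    qed (use that in auto)
    then show ?thesis by (simp add: h)
  qed
  have "continuous_on (cball 0 R) (\<lambda>x. (1 + norm x) ^ N * norm (h x))"
    using h_diff by (intro continuous_intros continuous_at_imp_continuous_on)
       (auto intro: differentiable_imp_continuous_within)
  then have "bounded ((\<lambda>x. (1 + norm x) ^ N * norm (h x)) ` cball 0 R)"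
    by (intro compact_imp_bounded compact_continuous_image) auto
  then obtain B where "\<forall>y\<in>(\<lambda>x. (1 + norm x) ^ N * norm (h x)) ` cball 0 R. norm y \<le> B"
    unfolding bounded_iff by (elim exE)
  then have B: "norm ((1 + norm x) ^ N * norm (h x)) \<le> B" if "x \<in> cball 0 R" for x
    using that by (rule bspec[OF _ imageI])
  have "(1 + norm x) ^ N * norm (h x) \<le> max B 0" for x
  proof (cases "x \<in> cball 0 R")
    case True
    from B[OF this] show ?thesis unfolding real_norm_def by linarith
  qed (simp add: zero)
  then show "\<exists>C. \<forall>x. (1 + norm x) ^ N * norm (h x) \<le> C" by blast
qed

section \<open>The Fourier transform on Schwartz functions\<close>

lemma fourier_wave: "fourier f \<xi> = (\<integral>x. f x * wave (- \<xi>) x \<partial>lborel)"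
  by (simp add: fourier_def)

lemma inv_fourier_wave: "inv_fourier g x = (\<integral>\<xi>. g \<xi> * wave x \<xi> \<partial>lborel)"
  by (simp add: inv_fourier_def inner_commute)

lemma inv_fourier_eq_fourier: "inv_fourier g x = fourier g (- x)"
  by (simp add: inv_fourier_wave fourier_wave)

section \<open>Affine changes of variables and the integrable weight\<close>

lemma integral_affine:
  fixes f :: "real^'n::finite \<Rightarrow> 'b::{banach, second_countable_topology}"
  assumes [measurable]: "f \<in> borel_measurable borel" and "c \<noteq> 0"
  shows "(\<integral>x. f x \<partial>lborel) = (\<bar>c\<bar> ^ CARD('n)) *\<^sub>R (\<integral>x. f (t + c *\<^sub>R x) \<partial>lborel)"
proof -
  have "(\<integral>x. f x \<partial>lborel) =
      (\<integral>x. f x \<partial>density (distr lborel borel (\<lambda>x::real^'n. t + c *\<^sub>R x)) (\<lambda>_. \<bar>c\<bar> ^ DIM(real^'n)))"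
    using lborel_affine[OF assms(2), of t] by simp
  also have "\<dots> = (\<integral>x. \<bar>c\<bar> ^ CARD('n) *\<^sub>R f (t + c *\<^sub>R x) \<partial>lborel)"
    by (subst integral_density) (auto simp: integral_distr)
  finally show ?thesis by simp
qed

lemma integrable_affine:
  fixes f :: "real^'n::finite \<Rightarrow> 'b::{banach, second_countable_topology}"
  assumes "integrable lborel f" and "c \<noteq> 0"
  shows "integrable lborel (\<lambda>x. f (t + c *\<^sub>R x))"
proof -
  have [measurable]: "f \<in> borel_measurable borel" using assms(1) by auto
  have "integrable (density (distr lborel borel (\<lambda>x::real^'n. t + c *\<^sub>R x)) (\<lambda>_. \<bar>c\<bar> ^ DIM(real^'n))) f"
    using assms(1) lborel_affine[OF assms(2), of t] by simp
  then have "integrable lborel (\<lambda>x. \<bar>c\<bar> ^ DIM(real^'n) *\<^sub>R f (t + c *\<^sub>R x))"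
    by (subst (asm) integrable_density) (auto simp: integrable_distr_eq)
  from integrable_scaleR_right[OF this, of "1 / \<bar>c\<bar> ^ DIM(real^'n)"] show ?thesis
    using assms(2) by simp
qed

lemma nn_integral_affine:
  fixes f :: "real^'n::finite \<Rightarrow> ennreal"
  assumes [measurable]: "f \<in> borel_measurable borel" and "c \<noteq> 0"
  shows "(\<integral>\<^sup>+x. f x \<partial>lborel) = ennreal (\<bar>c\<bar> ^ CARD('n)) * (\<integral>\<^sup>+x. f (t + c *\<^sub>R x) \<partial>lborel)"
proof -
  have "(\<integral>\<^sup>+x. f x \<partial>lborel) =
      (\<integral>\<^sup>+x. f x \<partial>density (distr lborel borel (\<lambda>x::real^'n. t + c *\<^sub>R x)) (\<lambda>_. \<bar>c\<bar> ^ DIM(real^'n)))"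
    using lborel_affine[OF assms(2), of t] by simp
  also have "\<dots> = (\<integral>\<^sup>+x. ennreal (\<bar>c\<bar> ^ CARD('n)) * f (t + c *\<^sub>R x) \<partial>lborel)"
    by (subst nn_integral_density) (auto simp: nn_integral_distr nn_integral_cmult)
  finally show ?thesis by (simp add: nn_integral_cmult)
qed

text \<open>Since \<open>1 + (x \<bullet> b)\<^sup>2 \<le> (1 + norm x)\<^sup>2\<close>, the weight
  is dominated by a product of the one-dimensional functions \<open>inverse (1 + x\<^sup>2)\<close>.
  One square per coordinate explains the exponent \<open>2 * CARD('n)\<close>.\<close>

lemma integrable_decay:
  "integrable lborel (\<lambda>x::real^'n::finite. 1 / (1 + norm x) ^ (2 * CARD('n)))"
proof -
  have "set_integrable lborel UNIV (\<lambda>x::real. inverse (1 + x\<^sup>2))"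
    using integrable_inverse_1_plus_square by (simp add: einterval_eq)
  then have "integrable lborel (\<lambda>x::real. inverse (1 + x\<^sup>2))"
    by (simp add: set_integrable_def)
  then have fin: "(\<integral>\<^sup>+x. ennreal (inverse (1 + x\<^sup>2)) \<partial>(lborel :: real measure)) < \<infinity>"
    by (simp add: integrable_iff_bounded)
  have le: "1 / (1 + norm x) ^ (2 * CARD('n)) \<le> (\<Prod>b\<in>Basis. inverse (1 + (x \<bullet> b)\<^sup>2))" for x :: "real^'n"
  proof -
    have "(\<Prod>b\<in>Basis. 1 + (x \<bullet> b)\<^sup>2) \<le> (\<Prod>b\<in>(Basis::(real^'n) set). (1 + norm x)\<^sup>2)"
    proof (rule prod_mono, safe)
      fix b :: "real^'n" assume "b \<in> Basis"
      then have "\<bar>x \<bullet> b\<bar> \<le> norm x" by (rule Basis_le_norm)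
      then have "(x \<bullet> b)\<^sup>2 \<le> (norm x)\<^sup>2" using abs_le_square_iff by force
      then show "1 + (x \<bullet> b)\<^sup>2 \<le> (1 + norm x)\<^sup>2" using norm_ge_zero[of x] unfolding power2_sum power_one by linarith
    qed simp
    also have "\<dots> = (1 + norm x) ^ (2 * CARD('n))" by (simp add: power_mult)
    finally have "inverse ((1 + norm x) ^ (2 * CARD('n))) \<le> inverse (\<Prod>b\<in>Basis. 1 + (x \<bullet> b)\<^sup>2)"
      by (intro le_imp_inverse_le prod_pos) (auto intro: add_pos_nonneg)
    then show ?thesis by (simp add: prod_inversef[symmetric] o_def divide_inverse)
  qed
  have "(\<integral>\<^sup>+(x::real^'n). ennreal (1 / (1 + norm x) ^ (2 * CARD('n))) \<partial>lborel)
      \<le> (\<integral>\<^sup>+(x::real^'n). (\<Prod>b\<in>Basis. ennreal (inverse (1 + (x \<bullet> b)\<^sup>2))) \<partial>lborel)"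
    by (intro nn_integral_mono) (subst prod_ennreal, auto intro!: ennreal_leI le)
  also have "\<dots> = (\<Prod>b\<in>(Basis::(real^'n) set). \<integral>\<^sup>+x. ennreal (inverse (1 + x\<^sup>2)) \<partial>lborel)"
    by (rule nn_integral_lborel_prod) auto
  also have "\<dots> < \<infinity>" using fin by (simp add: power_less_top_ennreal)
  finally show ?thesis
    by (intro integrableI_bounded) auto
qed

text \<open>A single constant serves all centres, so integrals over many translated bumps add up to
  a multiple of their number.\<close>

lemma nn_integral_decay:
  obtains I :: real where "0 \<le> I"
    and "\<And>a::real^'n::finite. (\<integral>\<^sup>+x. ennreal (1 / (1 + norm (x - a)) ^ (2 * CARD('n))) \<partial>lborel) = ennreal I"
proof
  let ?w = "\<lambda>x::real^'n. 1 / (1 + norm x) ^ (2 * CARD('n))"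
  show "0 \<le> (\<integral>x. ?w x \<partial>lborel)" by (intro integral_nonneg_AE) simp
  have "(\<integral>\<^sup>+x. ennreal (?w x) \<partial>lborel) = ennreal (\<integral>x. ?w x \<partial>lborel)"
    by (rule nn_integral_eq_integral[OF integrable_decay]) simp
  then show "(\<integral>\<^sup>+x. ennreal (?w (x - a)) \<partial>lborel) = ennreal (\<integral>x. ?w x \<partial>lborel)" for a
    using nn_integral_affine[of "\<lambda>x. ennreal (?w (x - a))" 1 a] by simp
qed

lemma powr_minus_nat: "0 < x \<Longrightarrow> x powr (- real m) = 1 / x ^ m"
  by (simp add: powr_minus powr_realpow inverse_eq_divide)

lemma decay_le_weight:
  fixes f :: "'a::real_normed_vector \<Rightarrow> 'b::real_normed_vector"
  assumes "(1 + norm x) ^ N * norm (f x) \<le> C"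
  shows "norm (f x) \<le> C * (1 / (1 + norm x) ^ N)"
proof -
  have "0 < (1 + norm x) ^ N" by (simp add: add_pos_nonneg)
  then show ?thesis using assms by (simp add: field_simps)
qed

lemma integrable_of_decay:
  fixes f :: "real^'n::finite \<Rightarrow> complex"
  assumes "f \<in> borel_measurable borel"
    and "\<And>x. (1 + norm x) ^ (2 * CARD('n)) * norm (f x) \<le> C"
  shows "integrable lborel f"
proof (rule Bochner_Integration.integrable_bound)
  show "integrable lborel (\<lambda>x::real^'n. C * (1 / (1 + norm x) ^ (2 * CARD('n))))"
    by (intro integrable_mult_right integrable_decay)
  show "AE x in lborel. norm (f x) \<le> norm (C * (1 / (1 + norm x) ^ (2 * CARD('n))))"
  proof (rule AE_I2)
    fix x
    have "norm (f x) \<le> C * (1 / (1 + norm x) ^ (2 * CARD('n)))"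
      by (rule decay_le_weight[OF assms(2)])
    then show "norm (f x) \<le> norm (C * (1 / (1 + norm x) ^ (2 * CARD('n))))"
      unfolding real_norm_def by linarith
  qed
qed (use assms(1) in simp)

lemma schwartz_integrable:
  fixes f :: "real^'n::finite \<Rightarrow> complex"
  assumes "f \<in> schwartz" shows "integrable lborel f"
  using schwartz_decay[OF assms, of "2 * CARD('n)"] integrable_of_decay schwartz_measurable[OF assms]
  by metis

text \<open>The steps \<open>1 / real (m + 2)\<close> are positive and at most 1/2, which keeps
  shifted weights comparable in \<open>integral_partial_deriv\<close>.\<close>

lemma difference_quotient_tendsto:
  fixes f :: "real^'n::finite \<Rightarrow> 'b::real_normed_vector"
  assumes "f differentiable (at x)"
  shows "(\<lambda>m. real (m + 2) *\<^sub>R (f (x + (1 / real (m + 2)) *\<^sub>R axis j 1) - f x))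
    \<longlonglongrightarrow> partial_deriv j f x"
proof -
  let ?D = "frechet_derivative f (at x)"
  let ?h = "\<lambda>m. (1 / real (m + 2)) *\<^sub>R (axis j 1 :: real^'n)"
  have D: "(f has_derivative ?D) (at x)" using assms by (simp add: frechet_derivative_works)
  have nz: "?h m \<noteq> 0" for m by (simp add: axis_eq_0_iff)
  have "(\<lambda>m. 1 / real (m + 2)) \<longlonglongrightarrow> 0"
    using LIMSEQ_ignore_initial_segment[OF lim_1_over_n, of 2] by simp
  then have "?h \<longlonglongrightarrow> 0 *\<^sub>R axis j 1" by (intro tendsto_intros)
  then have lim0: "filterlim ?h (at 0) sequentially"
    using nz by (intro filterlim_atI) auto
  have "((\<lambda>h. norm (f (x + h) - f x - ?D h) / norm h) \<longlongrightarrow> 0) (at 0)"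
    using D by (simp add: has_derivative_at)
  from filterlim_compose[OF this lim0]
  have lim: "(\<lambda>m. norm (f (x + ?h m) - f x - ?D (?h m)) / norm (?h m)) \<longlonglongrightarrow> 0" .
  have "norm (f (x + ?h m) - f x - ?D (?h m)) / norm (?h m)
      = norm (real (m + 2) *\<^sub>R (f (x + ?h m) - f x) - ?D (axis j 1))" for m
  proof -
    have "?D (?h m) = (1 / real (m + 2)) *\<^sub>R ?D (axis j 1)"
      by (rule linear_scale[OF has_derivative_linear[OF D]])
    then have "real (m + 2) *\<^sub>R (f (x + ?h m) - f x) - ?D (axis j 1) =
        real (m + 2) *\<^sub>R (f (x + ?h m) - f x - ?D (?h m))"
      by (simp add: scaleR_diff_right)
    then have "norm (real (m + 2) *\<^sub>R (f (x + ?h m) - f x) - ?D (axis j 1)) =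
        real (m + 2) * norm (f (x + ?h m) - f x - ?D (?h m))"
      by (simp only: norm_scaleR abs_of_nat)
    then show ?thesis by (simp add: norm_axis_1)
  qed
  with lim have "(\<lambda>m. norm (real (m + 2) *\<^sub>R (f (x + ?h m) - f x) - ?D (axis j 1))) \<longlonglongrightarrow> 0"
    by simp
  then show ?thesis
    unfolding partial_deriv_def by (simp add: tendsto_norm_zero_iff Lim_null[symmetric])
qed

text \<open>Translation invariance makes every difference quotient integrate to zero; dominated
  convergence carries this over to the derivative.\<close>

lemma integral_partial_deriv:
  fixes f :: "real^'n::finite \<Rightarrow> complex"
  assumes f: "f \<in> schwartz"
  shows "(\<integral>x. partial_deriv j f x \<partial>lborel) = 0"
proof -
  let ?N = "2 * CARD('n)"
  obtain C where C: "C > 0" "\<And>x. (1 + norm x) ^ ?N * norm (partial_deriv j f x) \<le> C"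
    using schwartz_decay[OF schwartz_partial_deriv[OF f], of ?N j] by metis
  define h where "h m = (1 / real (m + 2)) *\<^sub>R (axis j 1 :: real^'n)" for m
  define s where "s m x = real (m + 2) *\<^sub>R (f (x + h m) - f x)" for m x
  note [measurable] = schwartz_measurable[OF f] schwartz_measurable[OF schwartz_partial_deriv[OF f]]
  have int: "integrable lborel (\<lambda>x. f (x + h m))" for m
    using integrable_affine[OF schwartz_integrable[OF f], of 1 "h m"] by (simp add: add.commute)
  have "(\<integral>x. f (x + h m) \<partial>lborel) = (\<integral>x. f x \<partial>lborel)" for m
    using integral_affine[of f 1 "h m"] by (simp add: add.commute)
  then have zero: "(\<integral>x. s m x \<partial>lborel) = 0" for m
    unfolding s_def using int schwartz_integrable[OF f] by simp
  have "(\<lambda>m. \<integral>x. s m x \<partial>lborel) \<longlonglongrightarrow> (\<integral>x. partial_deriv j f x \<partial>lborel)"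
  proof (rule integral_dominated_convergence)
    show "integrable lborel (\<lambda>x::real^'n. (C * 2 ^ ?N) * (1 / (1 + norm x) ^ ?N))"
      by (intro integrable_mult_right integrable_decay)
    show "AE x in lborel. (\<lambda>m. s m x) \<longlonglongrightarrow> partial_deriv j f x"
      unfolding s_def h_def by (intro AE_I2 difference_quotient_tendsto schwartz_differentiable f)
    show "AE x in lborel. norm (s m x) \<le> (C * 2 ^ ?N) * (1 / (1 + norm x) ^ ?N)" for m
    proof (rule AE_I2)
      fix x :: "real^'n"
      let ?e = "axis j 1 :: real^'n" and ?t = "1 / real (m + 2)"
      have der: "((\<lambda>t. f (x + t *\<^sub>R ?e)) has_derivative (\<lambda>v. v *\<^sub>R partial_deriv j f (x + t *\<^sub>R ?e))) (at t)" for t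
      proof -
        let ?D = "frechet_derivative f (at (x + t *\<^sub>R ?e))"
        have "((\<lambda>t. x + t *\<^sub>R ?e) has_derivative (\<lambda>v. v *\<^sub>R ?e)) (at t)"
          by (auto intro!: derivative_eq_intros)
        from has_derivative_compose[OF this has_derivative_schwartz[OF f]]
        have "((\<lambda>t. f (x + t *\<^sub>R ?e)) has_derivative (\<lambda>v. ?D (v *\<^sub>R ?e))) (at t)" .
        then show ?thesis
          using linear_scale[OF has_derivative_linear[OF has_derivative_schwartz[OF f]]]
          by (simp add: partial_deriv_def)
      qed
      \<comment> \<open>The mean value inequality bounds the quotient by the derivative at a point
        within 1/2 of \<open>x\<close>; returning to the weight at \<open>x\<close> costs the factor
        \<open>2 ^ ?N\<close>.\<close>
      have "\<exists>r\<in>{0<..<?t}. norm (f (x + ?t *\<^sub>R ?e) - f (x + 0 *\<^sub>R ?e))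
          \<le> norm ((?t - 0) *\<^sub>R partial_deriv j f (x + r *\<^sub>R ?e))"
      proof (rule mvt_general)
        show "continuous_on {0..?t} (\<lambda>t. f (x + t *\<^sub>R ?e))"
          using der by (auto intro!: continuous_at_imp_continuous_on has_derivative_continuous)
      qed (use der in auto)
      then obtain r where r: "0 < r" "r < ?t"
        and "norm (f (x + ?t *\<^sub>R ?e) - f x) \<le> ?t * norm (partial_deriv j f (x + r *\<^sub>R ?e))"
        by auto
      then have "real (m + 2) * norm (f (x + ?t *\<^sub>R ?e) - f x)
          \<le> real (m + 2) * (?t * norm (partial_deriv j f (x + r *\<^sub>R ?e)))"
        by (intro mult_left_mono) auto
      then have "norm (s m x) \<le> norm (partial_deriv j f (x + r *\<^sub>R ?e))"
        by (simp add: s_def h_def)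
      also have "\<dots> \<le> C * (1 / (1 + norm (x + r *\<^sub>R ?e)) ^ ?N)"
        by (rule decay_le_weight[OF C(2)])
      also have "\<dots> \<le> C * (2 ^ ?N * (1 / (1 + norm x) ^ ?N))"
      proof (rule mult_left_mono)
        have "?t \<le> 1/2" by (simp add: field_simps)
        then have "r \<le> 1/2" using r by linarith
        moreover have "norm x \<le> norm (x + r *\<^sub>R ?e) + norm (r *\<^sub>R ?e)"
          by (metis add_diff_cancel_right' norm_triangle_ineq4)
        ultimately have "1 + norm x \<le> 2 * (1 + norm (x + r *\<^sub>R ?e))"
          using abs_of_pos[OF r(1)] norm_ge_zero[of "x + r *\<^sub>R ?e"] unfolding norm_scaleR norm_axis_1 by argo
        from power_mono[OF this, of ?N]
        have "(1 + norm x) ^ ?N \<le> 2 ^ ?N * (1 + norm (x + r *\<^sub>R ?e)) ^ ?N"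
          by (simp only: power_mult_distrib) simp
        moreover have "0 < (1 + norm x) ^ ?N" "0 < (1 + norm (x + r *\<^sub>R ?e)) ^ ?N"
          by (simp_all add: add_pos_nonneg)
        ultimately show "1 / (1 + norm (x + r *\<^sub>R ?e)) ^ ?N \<le> 2 ^ ?N * (1 / (1 + norm x) ^ ?N)"
          by (simp add: field_simps)
      qed (use C in simp)
      finally show "norm (s m x) \<le> (C * 2 ^ ?N) * (1 / (1 + norm x) ^ ?N)" by (simp add: mult.assoc)
    qed
    show "s m \<in> borel_measurable lborel" for m
      unfolding s_def by measurable
  qed measurable
  with zero show ?thesis by (simp add: LIMSEQ_const_iff)
qed

text \<open>The derivative of \<open>wave (- \<xi>) x * f x\<close> integrates to zero, and the
  product rule splits it into the two terms of the identity.\<close>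

lemma fourier_partial_deriv:
  fixes f :: "real^'n::finite \<Rightarrow> complex"
  assumes f: "f \<in> schwartz"
  shows "fourier (partial_deriv j f) \<xi> = complex_of_real (2 * pi * \<xi> $ j) * (\<i> * fourier f \<xi>)"
proof -
  have "partial_deriv j (\<lambda>x. wave (- \<xi>) x * f x) x =
      partial_deriv j f x * wave (- \<xi>) x - (complex_of_real (2 * pi * \<xi> $ j) * \<i>) * (f x * wave (- \<xi>) x)" for x
    unfolding partial_deriv_mult[OF differentiable_wave schwartz_differentiable[OF f]] partial_deriv_wave
    by (simp add: algebra_simps)
  moreover have "integrable lborel (\<lambda>x. partial_deriv j f x * wave (- \<xi>) x)"
    "integrable lborel (\<lambda>x. f x * wave (- \<xi>) x)"
    using schwartz_integrable[OF schwartz_wave_mult[OF schwartz_partial_deriv[OF f]], of "- \<xi>" j]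
      schwartz_integrable[OF schwartz_wave_mult[OF f], of "- \<xi>"]
    by (simp_all add: mult.commute)
  ultimately show ?thesis
    using integral_partial_deriv[OF schwartz_wave_mult[OF f], of j "- \<xi>"]
    by (simp add: fourier_wave)
qed

section \<open>Decay of transforms and the multiplication formula\<close>

lemma norm_fourier_le: "norm (fourier f \<xi>) \<le> (\<integral>x. norm (f x) \<partial>lborel)"
  unfolding fourier_wave by (rule order_trans[OF integral_norm_bound]) (simp add: norm_mult)

text \<open>Induction on the power, over all Schwartz functions at once: a factor
  \<open>norm \<xi>\<close> is at most the sum of the moduli of the coordinates, and each coordinate
  is traded for a partial derivative of \<open>f\<close>, where \<open>2 * pi \<ge> 1\<close> is
  dropped.\<close>

lemma fourier_decay:
  fixes f :: "real^'n::finite \<Rightarrow> complex"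
  assumes "f \<in> schwartz"
  obtains C where "C > 0" "\<And>\<xi>. (1 + norm \<xi>) ^ N * norm (fourier f \<xi>) \<le> C"
proof -
  have "\<exists>C. \<forall>\<xi>. (1 + norm \<xi>) ^ N * norm (fourier f \<xi>) \<le> C"
    using assms
  proof (induction N arbitrary: f)
    case 0
    then show ?case using norm_fourier_le by (auto intro!: exI)
  next
    case (Suc N)
    obtain A where A: "\<And>\<xi>. (1 + norm \<xi>) ^ N * norm (fourier f \<xi>) \<le> A"
      using Suc by metis
    have "\<forall>j. \<exists>B. \<forall>\<xi>. (1 + norm \<xi>) ^ N * norm (fourier (partial_deriv j f) \<xi>) \<le> B"
      using Suc by (simp add: schwartz_partial_deriv)
    then obtain B where B: "\<And>j \<xi>. (1 + norm \<xi>) ^ N * norm (fourier (partial_deriv j f) \<xi>) \<le> B j"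
      by metis
    have "(1 + norm \<xi>) ^ Suc N * norm (fourier f \<xi>) \<le> A + (\<Sum>j\<in>UNIV. B j)" for \<xi> :: "real^'n"
    proof -
      let ?P = "(1 + norm \<xi>) ^ N"
      have "\<bar>\<xi> $ j\<bar> * norm (fourier f \<xi>) \<le> norm (fourier (partial_deriv j f) \<xi>)" for j
      proof -
        have "1 * (\<bar>\<xi> $ j\<bar> * norm (fourier f \<xi>)) \<le> (2 * pi) * (\<bar>\<xi> $ j\<bar> * norm (fourier f \<xi>))"
          using pi_gt3 by (intro mult_right_mono) auto
        then show ?thesis by (simp add: fourier_partial_deriv[OF Suc.prems] norm_mult abs_mult)
      qed
      then have "(\<Sum>j\<in>UNIV. \<bar>\<xi> $ j\<bar> * norm (fourier f \<xi>)) \<le> (\<Sum>j\<in>UNIV. norm (fourier (partial_deriv j f) \<xi>))"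
        by (rule sum_mono)
      moreover have "norm \<xi> * norm (fourier f \<xi>) \<le> (\<Sum>j\<in>UNIV. \<bar>\<xi> $ j\<bar>) * norm (fourier f \<xi>)"
        by (intro mult_right_mono norm_le_l1_cart) simp
      ultimately have "norm \<xi> * norm (fourier f \<xi>) \<le> (\<Sum>j\<in>UNIV. norm (fourier (partial_deriv j f) \<xi>))"
        by (simp add: sum_distrib_right)
      from mult_left_mono[OF this, of ?P]
      have "?P * (norm \<xi> * norm (fourier f \<xi>)) \<le> (\<Sum>j\<in>UNIV. ?P * norm (fourier (partial_deriv j f) \<xi>))"
        by (simp add: sum_distrib_left)
      also have "\<dots> \<le> (\<Sum>j\<in>UNIV. B j)" by (intro sum_mono B)
      finally show ?thesis using A[of \<xi>] by (simp add: algebra_simps)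
    qed
    then show ?case by blast
  qed
  then obtain C where "\<And>\<xi>. (1 + norm \<xi>) ^ N * norm (fourier f \<xi>) \<le> C" by blast
  then show thesis by (intro that[of "max C 1"]) (auto simp: le_max_iff_disj)
qed

lemma fourier_measurable[measurable]:
  fixes f :: "real^'n::finite \<Rightarrow> complex"
  assumes [measurable]: "f \<in> borel_measurable borel"
  shows "fourier f \<in> borel_measurable borel"
proof -
  have "(\<lambda>\<xi>. \<integral>x. f x * cis (- 2 * pi * (x \<bullet> \<xi>)) \<partial>lborel) \<in> borel_measurable borel"
    by measurable
  then show ?thesis by (simp add: fourier_def[abs_def])
qed

lemma fourier_integrable:
  fixes f :: "real^'n::finite \<Rightarrow> complex"
  assumes "f \<in> schwartz" shows "integrable lborel (fourier f)"
  using fourier_decay[OF assms, of "2 * CARD('n)"] integrable_of_decay schwartz_measurable[OF assms]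
    fourier_measurable by metis

text \<open>Both sides are the same double integral; Fubini applies because the integrand has
  modulus \<open>norm (f x) * norm (g y)\<close>.\<close>

lemma fourier_multiplication_formula:
  fixes f g :: "real^'n::finite \<Rightarrow> complex"
  assumes f: "integrable lborel f" and g: "integrable lborel g"
  shows "(\<integral>x. fourier f x * g x \<partial>lborel) = (\<integral>y. f y * fourier g y \<partial>lborel)"
proof -
  have [measurable]: "f \<in> borel_measurable borel" "g \<in> borel_measurable borel"
    using f g by auto
  have "integrable (lborel \<Otimes>\<^sub>M lborel) (\<lambda>(x, y). f x * (g y * wave (- x) y))"
  proof (rule lborel_pair.Fubini_integrable)
    show "(\<lambda>(x, y). f x * (g y * wave (- x) y)) \<in> borel_measurable (lborel \<Otimes>\<^sub>M lborel)"
      by measurable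
    have "(\<lambda>x. \<integral>y. norm (case (x, y) of (x, y) \<Rightarrow> f x * (g y * wave (- x) y)) \<partial>lborel)
        = (\<lambda>x. norm (f x) * (\<integral>y. norm (g y) \<partial>lborel))"
      using g by (simp add: norm_mult)
    then show "integrable lborel (\<lambda>x. \<integral>y. norm (case (x, y) of (x, y) \<Rightarrow> f x * (g y * wave (- x) y)) \<partial>lborel)"
      using f by simp
    show "AE x in lborel. integrable lborel (\<lambda>y. case (x, y) of (x, y) \<Rightarrow> f x * (g y * wave (- x) y))"
    proof (rule AE_I2)
      fix x
      have "integrable lborel (\<lambda>y. g y * wave (- x) y)"
        by (rule Bochner_Integration.integrable_bound[OF g]) (auto simp: norm_mult)
      then show "integrable lborel (\<lambda>y. case (x, y) of (x, y) \<Rightarrow> f x * (g y * wave (- x) y))" by simp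
    qed
  qed
  from lborel_pair.Fubini_integral[OF this]
  have swap: "(\<integral>y. \<integral>x. f x * (g y * wave (- x) y) \<partial>lborel \<partial>lborel) = (\<integral>x. \<integral>y. f x * (g y * wave (- x) y) \<partial>lborel \<partial>lborel)" .
  have 1: "(\<integral>y. f x * (g y * wave (- x) y) \<partial>lborel) = f x * fourier g x" for x
    by (simp add: fourier_wave)
  have 2: "(\<integral>x. f x * (g y * wave (- x) y) \<partial>lborel) = fourier f y * g y" for y
  proof -
    have "(\<lambda>x. f x * (g y * wave (- x) y)) = (\<lambda>x. g y * (f x * wave (- y) x))"
      by (simp add: inner_commute ac_simps)
    then show ?thesis by (simp add: fourier_wave mult.commute)
  qed
  show ?thesis using swap unfolding 1 2 .
qed

section \<open>Fourier inversion\<close>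

text \<open>The standard normal density, written as a product so that its transform factors into
  characteristic functions of one-dimensional normal laws.\<close>

definition gauss :: "real^'n::finite \<Rightarrow> real" where
  "gauss x = (\<Prod>b\<in>Basis. std_normal_density (x \<bullet> b))"

lemma gauss_altdef: "gauss (x :: real^'n::finite) = (1 / sqrt (2 * pi)) ^ CARD('n) * exp (- (norm x)\<^sup>2 / 2)"
proof -
  have "(\<Sum>b\<in>Basis. - (x \<bullet> b)\<^sup>2 / 2) = - (norm x)\<^sup>2 / 2"
    unfolding power2_norm_eq_inner euclidean_inner[of x x]
    by (simp add: sum_negf sum_divide_distrib power2_eq_square)
  then show ?thesis
    unfolding gauss_def std_normal_density_def prod.distrib prod_constant exp_sum[OF finite_Basis, symmetric]
    by simp
qed

lemma gauss_nonneg: "0 \<le> gauss x"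
  by (simp add: gauss_altdef)

lemma gauss_le: "gauss (x :: real^'n::finite) \<le> gauss (0 :: real^'n)"
  unfolding gauss_altdef by (intro mult_left_mono) auto

lemma gauss_pos: "0 < gauss x"
  by (simp add: gauss_altdef)

lemma continuous_gauss: "continuous_on A gauss"
  unfolding gauss_altdef[abs_def] by (intro continuous_intros) auto

lemma gauss_measurable[measurable]: "gauss \<in> borel_measurable borel"
  by (intro borel_measurable_continuous_onI continuous_gauss)

lemma gauss_integrable: "integrable lborel (gauss :: real^'n::finite \<Rightarrow> real)"
proof (intro integrableI_bounded)
  have "(\<integral>\<^sup>+(x::real^'n). norm (gauss x) \<partial>lborel) =
      (\<integral>\<^sup>+(x::real^'n). (\<Prod>b\<in>Basis. ennreal (std_normal_density (x \<bullet> b))) \<partial>lborel)"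
    by (intro nn_integral_cong) (subst prod_ennreal, auto simp: gauss_def prod_nonneg)
  also have "\<dots> = (\<Prod>b\<in>(Basis::(real^'n) set). \<integral>\<^sup>+x. ennreal (std_normal_density x) \<partial>lborel)"
    by (rule nn_integral_lborel_prod) auto
  also have "(\<integral>\<^sup>+x. ennreal (std_normal_density x) \<partial>lborel) < \<infinity>"
    using integrable_normal_moment[of 1 0 0] by (simp add: integrable_iff_bounded)
  then have "(\<Prod>b\<in>(Basis::(real^'n) set). \<integral>\<^sup>+x. ennreal (std_normal_density x) \<partial>lborel) < \<infinity>"
    by (simp add: power_less_top_ennreal)
  finally show "(\<integral>\<^sup>+(x::real^'n). norm (gauss x) \<partial>lborel) < \<infinity>" .
qed simp

lemma inv_fourier_gauss:
  fixes \<xi> :: "real^'n::finite"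
  shows "inv_fourier (\<lambda>x. complex_of_real (gauss x)) \<xi> = complex_of_real (exp (- (norm ((2 * pi) *\<^sub>R \<xi>))\<^sup>2 / 2))"
proof -
  interpret P: product_sigma_finite "\<lambda>_::real^'n. lborel :: real measure" ..
  define g where "g b u = complex_of_real (std_normal_density u) * cis (2 * pi * (\<xi> \<bullet> b) * u)"
    for b :: "real^'n" and u
  have g_int: "integrable lborel (g b)" for b
  proof (rule Bochner_Integration.integrable_bound)
    show "integrable lborel std_normal_density" using integrable_normal_moment[of 1 0 0] by simp
    show "g b \<in> borel_measurable lborel" unfolding g_def by measurable
  qed (auto simp: g_def norm_mult)
  have g_val: "(\<integral>u. g b u \<partial>lborel) = complex_of_real (exp (- (2 * pi * (\<xi> \<bullet> b))\<^sup>2 / 2))" for b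
  proof -
    have "char std_normal_distribution (2 * pi * (\<xi> \<bullet> b)) = (\<integral>u. g b u \<partial>lborel)"
      unfolding char_def
      by (subst integral_density) (auto simp: g_def[abs_def] cis_conv_exp scaleR_conv_of_real mult.assoc)
    then show ?thesis by (simp add: char_std_normal_distribution)
  qed
  have prod: "complex_of_real (gauss x) * cis (2 * pi * (x \<bullet> \<xi>)) = (\<Prod>b\<in>Basis. g b (x \<bullet> b))" for x
  proof -
    have "cis (2 * pi * (x \<bullet> \<xi>)) = exp (\<Sum>b\<in>Basis. \<i> * complex_of_real (2 * pi * (\<xi> \<bullet> b) * (x \<bullet> b)))"
      unfolding cis_conv_exp euclidean_inner[of x \<xi>]
      by (simp add: sum_distrib_left ac_simps)
    also have "\<dots> = (\<Prod>b\<in>Basis. cis (2 * pi * (\<xi> \<bullet> b) * (x \<bullet> b)))"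
      by (simp add: exp_sum cis_conv_exp)
    finally show ?thesis by (simp add: g_def gauss_def prod.distrib)
  qed
  have [measurable]: "(\<lambda>x. \<Prod>b\<in>Basis. g b (x \<bullet> b)) \<in> borel_measurable (borel :: (real^'n) measure)"
    unfolding g_def by measurable
  have "inv_fourier (\<lambda>x. complex_of_real (gauss x)) \<xi> = (\<integral>x. (\<Prod>b\<in>Basis. g b (x \<bullet> b)) \<partial>lborel)"
    unfolding inv_fourier_wave prod ..
  \<comment> \<open>Lebesgue measure is rewritten as the image of a product measure, so that the
    integral of a product becomes a product of integrals.\<close>
  also have "\<dots> = (\<integral>x. (\<Prod>b\<in>Basis. g b (x \<bullet> b))
      \<partial>distr (\<Pi>\<^sub>M b\<in>Basis. lborel) borel (\<lambda>f. \<Sum>b\<in>(Basis::(real^'n) set). f b *\<^sub>R b))"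
    by (subst lborel_eq) (rule refl)
  also have "\<dots> = (\<integral>f. (\<Prod>b\<in>Basis. g b ((\<Sum>c\<in>(Basis::(real^'n) set). f c *\<^sub>R c) \<bullet> b)) \<partial>(\<Pi>\<^sub>M b\<in>Basis. lborel))"
    by (rule integral_distr) measurable
  also have "\<dots> = (\<integral>f. (\<Prod>b\<in>Basis. g b (f b)) \<partial>(\<Pi>\<^sub>M b\<in>(Basis::(real^'n) set). lborel))"
    by (intro Bochner_Integration.integral_cong refl prod.cong) simp
  also have "\<dots> = (\<Prod>b\<in>Basis. integral\<^sup>L lborel (g b))"
    by (rule P.product_integral_prod) (auto simp: g_int)
  also have "\<dots> = complex_of_real (exp (\<Sum>b\<in>Basis. - (2 * pi * (\<xi> \<bullet> b))\<^sup>2 / 2))"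
    by (simp add: g_val exp_sum)
  also have "(\<Sum>b\<in>Basis. - (2 * pi * (\<xi> \<bullet> b))\<^sup>2 / 2) = - (norm ((2 * pi) *\<^sub>R \<xi>))\<^sup>2 / 2"
    unfolding power2_norm_eq_inner euclidean_inner[of "(2 * pi) *\<^sub>R \<xi>" "(2 * pi) *\<^sub>R \<xi>"]
    by (simp add: sum_negf sum_divide_distrib power2_eq_square)
  finally show ?thesis .
qed

text \<open>Up to a dilation and a constant the Gaussian is its own transform; this yields both the
  integrability and the total integral of the transform.\<close>

lemma inv_fourier_gauss_eq:
  fixes \<xi> :: "real^'n::finite"
  shows "inv_fourier (\<lambda>x. complex_of_real (gauss x)) \<xi> =
    complex_of_real (sqrt (2 * pi) ^ CARD('n) * gauss ((2 * pi) *\<^sub>R \<xi>))"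
  unfolding inv_fourier_gauss gauss_altdef[of "(2 * pi) *\<^sub>R \<xi>"] by (simp add: power_one_over)

lemma integral_gauss: "(\<integral>x. gauss x \<partial>lborel) = (1 :: real)"
proof -
  have "(\<integral>x. complex_of_real (gauss (x :: real^'n::finite)) \<partial>lborel) = 1"
    using inv_fourier_gauss[of "0 :: real^'n"] by (simp add: inv_fourier_wave)
  then show ?thesis by (metis integral_complex_of_real of_real_eq_1_iff)
qed

lemma inv_fourier_gauss_integrable:
  "integrable lborel (inv_fourier (\<lambda>x::real^'n::finite. complex_of_real (gauss x)))"
proof -
  have "integrable lborel (\<lambda>\<xi>::real^'n. complex_of_real (sqrt (2 * pi) ^ CARD('n) * gauss (0 + (2 * pi) *\<^sub>R \<xi>)))"
    by (intro integrable_of_real integrable_mult_right integrable_affine gauss_integrable) simp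
  then show ?thesis unfolding inv_fourier_gauss_eq[abs_def] by simp
qed

text \<open>This is inversion for the Gaussian at the origin. Its value is the nonzero factor
  cancelled at the end of \<open>fourier_inversion\<close>.\<close>

lemma integral_inv_fourier_gauss:
  "(\<integral>\<xi>. inv_fourier (\<lambda>x::real^'n::finite. complex_of_real (gauss x)) \<xi> \<partial>lborel) = complex_of_real (gauss (0 :: real^'n))"
proof -
  let ?I = "\<integral>\<xi>. gauss ((2 * pi) *\<^sub>R \<xi>) \<partial>(lborel :: (real^'n) measure)"
  have I: "1 = (2 * pi) ^ CARD('n) * ?I"
    using integral_affine[of "gauss :: real^'n \<Rightarrow> real" "2 * pi" 0] by (simp add: integral_gauss)
  have "(sqrt (2 * pi)) ^ CARD('n) * ?I = gauss (0 :: real^'n)"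
  proof -
    have "(2 * pi) ^ CARD('n) = sqrt (2 * pi) ^ CARD('n) * sqrt (2 * pi) ^ CARD('n)"
      by (subst power_mult_distrib[symmetric]) simp
    with I have "sqrt (2 * pi) ^ CARD('n) * ?I * sqrt (2 * pi) ^ CARD('n) = 1"
      by (metis mult.assoc mult.commute)
    then have "sqrt (2 * pi) ^ CARD('n) * ?I = 1 / sqrt (2 * pi) ^ CARD('n)"
      by (intro eq_divide_imp) simp_all
    then show ?thesis by (simp add: gauss_altdef power_one_over)
  qed
  then show ?thesis
    unfolding inv_fourier_gauss_eq integral_complex_of_real integral_mult_right_zero by simp
qed

text \<open>Gaussian regularisation. The multiplication formula equates a damped inversion integral
  with an average of \<open>f\<close> at distances of order \<open>\<epsilon> m\<close> from
  \<open>x\<close>; dominated convergence on both sides leaves the same factor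
  \<open>gauss 0\<close>.\<close>

theorem fourier_inversion:
  fixes f :: "real^'n::finite \<Rightarrow> complex"
  assumes f: "f \<in> schwartz"
  shows "inv_fourier (fourier f) x = f x"
proof -
  define G :: "real^'n \<Rightarrow> complex" where "G = inv_fourier (\<lambda>x. complex_of_real (gauss x))"
  define \<epsilon> where "\<epsilon> m = 1 / real (Suc m)" for m
  have \<epsilon>: "\<epsilon> m > 0" for m by (simp add: \<epsilon>_def)
  have \<epsilon>0: "\<epsilon> \<longlonglongrightarrow> 0" unfolding \<epsilon>_def using LIMSEQ_inverse_real_of_nat by (simp add: inverse_eq_divide)
  note [measurable] = schwartz_measurable[OF f]
  have Gm[measurable]: "G \<in> borel_measurable borel"
    unfolding G_def inv_fourier_gauss_eq[abs_def] by measurable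
  obtain C where "C > 0" and C: "\<And>x. norm (f x) \<le> C" using schwartz_bounded[OF f] by blast
  have eq: "(\<integral>\<xi>. fourier f \<xi> * (complex_of_real (gauss (\<epsilon> m *\<^sub>R \<xi>)) * wave x \<xi>) \<partial>lborel) =
      (\<integral>z. f (x - \<epsilon> m *\<^sub>R z) * G z \<partial>lborel)" for m
  proof -
    define K where "K \<xi> = complex_of_real (gauss (\<epsilon> m *\<^sub>R \<xi>)) * wave x \<xi>" for \<xi>
    have [measurable]: "K \<in> borel_measurable borel" unfolding K_def by measurable
    have K_int: "integrable lborel K"
    proof (rule Bochner_Integration.integrable_bound)
      show "integrable lborel (\<lambda>\<xi>::real^'n. gauss (0 + \<epsilon> m *\<^sub>R \<xi>))"
        using \<epsilon>[of m] by (intro integrable_affine gauss_integrable) auto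
    qed (auto simp: K_def norm_mult)
    \<comment> \<open>The transform of the damped wave is a rescaled copy of \<open>G\<close>
      centred at \<open>x\<close>: up to a constant factor, an approximate identity.\<close>
    have K_four: "fourier K y = (1 / \<epsilon> m) ^ CARD('n) *\<^sub>R G ((1 / \<epsilon> m) *\<^sub>R (x + - y))" for y
    proof -
      have "fourier K y = (\<integral>\<xi>. complex_of_real (gauss (\<epsilon> m *\<^sub>R \<xi>)) * wave (x + - y) \<xi> \<partial>lborel)"
        unfolding K_def fourier_wave wave_add_freq by (simp only: mult.assoc)
      also have "\<dots> = \<bar>1 / \<epsilon> m\<bar> ^ CARD('n) *\<^sub>R (\<integral>\<xi>. complex_of_real (gauss (\<epsilon> m *\<^sub>R (0 + (1 / \<epsilon> m) *\<^sub>R \<xi>)))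
          * wave (x + - y) (0 + (1 / \<epsilon> m) *\<^sub>R \<xi>) \<partial>lborel)"
        using \<epsilon>[of m] by (intro integral_affine) auto
      also have "\<dots> = \<bar>1 / \<epsilon> m\<bar> ^ CARD('n) *\<^sub>R G ((1 / \<epsilon> m) *\<^sub>R (x + - y))"
        using \<epsilon>[of m] by (simp add: G_def inv_fourier_wave)
      finally show ?thesis using \<epsilon>[of m] by simp
    qed
    have "(\<integral>\<xi>. fourier f \<xi> * K \<xi> \<partial>lborel) = (\<integral>y. f y * fourier K y \<partial>lborel)"
      by (intro fourier_multiplication_formula schwartz_integrable f K_int)
    also have "\<dots> = (1 / \<epsilon> m) ^ CARD('n) *\<^sub>R (\<integral>y. f y * G ((1 / \<epsilon> m) *\<^sub>R (x + - y)) \<partial>lborel)"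
      by (simp add: K_four)
    \<comment> \<open>The substitution \<open>y = x - \<epsilon> m *\<^sub>R z\<close> undoes the
      dilation of \<open>G\<close> and cancels the factor in front.\<close>
    also have "(\<integral>y. f y * G ((1 / \<epsilon> m) *\<^sub>R (x + - y)) \<partial>lborel) =
        \<bar>- \<epsilon> m\<bar> ^ CARD('n) *\<^sub>R (\<integral>z. f (x + (- \<epsilon> m) *\<^sub>R z) * G ((1 / \<epsilon> m) *\<^sub>R (x + - (x + (- \<epsilon> m) *\<^sub>R z))) \<partial>lborel)"
      using \<epsilon>[of m] by (intro integral_affine) auto
    also have "(1 / \<epsilon> m) ^ CARD('n) *\<^sub>R \<dots> = (\<integral>z. f (x - \<epsilon> m *\<^sub>R z) * G z \<partial>lborel)"
      using \<epsilon>[of m] by (simp add: power_one_over)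
    finally show ?thesis by (simp add: K_def)
  qed
  have lim1: "(\<lambda>m. \<integral>z. f (x - \<epsilon> m *\<^sub>R z) * G z \<partial>lborel) \<longlonglongrightarrow> (\<integral>z. f x * G z \<partial>lborel)"
  proof (rule integral_dominated_convergence)
    show "integrable lborel (\<lambda>z. C * norm (G z))"
      unfolding G_def by (intro integrable_mult_right integrable_norm inv_fourier_gauss_integrable)
    show "AE z in lborel. (\<lambda>m. f (x - \<epsilon> m *\<^sub>R z) * G z) \<longlonglongrightarrow> f x * G z"
    proof (intro AE_I2 tendsto_mult tendsto_const)
      fix z
      have "(\<lambda>m. x - \<epsilon> m *\<^sub>R z) \<longlonglongrightarrow> x - 0 *\<^sub>R z" by (intro tendsto_intros \<epsilon>0)
      moreover have "isCont f x"
        using schwartz_continuous[OF f, of UNIV] by (simp add: continuous_on_eq_continuous_at)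
      ultimately show "(\<lambda>m. f (x - \<epsilon> m *\<^sub>R z)) \<longlonglongrightarrow> f x"
        by (auto intro: isCont_tendsto_compose)
    qed
    show "AE z in lborel. norm (f (x - \<epsilon> m *\<^sub>R z) * G z) \<le> C * norm (G z)" for m
      by (intro AE_I2) (simp add: norm_mult mult_right_mono C)
  qed measurable
  have val1: "(\<integral>z. f x * G z \<partial>lborel) = f x * complex_of_real (gauss (0 :: real^'n))"
    unfolding G_def by (simp add: integral_inv_fourier_gauss)
  have lim2: "(\<lambda>m. \<integral>\<xi>. fourier f \<xi> * (complex_of_real (gauss (\<epsilon> m *\<^sub>R \<xi>)) * wave x \<xi>) \<partial>lborel)
      \<longlonglongrightarrow> (\<integral>\<xi>. fourier f \<xi> * (complex_of_real (gauss (0 :: real^'n)) * wave x \<xi>) \<partial>lborel)"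
  proof (rule integral_dominated_convergence)
    show "integrable lborel (\<lambda>\<xi>. gauss (0::real^'n) * norm (fourier f \<xi>))"
      by (intro integrable_mult_right integrable_norm fourier_integrable f)
    show "AE \<xi> in lborel. (\<lambda>m. fourier f \<xi> * (complex_of_real (gauss (\<epsilon> m *\<^sub>R \<xi>)) * wave x \<xi>))
        \<longlonglongrightarrow> fourier f \<xi> * (complex_of_real (gauss (0 :: real^'n)) * wave x \<xi>)"
    proof (intro AE_I2 tendsto_mult tendsto_const tendsto_of_real)
      fix \<xi> :: "real^'n"
      have "(\<lambda>m. \<epsilon> m *\<^sub>R \<xi>) \<longlonglongrightarrow> 0 *\<^sub>R \<xi>" by (intro tendsto_intros \<epsilon>0)
      moreover have "isCont (gauss :: real^'n \<Rightarrow> real) 0"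
        unfolding gauss_altdef[abs_def] by (intro continuous_intros) auto
      ultimately show "(\<lambda>m. gauss (\<epsilon> m *\<^sub>R \<xi>)) \<longlonglongrightarrow> gauss (0::real^'n)"
        by (auto intro: isCont_tendsto_compose)
    qed
    show "AE \<xi> in lborel. norm (fourier f \<xi> * (complex_of_real (gauss (\<epsilon> m *\<^sub>R \<xi>)) * wave x \<xi>))
        \<le> gauss (0::real^'n) * norm (fourier f \<xi>)" for m
      by (intro AE_I2)
         (simp add: norm_mult abs_of_nonneg[OF gauss_nonneg] mult.commute[of "gauss 0"] mult_left_mono gauss_le)
  qed measurable
  have val2: "(\<integral>\<xi>. fourier f \<xi> * (complex_of_real (gauss (0 :: real^'n)) * wave x \<xi>) \<partial>lborel) =
      complex_of_real (gauss (0 :: real^'n)) * inv_fourier (fourier f) x"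
    unfolding inv_fourier_wave by (simp add: mult.left_commute flip: integral_mult_right_zero)
  have "complex_of_real (gauss (0 :: real^'n)) * inv_fourier (fourier f) x
      = f x * complex_of_real (gauss (0 :: real^'n))"
    using LIMSEQ_unique[OF lim2[unfolded eq] lim1] unfolding val1 val2 .
  moreover have "gauss (0 :: real^'n) \<noteq> 0"
    using gauss_pos[of "0 :: real^'n"] by simp
  ultimately show ?thesis by simp
qed

section \<open>Vanishing moments and Littlewood--Paley pieces\<close>

lemma fourier_add:
  assumes "integrable lborel f" "integrable lborel g"
  shows "fourier (\<lambda>x. f x + g x) \<xi> = fourier f \<xi> + fourier g \<xi>"
proof -
  have "integrable lborel (\<lambda>x. h x * wave (- \<xi>) x)" if "integrable lborel h" for h
    by (rule Bochner_Integration.integrable_bound[OF that]) (use that in \<open>auto simp: norm_mult\<close>)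
  from this[OF assms(1)] this[OF assms(2)] show ?thesis
    by (simp add: fourier_wave distrib_right)
qed

lemma fourier_cmult: "fourier (\<lambda>x. c * f x) \<xi> = c * fourier f \<xi>"
  by (simp add: fourier_wave mult.assoc)

lemma fourier_sum:
  fixes f :: "'i \<Rightarrow> real^'n::finite \<Rightarrow> complex"
  assumes "\<And>i. i \<in> I \<Longrightarrow> f i \<in> schwartz"
  shows "fourier (\<lambda>x. \<Sum>i\<in>I. f i x) \<xi> = (\<Sum>i\<in>I. fourier (f i) \<xi>)"
  using assms
proof (induction I rule: infinite_finite_induct)
  case (insert i I)
  then have "fourier (\<lambda>x. f i x + (\<Sum>j\<in>I. f j x)) \<xi> = fourier (f i) \<xi> + (\<Sum>j\<in>I. fourier (f j) \<xi>)"
    by (subst fourier_add) (auto intro!: schwartz_integrable schwartz_sum)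
  then show ?case using insert by simp
qed (simp_all add: fourier_def)

lemma fourier_wave_mult: "fourier (\<lambda>x. wave \<zeta> x * f x) \<xi> = fourier f (\<xi> - \<zeta>)"
proof -
  have neg: "- (\<xi> - \<zeta>) = \<zeta> + - \<xi>" by simp
  have "wave \<zeta> x * f x * wave (- \<xi>) x = f x * wave (- (\<xi> - \<zeta>)) x" for x
    unfolding neg wave_add_freq by (simp only: ac_simps)
  then show ?thesis by (simp only: fourier_wave)
qed

lemma fourier_affine:
  fixes f :: "real^'n::finite \<Rightarrow> complex"
  assumes [measurable]: "f \<in> borel_measurable borel" and "a \<noteq> 0"
  shows "fourier (\<lambda>x. f (a *\<^sub>R x + b)) \<xi> =
    (\<bar>1 / a\<bar> ^ CARD('n)) *\<^sub>R (wave \<xi> ((1 / a) *\<^sub>R b) * fourier f ((1 / a) *\<^sub>R \<xi>))"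
proof -
  let ?t = "- ((1 / a) *\<^sub>R b)"
  have pt: "f (a *\<^sub>R (?t + (1 / a) *\<^sub>R y) + b) * wave (- \<xi>) (?t + (1 / a) *\<^sub>R y) =
      wave \<xi> ((1 / a) *\<^sub>R b) * (f y * wave (- ((1 / a) *\<^sub>R \<xi>)) y)" for y
  proof -
    have "a *\<^sub>R (?t + (1 / a) *\<^sub>R y) + b = y"
      using assms(2) by (simp add: algebra_simps)
    moreover have "wave (- \<xi>) ?t = wave \<xi> ((1 / a) *\<^sub>R b)"
      "wave (- \<xi>) ((1 / a) *\<^sub>R y) = wave (- ((1 / a) *\<^sub>R \<xi>)) y" by simp_all
    ultimately show ?thesis unfolding wave_add by (simp only: ac_simps)
  qed
  have "fourier (\<lambda>x. f (a *\<^sub>R x + b)) \<xi> = \<bar>1 / a\<bar> ^ CARD('n) *\<^sub>R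
      (\<integral>y. f (a *\<^sub>R (?t + (1 / a) *\<^sub>R y) + b) * wave (- \<xi>) (?t + (1 / a) *\<^sub>R y) \<partial>lborel)"
    unfolding fourier_wave
    using assms(2) by (intro integral_affine) auto
  also have "\<dots> = \<bar>1 / a\<bar> ^ CARD('n) *\<^sub>R (wave \<xi> ((1 / a) *\<^sub>R b) * fourier f ((1 / a) *\<^sub>R \<xi>))"
    unfolding pt by (simp add: fourier_wave)
  finally show ?thesis .
qed

lemma norm_cis_diff_le: "norm (cis a - 1) \<le> \<bar>a\<bar>"
  using iexp_approx1[of a 0] by (simp add: cis_conv_exp)

text \<open>Multiplication by a coordinate differentiates the Fourier transform, and derivatives of a
  function vanish where it vanishes locally.\<close>

lemma fourier_coord_mult_zero:
  fixes f :: "real^'n::finite \<Rightarrow> complex"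
  assumes f: "f \<in> schwartz" and "open U" and zero: "\<And>\<xi>. \<xi> \<in> U \<Longrightarrow> fourier f \<xi> = 0" and \<xi>: "\<xi> \<in> U"
  shows "fourier (\<lambda>x. complex_of_real (x $ j) * f x) \<xi> = 0"
proof -
  define h where "h m = (1 / real (m + 2)) *\<^sub>R (axis j 1 :: real^'n)" for m
  define s where "s m x = real (m + 2) *\<^sub>R (wave (- x) (\<xi> + h m) - wave (- x) \<xi>)" for m x
  note [measurable] = schwartz_measurable[OF f]
  have int: "integrable lborel (\<lambda>x. f x * wave (- x) y)" for y
    by (rule Bochner_Integration.integrable_bound[OF schwartz_integrable[OF f]])
       (auto simp: norm_mult)
  have four: "fourier f y = (\<integral>x. f x * wave (- x) y \<partial>lborel)" for y
    by (simp add: fourier_wave inner_commute)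
  have quot: "(\<integral>x. f x * s m x \<partial>lborel) = real (m + 2) *\<^sub>R (fourier f (\<xi> + h m) - fourier f \<xi>)" for m
  proof -
    have "f x * s m x = real (m + 2) *\<^sub>R (f x * wave (- x) (\<xi> + h m) - f x * wave (- x) \<xi>)" for x
      unfolding s_def by (simp only: mult_scaleR_right right_diff_distrib)
    then show ?thesis
      unfolding four
      by (simp only: integral_scaleR_right Bochner_Integration.integral_diff[OF int int])
  qed
  have h0: "h \<longlonglongrightarrow> 0"
  proof -
    have "(\<lambda>m. 1 / real (m + 2)) \<longlonglongrightarrow> 0"
      using LIMSEQ_ignore_initial_segment[OF lim_1_over_n, of 2] by simp
    then have "h \<longlonglongrightarrow> 0 *\<^sub>R axis j 1" unfolding h_def by (intro tendsto_intros)
    then show ?thesis by simp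
  qed
  have "(\<lambda>m. \<xi> + h m) \<longlonglongrightarrow> \<xi> + 0" by (intro tendsto_intros h0)
  then have "\<forall>\<^sub>F m in sequentially. \<xi> + h m \<in> U"
    using \<open>open U\<close> \<xi> by (intro topological_tendstoD) auto
  then have "\<forall>\<^sub>F m in sequentially. (\<integral>x. f x * s m x \<partial>lborel) = 0"
    by eventually_elim (simp add: quot zero \<xi>)
  then have "(\<lambda>m. \<integral>x. f x * s m x \<partial>lborel) \<longlonglongrightarrow> 0"
    by (rule tendsto_eventually)
  moreover have "(\<lambda>m. \<integral>x. f x * s m x \<partial>lborel) \<longlonglongrightarrow>
      (\<integral>x. f x * (complex_of_real (2 * pi * (- x) $ j) * (\<i> * wave (- x) \<xi>)) \<partial>lborel)"
  proof (rule integral_dominated_convergence)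
    show "integrable lborel (\<lambda>x. 2 * pi * norm (complex_of_real (x $ j) * f x))"
      by (intro integrable_mult_right integrable_norm schwartz_integrable schwartz_coord_mult f)
    show "AE x in lborel. (\<lambda>m. f x * s m x) \<longlonglongrightarrow>
        f x * (complex_of_real (2 * pi * (- x) $ j) * (\<i> * wave (- x) \<xi>))"
      unfolding s_def h_def partial_deriv_wave[symmetric]
      by (intro AE_I2 tendsto_mult tendsto_const difference_quotient_tendsto differentiable_wave)
    show "AE x in lborel. norm (f x * s m x) \<le> 2 * pi * norm (complex_of_real (x $ j) * f x)" for m
    proof (rule AE_I2)
      fix x
      have "s m x = real (m + 2) *\<^sub>R (wave (- x) \<xi> * (wave (- x) (h m) - 1))"
        unfolding s_def wave_add by (simp only: right_diff_distrib mult_1_right)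
      then have "norm (s m x) = real (m + 2) * norm (wave (- x) (h m) - 1)"
        by (simp only: norm_scaleR norm_mult norm_cis mult_1 abs_of_nat)
      also have "\<dots> \<le> real (m + 2) * \<bar>2 * pi * (h m \<bullet> (- x))\<bar>"
        by (intro mult_left_mono norm_cis_diff_le) simp
      also have "\<dots> = 2 * pi * \<bar>x $ j\<bar>"
        by (simp add: h_def inner_axis' abs_mult del: of_nat_add)
      finally have "norm (f x) * norm (s m x) \<le> norm (f x) * (2 * pi * \<bar>x $ j\<bar>)"
        by (intro mult_left_mono) simp_all
      then show "norm (f x * s m x) \<le> 2 * pi * norm (complex_of_real (x $ j) * f x)"
        by (simp add: norm_mult ac_simps)
    qed
  qed (unfold s_def, measurable)
  ultimately have zero_int: "(\<integral>x. f x * (complex_of_real (2 * pi * (- x) $ j) * (\<i> * wave (- x) \<xi>)) \<partial>lborel) = 0"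
    using LIMSEQ_unique by blast
  have eq: "(\<lambda>x. f x * (complex_of_real (2 * pi * (- x) $ j) * (\<i> * wave (- x) \<xi>))) =
      (\<lambda>x. (- complex_of_real (2 * pi) * \<i>) * (complex_of_real (x $ j) * f x * wave (- \<xi>) x))"
    by (simp add: fun_eq_iff inner_commute)
  show ?thesis using zero_int unfolding eq by (simp add: fourier_wave)
qed

text \<open>Vanishing on an open set, unlike vanishing at one point, survives the differentiation of
  the transform that a coordinate factor causes. In a product one factor is absorbed into
  \<open>f\<close>, so \<open>f\<close> and \<open>\<xi>\<close> vary in the induction.\<close>

lemma fourier_real_polynomial_mult_zero:
  fixes f :: "real^'n::finite \<Rightarrow> complex"
  assumes "real_polynomial_function P" "f \<in> schwartz"
    and "open U" and "\<And>\<xi>. \<xi> \<in> U \<Longrightarrow> fourier f \<xi> = 0" and "\<xi> \<in> U"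
  shows "fourier (\<lambda>x. complex_of_real (P x) * f x) \<xi> = 0"
  using assms
proof (induction arbitrary: f \<xi> rule: real_polynomial_function.induct)
  case (linear l)
  have "(\<lambda>x. complex_of_real (l x) * f x) =
      (\<lambda>x. \<Sum>i\<in>UNIV. complex_of_real (l (axis i 1)) * (complex_of_real (x $ i) * f x))"
    by (subst bounded_linear_cart_sum[OF linear(1)]) (simp add: sum_distrib_right mult.assoc)
  moreover have "fourier (\<lambda>x. \<Sum>i\<in>UNIV. complex_of_real (l (axis i 1)) * (complex_of_real (x $ i) * f x)) \<xi> = 0"
    using fourier_coord_mult_zero[OF linear.prems(1,2,3,4)]
    by (subst fourier_sum) (auto simp: fourier_cmult intro!: schwartz_cmult schwartz_coord_mult linear)
  ultimately show ?case by simp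
next
  case (const c)
  then show ?case by (simp add: fourier_cmult)
next
  case (add P Q)
  have "integrable lborel (\<lambda>x. complex_of_real (P x) * f x)" "integrable lborel (\<lambda>x. complex_of_real (Q x) * f x)"
    using add.hyps add.prems by (auto intro!: schwartz_integrable schwartz_real_polynomial_mult)
  then show ?case using add.IH[OF add.prems]
    by (simp add: distrib_right fourier_add)
next
  case (mult P Q)
  have "fourier (\<lambda>x. complex_of_real (P x) * (complex_of_real (Q x) * f x)) \<xi> = 0"
    using mult.prems(1) mult.hyps(2)
    by (intro mult.IH(1)[OF _ mult.prems(2) mult.IH(2)] schwartz_real_polynomial_mult mult.prems)
  then show ?case by (simp add: mult.assoc)
qed

text \<open>The integral is the transform of \<open>P * f\<close> at the origin. Real and imaginary
  parts of \<open>P\<close> are separated because the induction runs over real polynomials.\<close>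

lemma polynomial_integral_zero:
  fixes f :: "real^'n::finite \<Rightarrow> complex" and P :: "real^'n \<Rightarrow> complex"
  assumes "polynomial_function P" and f: "f \<in> schwartz"
    and "0 < r" and zero: "\<And>\<xi>. norm \<xi> < r \<Longrightarrow> fourier f \<xi> = 0"
  shows "(\<integral>x. P x * f x \<partial>lborel) = 0"
proof -
  have "real_polynomial_function (\<lambda>x. Re (P x))" "real_polynomial_function (\<lambda>x. Im (P x))"
    using assms(1) bounded_linear_Re bounded_linear_Im unfolding polynomial_function_def o_def by blast+
  note R = this[THEN schwartz_real_polynomial_mult, OF f]
    and Z = this(1)[THEN fourier_real_polynomial_mult_zero, OF f open_ball, of 0 r 0]
      this(2)[THEN fourier_real_polynomial_mult_zero, OF f open_ball, of 0 r 0]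
  have "(\<integral>x. complex_of_real (Re (P x)) * f x \<partial>lborel) = 0" "(\<integral>x. complex_of_real (Im (P x)) * f x \<partial>lborel) = 0"
    using Z zero \<open>0 < r\<close> by (simp_all add: fourier_wave)
  moreover have "P x * f x = complex_of_real (Re (P x)) * f x + \<i> * (complex_of_real (Im (P x)) * f x)" for x
    by (subst complex_eq[of "P x"]) (simp add: distrib_right)
  ultimately show ?thesis
    using R[THEN schwartz_integrable] by simp
qed

text \<open>Each moment is the value at the origin of the transform of a monomial times
  \<open>f\<close>.\<close>

lemma schwartz_vanishing_momentsI:
  fixes f :: "real^'n::finite \<Rightarrow> complex"
  assumes f: "f \<in> schwartz" and "0 < r" and zero: "\<And>\<xi>. norm \<xi> < r \<Longrightarrow> fourier f \<xi> = 0"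
  shows "f \<in> schwartz_vanishing_moments"
proof -
  have "(\<integral>x. complex_of_real (\<Prod>i\<in>UNIV. (x $ i) ^ \<alpha> i) * f x \<partial>lborel) = 0" for \<alpha> :: "'n \<Rightarrow> nat"
  proof -
    have "real_polynomial_function (\<lambda>x::real^'n. \<Prod>i\<in>UNIV. (x $ i) ^ \<alpha> i)"
      by (intro real_polynomial_function_prod real_polynomial_function_power
          real_polynomial_function.intros(1) bounded_linear_vec_nth) auto
    from fourier_real_polynomial_mult_zero[OF this f open_ball, of 0 r 0]
    show ?thesis using zero \<open>0 < r\<close> by (simp add: fourier_wave)
  qed
  then show ?thesis using f by (simp add: schwartz_vanishing_moments_def)
qed

text \<open>As \<open>f\<close> is integrable, the sup norm of the test function is enough: order 0,
  with the L1 norm of \<open>f\<close> as constant.\<close>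

lemma tempered_distribution_of_schwartz:
  fixes f :: "real^'n::finite \<Rightarrow> complex"
  assumes f: "f \<in> schwartz" shows "tempered_distribution (distribution_of f)"
  unfolding tempered_distribution_def
proof (intro conjI ballI allI)
  fix g h :: "real^'n \<Rightarrow> complex" and a b assume g: "g \<in> schwartz" and h: "h \<in> schwartz"
  have "(\<lambda>x. f x * (a * g x + b * h x)) = (\<lambda>x. a * (f x * g x) + b * (f x * h x))"
    by (simp add: fun_eq_iff algebra_simps)
  then show "distribution_of f (\<lambda>x. a * g x + b * h x) = a * distribution_of f g + b * distribution_of f h"
    using schwartz_integrable[OF schwartz_mult[OF f g]] schwartz_integrable[OF schwartz_mult[OF f h]]
    by (simp add: distribution_of_def)
next
  show "\<exists>C N. \<forall>g\<in>schwartz. norm (distribution_of f g) \<le> C * schwartz_seminorm N g"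
  proof (intro exI ballI)
    fix g :: "real^'n \<Rightarrow> complex" assume g: "g \<in> schwartz"
    let ?S = "schwartz_seminorm 0 g"
    obtain B where B: "\<And>x. norm (g x) \<le> B" using schwartz_bounded[OF g] by metis
    \<comment> \<open>At order 0 only the empty list of indices is admissible, so the seminorm is
      the sup norm.\<close>
    have "{js::'n list. length js \<le> 0} \<times> UNIV = range (\<lambda>x::real^'n. ([], x))" by auto
    then have S: "?S = (SUP x. norm (g x))"
      by (simp add: schwartz_seminorm_def iterated_deriv_def image_image)
    have le: "norm (g x) \<le> ?S" for x
      unfolding S by (rule cSUP_upper) (auto intro!: bdd_aboveI B)
    have le2: "norm (f x * g x) \<le> ?S * norm (f x)" for x
      unfolding norm_mult using mult_right_mono[OF le[of x], of "norm (f x)"] by (simp add: mult.commute)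
    have "norm (distribution_of f g) \<le> (\<integral>x. norm (f x * g x) \<partial>lborel)"
      unfolding distribution_of_def by (rule integral_norm_bound)
    also have "\<dots> \<le> (\<integral>x. ?S * norm (f x) \<partial>lborel)"
      by (intro integral_mono integrable_norm integrable_mult_right schwartz_integrable schwartz_mult f g le2)
    also have "\<dots> = (\<integral>x. norm (f x) \<partial>lborel) * ?S" by simp
    finally show "norm (distribution_of f g) \<le> (\<integral>x. norm (f x) \<partial>lborel) * ?S" .
  qed
qed

lemma distribution_of_in_class:
  fixes f :: "real^'n::finite \<Rightarrow> complex"
  assumes "f \<in> schwartz" shows "distribution_of f \<in> class_of f"
proof -
  have "polynomial_function (\<lambda>_::real^'n. 0 :: complex)" by (rule polynomial_function_const)
  moreover have "distribution_of (\<lambda>_::real^'n. 0 :: complex) g = 0" for g by (simp add: distribution_of_def)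
  ultimately show ?thesis
    unfolding class_of_def equal_mod_polynomials_def using tempered_distribution_of_schwartz[OF assms]
    by (auto intro!: exI[of _ "\<lambda>_. 0"])
qed

section \<open>Dyadic dilates and independence of the pieces from the representative\<close>

lemma dyadic_dilate_altdef:
  "dyadic_dilate \<phi> k = (\<lambda>x::real^'n::finite. complex_of_real (2 powi (k * int CARD('n))) * \<phi> ((2 powi k) *\<^sub>R x + 0))"
  by (simp add: dyadic_dilate_def[abs_def] scaleR_conv_of_real[where 'a=complex])

lemma schwartz_dyadic_dilate:
  fixes \<phi> :: "real^'n::finite \<Rightarrow> complex"
  assumes "\<phi> \<in> schwartz" shows "dyadic_dilate \<phi> k \<in> schwartz"
  unfolding dyadic_dilate_altdef by (intro schwartz_cmult schwartz_affine assms) simp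

lemma fourier_dyadic_dilate:
  fixes \<phi> :: "real^'n::finite \<Rightarrow> complex"
  assumes "\<phi> \<in> schwartz"
  shows "fourier (dyadic_dilate \<phi> k) \<xi> = fourier \<phi> ((2 powi (- k)) *\<^sub>R \<xi>)"
proof -
  have "(2::real) powi (k * int CARD('n)) = (2 powi k) ^ CARD('n)"
    by (simp add: power_int_mult)
  then have "(2::real) powi (k * int CARD('n)) * \<bar>1 / 2 powi k\<bar> ^ CARD('n) = 1"
    by (simp add: power_one_over)
  from arg_cong[OF this, of complex_of_real]
  have "complex_of_real (2 powi (k * int CARD('n))) * complex_of_real (\<bar>1 / 2 powi k\<bar> ^ CARD('n)) = 1"
    by (simp only: of_real_mult of_real_1)
  then show ?thesis
    unfolding dyadic_dilate_altdef fourier_cmult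
    by (subst fourier_affine[OF schwartz_measurable[OF assms]])
       (auto simp: power_int_minus inverse_eq_divide scaleR_conv_of_real[where 'a=complex] simp flip: mult.assoc)
qed

lemma schwartz_reflect_translate:
  fixes f :: "real^'n::finite \<Rightarrow> complex"
  assumes "f \<in> schwartz" shows "(\<lambda>y. f (x - y)) \<in> schwartz"
  using schwartz_affine[OF assms, of "-1" x] by simp

lemma littlewood_paley_fourier_zero:
  assumes "littlewood_paley \<phi>" "norm \<xi> < 1/2 \<or> 2 < norm \<xi>"
  shows "fourier \<phi> \<xi> = 0"
proof (rule ccontr)
  assume "fourier \<phi> \<xi> \<noteq> 0"
  then have "\<xi> \<in> supp (fourier \<phi>)" unfolding supp_def using closure_subset by fast
  then show False using assms unfolding littlewood_paley_def by auto
qed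

text \<open>Representatives differ by a polynomial, and the kernel of the piece annihilates
  polynomials because its transform vanishes near the origin.\<close>

lemma LP_piece_class_of:
  fixes \<phi> :: "real^'n::finite \<Rightarrow> complex"
  assumes \<phi>: "littlewood_paley \<phi>" and \<Lambda>: "\<Lambda> \<in> class_of f"
  shows "LP_piece \<phi> k \<Lambda> = LP_piece \<phi> k (distribution_of f)"
proof
  fix x
  have \<phi>s: "\<phi> \<in> schwartz" using \<phi> by (simp add: littlewood_paley_def)
  let ?D = "dyadic_dilate \<phi> k" and ?g = "\<lambda>y. dyadic_dilate \<phi> k (x - y)"
  have g: "?g \<in> schwartz" by (intro schwartz_reflect_translate schwartz_dyadic_dilate \<phi>s)
  obtain P where P: "polynomial_function P" "\<And>g. g \<in> schwartz \<Longrightarrow> \<Lambda> g - distribution_of f g = distribution_of P g"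
    using \<Lambda> unfolding class_of_def equal_mod_polynomials_def by auto
  have "distribution_of P ?g = 0"
    unfolding distribution_of_def
  \<comment> \<open>The transform of the k-th dilate vanishes inside radius
    \<open>2 powi k / 2\<close>, the lower support radius 1/2 of \<open>fourier \<phi>\<close>
    rescaled.\<close>
  proof (rule polynomial_integral_zero[OF P(1) g, of "2 powi k / 2"])
    fix \<xi> :: "real^'n" assume \<xi>: "norm \<xi> < 2 powi k / 2"
    have "fourier ?D (- \<xi>) = 0"
      unfolding fourier_dyadic_dilate[OF \<phi>s] using \<xi>
      by (intro littlewood_paley_fourier_zero[OF \<phi>] disjI1) (simp add: power_int_minus field_simps)
    then show "fourier ?g \<xi> = 0"
      using fourier_affine[OF schwartz_measurable[OF schwartz_dyadic_dilate[OF \<phi>s]], of "-1" k x \<xi>]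
      by simp
  qed simp
  then show "LP_piece \<phi> k \<Lambda> x = LP_piece \<phi> k (distribution_of f) x"
    unfolding LP_piece_def using P(2)[OF g] by simp
qed

lemma TL_norm_class_of:
  fixes \<phi> f :: "real^'n::finite \<Rightarrow> complex"
  assumes "littlewood_paley \<phi>" "f \<in> schwartz"
  shows "TL_norm \<phi> p q (class_of f) = TL_norm_distribution \<phi> p q (distribution_of f)"
proof -
  have "TL_norm \<phi> p q (class_of f) = (INF \<Lambda>\<in>class_of f. TL_norm_distribution \<phi> p q (distribution_of f))"
    unfolding TL_norm_def TL_norm_distribution_def
    by (rule INF_cong[OF refl]) (simp only: LP_piece_class_of[OF assms(1)])
  \<comment> \<open>Nonemptiness matters: an infimum over an empty class would be infinite.\<close>
  moreover have "class_of f \<noteq> {}" using distribution_of_in_class[OF assms(2)] by blast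
  ultimately show ?thesis by simp
qed

text \<open>By inversion the kernel \<open>dyadic_dilate \<phi> k (x - y)\<close> is the transform
  of \<open>?K\<close> at \<open>y\<close>. The multiplication formula then moves the pairing to the
  frequency side, where disjointness of supports can be used.\<close>

lemma LP_piece_fourier:
  fixes \<phi> f :: "real^'n::finite \<Rightarrow> complex"
  assumes \<phi>: "\<phi> \<in> schwartz" and f: "f \<in> schwartz"
  shows "LP_piece \<phi> k (distribution_of f) x =
    (\<integral>\<xi>. fourier (dyadic_dilate \<phi> k) \<xi> * (fourier f \<xi> * wave x \<xi>) \<partial>lborel)"
proof -
  let ?D = "dyadic_dilate \<phi> k"
  have D: "?D \<in> schwartz" by (rule schwartz_dyadic_dilate[OF \<phi>])
  let ?K = "\<lambda>\<xi>. fourier ?D \<xi> * wave x \<xi>"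
  have K: "integrable lborel ?K"
    using schwartz_measurable[OF D]
    by (intro Bochner_Integration.integrable_bound[OF fourier_integrable[OF D]])
       (auto simp: norm_mult)
  have "fourier ?K y = ?D (x - y)" for y
  proof -
    have "fourier ?K y = inv_fourier (fourier ?D) (x + - y)"
      unfolding fourier_wave[of ?K] inv_fourier_wave wave_add_freq by (simp only: mult.assoc)
    then show ?thesis by (simp add: fourier_inversion[OF D])
  qed
  then have "LP_piece \<phi> k (distribution_of f) x = (\<integral>y. f y * fourier ?K y \<partial>lborel)"
    by (simp add: LP_piece_def distribution_of_def)
  also have "\<dots> = (\<integral>\<xi>. fourier f \<xi> * ?K \<xi> \<partial>lborel)"
    by (rule fourier_multiplication_formula[OF schwartz_integrable[OF f] K, symmetric])
  finally show ?thesis by (simp only: ac_simps)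
qed

section \<open>Sums of modulated wave packets\<close>

lemma power_freq_ge: "(1024::real) \<le> 2 ^ (10 * (k + 1))"
proof -
  have "(2::real) ^ 10 \<le> 2 ^ (10 * (k + 1))" by (intro power_increasing) auto
  then show ?thesis by simp
qed

lemma power_int_add_nat: "(2::real) powi (int n + i) = 2 ^ n * 2 powi i"
  by (simp add: power_int_add)

text \<open>Peetre's inequality: a weight centred at \<open>c\<close> moves from \<open>y\<close> to
  \<open>x\<close> at the price of a weight in \<open>x - y\<close>.\<close>

lemma weight_translate_le:
  fixes x y c :: "'a::real_normed_vector"
  shows "(1 + norm (x - c)) ^ M \<le> (1 + norm (y - c)) ^ M * (1 + norm (x - y)) ^ M"
proof -
  have "norm (x - c) \<le> norm (x - y) + norm (y - c)" using norm_triangle_ineq[of "x - y" "y - c"] by simp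
  also have "1 + \<dots> \<le> (1 + norm (y - c)) * (1 + norm (x - y))" by (simp add: algebra_simps)
  finally have "1 + norm (x - c) \<le> (1 + norm (y - c)) * (1 + norm (x - y))" by simp
  from power_mono[OF this, of M] show ?thesis by (simp add: power_mult_distrib)
qed

lemma schwartz_weighted_integrable:
  fixes f :: "real^'n::finite \<Rightarrow> complex"
  assumes "f \<in> schwartz"
  shows "integrable lborel (\<lambda>z. (1 + norm z) ^ M * norm (f z))" (is "integrable lborel ?h")
proof -
  note [measurable] = schwartz_measurable[OF assms]
  obtain C where C: "\<And>x. (1 + norm x) ^ (2 * CARD('n) + M) * norm (f x) \<le> C" using schwartz_decay[OF assms] by metis
  have "norm (complex_of_real (?h z)) = ?h z" for z
    by (subst norm_of_real) (simp add: abs_mult)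
  then have "integrable lborel (\<lambda>z. complex_of_real (?h z))"
    by (intro integrable_of_decay[where C=C]) (use C in \<open>simp_all add: power_add mult.assoc del: of_real_mult\<close>)
  then show ?thesis using complex_of_real_integrable_eq by blast
qed

text \<open>With offsets -1, 0, 1 this enumerates the scales that can see a packet: the k-th packet
  has frequency \<open>2 ^ (10 * (k + 1))\<close> and meets only scales within 1 of
  \<open>10 * (k + 1)\<close>.\<close>

definition scale_index :: "nat \<times> int \<Rightarrow> int" where
  "scale_index = (\<lambda>(k, i). int (10 * (k + 1)) + i)"

lemma inj_on_scale_index: "inj_on scale_index (UNIV \<times> {-1,0,1})"
  by (rule inj_onI) (auto simp: scale_index_def; presburger)

lemma ennpowr_ennreal: "0 \<le> a \<Longrightarrow> ennpowr (ennreal a) r = ennreal (a powr r)"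
  by (simp add: ennpowr_def)

lemma ennpowr_mono: "x \<le> y \<Longrightarrow> 0 \<le> r \<Longrightarrow> ennpowr x r \<le> ennpowr y r"
  unfolding ennpowr_def
  by (auto simp: top_unique less_top intro!: ennreal_leI powr_mono2 enn2real_mono)

locale wave_packets =
  fixes \<phi> :: "real^'n::finite \<Rightarrow> complex" and v :: "real^'n"
  assumes \<phi>: "littlewood_paley \<phi>" and v: "norm v = 1"
begin

lemma \<phi>s: "\<phi> \<in> schwartz"
  using \<phi> by (simp add: littlewood_paley_def)

text \<open>The spacing \<open>2\<^bsup>10\<^esup>\<close> is so wide that no Littlewood--Paley piece meets two packets and no dilate of the
  Herz cutoff meets two terms of the multiplier below.\<close>

definition freq :: "nat \<Rightarrow> real^'n" where
  "freq k = (2 ^ (10 * (k + 1))) *\<^sub>R v"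

text \<open>Only the envelope is centred at \<open>c\<close>, the wave is not. Translating a packet
  by \<open>b\<close> thus gives the packet with centre \<open>c + b\<close> times the phase
  \<open>wave (freq k) (- b)\<close>.\<close>

definition packet :: "nat \<Rightarrow> real^'n \<Rightarrow> real^'n \<Rightarrow> complex" where
  "packet k c x = wave (freq k) x * \<phi> (x - c)"

text \<open>The coefficients \<open>\<omega>\<close> keep track of the phases that translation
  creates.\<close>

definition packet_sum ::
  "(nat \<Rightarrow> complex) \<Rightarrow> (nat \<Rightarrow> real^'n) \<Rightarrow> nat \<Rightarrow> real^'n \<Rightarrow> complex"
  where "packet_sum \<omega> c N x = (\<Sum>k<N. \<omega> k * packet k (c k) x)"

abbreviation packet_piece ::
  "nat \<Rightarrow> real^'n \<Rightarrow> int \<Rightarrow> real^'n \<Rightarrow> complex"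
  where "packet_piece k c j \<equiv> LP_piece \<phi> j (distribution_of (packet k c))"

abbreviation sum_piece ::
  "(nat \<Rightarrow> complex) \<Rightarrow> (nat \<Rightarrow> real^'n) \<Rightarrow> nat \<Rightarrow> int \<Rightarrow> real^'n \<Rightarrow> complex"
  where "sum_piece \<omega> c N j \<equiv> LP_piece \<phi> j (distribution_of (packet_sum \<omega> c N))"

section \<open>Frequency supports and pieces of the packets\<close>

lemma schwartz_packet:
  "packet k c \<in> schwartz"
  unfolding packet_def[abs_def] using schwartz_affine[OF \<phi>s, of 1 "- c"]
  by (intro schwartz_wave_mult) simp

lemma schwartz_packet_sum:
  "packet_sum \<omega> c N \<in> schwartz"
  unfolding packet_sum_def[abs_def] by (intro schwartz_sum schwartz_cmult schwartz_packet \<phi>s)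

lemma fourier_packet:
  shows "fourier (packet k c) \<xi> = wave (\<xi> - freq k) (- c) * fourier \<phi> (\<xi> - freq k)"
  unfolding packet_def[abs_def] fourier_wave_mult
  using fourier_affine[OF schwartz_measurable[OF \<phi>s], of 1 "- c" "\<xi> - freq k"] by simp

lemma fourier_packet_sum:
  shows "fourier (packet_sum \<omega> c N) \<xi> = (\<Sum>k<N. \<omega> k * fourier (packet k (c k)) \<xi>)"
  unfolding packet_sum_def[abs_def]
  by (subst fourier_sum) (auto intro!: schwartz_cmult schwartz_packet \<phi>s simp: fourier_cmult)

lemma fourier_packet_support:
  assumes nz: "fourier (packet k c) \<xi> \<noteq> 0"
  shows "2 ^ (10 * (k + 1)) - 2 \<le> norm \<xi>" and "norm \<xi> \<le> 2 ^ (10 * (k + 1)) + 2"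
proof -
  have "\<phi> \<in> schwartz" using \<phi> by (simp add: littlewood_paley_def)
  then have "fourier \<phi> (\<xi> - freq k) \<noteq> 0" using nz by (simp add: fourier_packet)
  then have "norm (\<xi> - freq k) \<le> 2"
    using littlewood_paley_fourier_zero[OF \<phi>] by (metis not_le)
  moreover have "norm (freq k) = 2 ^ (10 * (k + 1))" by (simp add: freq_def v)
  moreover have "norm (freq k) - norm \<xi> \<le> norm (\<xi> - freq k)"
    by (metis norm_minus_commute norm_triangle_ineq2)
  moreover have "norm \<xi> - norm (freq k) \<le> norm (\<xi> - freq k)" by (rule norm_triangle_ineq2)
  ultimately show "2 ^ (10 * (k + 1)) - 2 \<le> norm \<xi>" "norm \<xi> \<le> 2 ^ (10 * (k + 1)) + 2" by linarith+
qed

text \<open>With \<open>A = 2 ^ (10 * (k + 1))\<close> the packet occupies norms within 2 of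
  \<open>A\<close>, while scale \<open>j\<close> sees norms from \<open>2 powi j / 2\<close> to
  \<open>2 * 2 powi j\<close>. Two or more steps away these are at least \<open>2 * A\<close> or at
  most \<open>A / 2\<close>, and \<open>A \<ge> 1024\<close> swallows the 2.\<close>

lemma fourier_dyadic_dilate_packet_zero:
  assumes nz: "fourier (packet k c) \<xi> \<noteq> 0" and j: "2 \<le> \<bar>j - int (10 * (k + 1))\<bar>"
  shows "fourier (dyadic_dilate \<phi> j) \<xi> = 0"
proof -
  define A :: real where "A = 2 ^ (10 * (k + 1))"
  have A: "1024 \<le> A" unfolding A_def by (rule power_freq_ge)
  have \<xi>: "A - 2 \<le> norm \<xi>" "norm \<xi> \<le> A + 2"
    using fourier_packet_support[OF nz] by (simp_all add: A_def)
  have A_powi: "2 powi (int (10 * (k + 1)) + i) = A * 2 powi i" for i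
    unfolding A_def by (rule power_int_add_nat)
  have scaled: "norm ((2 powi (- j)) *\<^sub>R \<xi>) = norm \<xi> / 2 powi j"
    by (simp add: power_int_minus divide_inverse mult.commute)
  consider "j \<ge> int (10 * (k + 1)) + 2" | "j \<le> int (10 * (k + 1)) + (- 2)" using j by linarith
  then have "norm ((2 powi (- j)) *\<^sub>R \<xi>) < 1/2 \<or> 2 < norm ((2 powi (- j)) *\<^sub>R \<xi>)"
  proof cases
    case 1
    have "(2::real) powi (int (10 * (k + 1)) + 2) \<le> 2 powi j" using 1 by (intro power_int_increasing) auto
    then have "A * 4 \<le> 2 powi j" unfolding A_powi by simp
    then have "norm \<xi> < 2 powi j / 2" using \<xi> A by linarith
    then show ?thesis unfolding scaled by (simp add: field_simps)
  next
    case 2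
    have "(2::real) powi j \<le> 2 powi (int (10 * (k + 1)) + (- 2))" using 2 by (intro power_int_increasing) auto
    then have "2 powi j \<le> A / 4" unfolding A_powi by (simp add: power_int_minus)
    then have "2 * 2 powi j < norm \<xi>" using \<xi> A by linarith
    then show ?thesis unfolding scaled by (simp add: field_simps)
  qed
  then show ?thesis
    unfolding fourier_dyadic_dilate[OF \<phi>s] by (rule littlewood_paley_fourier_zero[OF \<phi>])
qed

lemma LP_piece_packet_zero:
  assumes j: "2 \<le> \<bar>j - int (10 * (k + 1))\<bar>"
  shows "packet_piece k c j x = 0"
proof -
  have "fourier (dyadic_dilate \<phi> j) \<xi> * (fourier (packet k c) \<xi> * wave x \<xi>) = 0" for \<xi>
    using fourier_dyadic_dilate_packet_zero[OF _ j, of c \<xi>] by auto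
  then show ?thesis by (simp only: LP_piece_fourier[OF \<phi>s schwartz_packet]) simp
qed

text \<open>The transforms of the dilates sum to 1 over all scales; on the frequency support of the
  packet only three terms survive, and inversion returns the packet. All lower bounds rest on
  this.\<close>

lemma LP_piece_packet_sum:
  shows "(\<Sum>i\<in>{-1,0,1}. packet_piece k c (int (10 * (k + 1)) + i) x) = packet k c x"
proof -
  let ?F = "packet k c" and ?n = "int (10 * (k + 1))"
  let ?g = "\<lambda>i \<xi>. fourier (dyadic_dilate \<phi> (?n + i)) \<xi> * (fourier ?F \<xi> * wave x \<xi>)"
  have Fs: "?F \<in> schwartz" by (rule schwartz_packet)
  have Ds: "dyadic_dilate \<phi> j \<in> schwartz" for j by (rule schwartz_dyadic_dilate[OF \<phi>s])
  note [measurable] = fourier_measurable[OF schwartz_measurable[OF Fs]] fourier_measurable[OF schwartz_measurable[OF Ds]]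
  have int: "integrable lborel (?g i)" for i
  proof (rule Bochner_Integration.integrable_bound)
    let ?B = "\<integral>y. norm (dyadic_dilate \<phi> (?n + i) y) \<partial>lborel"
    show "integrable lborel (\<lambda>\<xi>. ?B * norm (fourier ?F \<xi>))"
      by (intro integrable_mult_right integrable_norm fourier_integrable Fs)
    show "AE \<xi> in lborel. norm (?g i \<xi>) \<le> norm (?B * norm (fourier ?F \<xi>))"
      using norm_fourier_le[of "dyadic_dilate \<phi> (?n + i)"]
      by (intro AE_I2) (auto simp: norm_mult abs_mult intro!: mult_right_mono order_trans[OF _ abs_ge_self])
  qed measurable
  have one: "(\<Sum>i\<in>{-1,0,1}. fourier (dyadic_dilate \<phi> (?n + i)) \<xi>) = 1" if "fourier ?F \<xi> \<noteq> 0" for \<xi>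
  proof -
    let ?h = "\<lambda>j. fourier (dyadic_dilate \<phi> j) \<xi>"
    have "\<xi> \<noteq> 0" using fourier_packet_support(1)[OF that] power_freq_ge[of k] by auto
    then have sum1: "(?h has_sum 1) UNIV" using \<phi> by (simp add: littlewood_paley_def)
    have "(?h has_sum 1) ((\<lambda>i. ?n + i) ` {-1,0,1})"
    proof (rule has_sum_cong_neutral[THEN iffD1, OF _ _ _ sum1])
      fix j assume j: "j \<in> UNIV - (\<lambda>i. ?n + i) ` {-1,0,1}"
      have "2 \<le> \<bar>j - ?n\<bar>"
      proof (rule ccontr)
        assume "\<not> 2 \<le> \<bar>j - ?n\<bar>"
        then have "j - ?n \<in> {-1,0,1}" by auto
        then have "?n + (j - ?n) \<in> (\<lambda>i. ?n + i) ` {-1,0,1}" by (rule imageI)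
        then show False using j by simp
      qed
      then show "?h j = 0" by (rule fourier_dyadic_dilate_packet_zero[OF that])
    qed auto
    then have "1 = sum ?h ((\<lambda>i. ?n + i) ` {-1,0,1})"
      by (rule has_sum_unique[OF _ has_sum_finite]) simp
    also have "\<dots> = (\<Sum>i\<in>{-1,0,1}. ?h (?n + i))"
      by (subst sum.reindex) auto
    finally show ?thesis by simp
  qed
  have "(\<Sum>i\<in>{-1,0,1}. LP_piece \<phi> (?n + i) (distribution_of ?F) x) = (\<Sum>i\<in>{-1,0,1}. \<integral>\<xi>. ?g i \<xi> \<partial>lborel)"
    by (simp only: LP_piece_fourier[OF \<phi>s Fs])
  also have "\<dots> = (\<integral>\<xi>. (\<Sum>i\<in>{-1,0,1}. ?g i \<xi>) \<partial>lborel)"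
    by (rule Bochner_Integration.integral_sum[symmetric]) (rule int)
  also have "\<dots> = (\<integral>\<xi>. fourier ?F \<xi> * wave x \<xi> \<partial>lborel)"
  proof (rule Bochner_Integration.integral_cong[OF refl])
    fix \<xi>
    have "(\<Sum>i\<in>{-1,0,1}. ?g i \<xi>) = (\<Sum>i\<in>{-1,0,1}. fourier (dyadic_dilate \<phi> (?n + i)) \<xi>) * (fourier ?F \<xi> * wave x \<xi>)"
      by (rule sum_distrib_right[symmetric])
    also have "\<dots> = fourier ?F \<xi> * wave x \<xi>"
      using one[of \<xi>] by (cases "fourier ?F \<xi> = 0") (simp_all del: sum.insert)
    finally show "(\<Sum>i\<in>{-1,0,1}. ?g i \<xi>) = fourier ?F \<xi> * wave x \<xi>" .
  qed
  also have "\<dots> = ?F x"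
    using fourier_inversion[OF Fs, of x] by (simp add: inv_fourier_wave)
  finally show ?thesis .
qed

text \<open>The modulation drops out of the modulus, which gives uniformity in \<open>k\<close>. For
  \<open>j \<ge> 0\<close> the kernel is a dilate of \<open>\<phi>\<close> of the same L1 norm and
  no larger width, so by Peetre's inequality the decay of the packet passes through the convolution
  at the fixed cost \<open>B\<close>.\<close>

lemma LP_piece_packet_bound:
  obtains C where "C > 0" and "\<And>k j c x. 0 \<le> j \<Longrightarrow>
    norm (packet_piece k c j x) \<le> C / (1 + norm (x - c)) ^ M"
proof -
  obtain A where A: "A > 0" "\<And>x. (1 + norm x) ^ M * norm (\<phi> x) \<le> A" using schwartz_decay[OF \<phi>s] by metis
  let ?h = "\<lambda>z. (1 + norm z) ^ M * norm (\<phi> z)"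
  define B where "B = (\<integral>z. ?h z \<partial>lborel)"
  note [measurable] = schwartz_measurable[OF \<phi>s]
  have h_int: "integrable lborel ?h" by (rule schwartz_weighted_integrable[OF \<phi>s])
  have B: "0 \<le> B" unfolding B_def by (intro integral_nonneg_AE) simp
  have bound: "norm (packet_piece k c j x) \<le> (A * B + 1) / (1 + norm (x - c)) ^ M"
    if j: "0 \<le> j" for k j c x
  proof -
    let ?W = "(1 + norm (x - c)) ^ M" and ?D = "dyadic_dilate \<phi> j" and ?a = "2 powi (- j) :: real"
    let ?H = "\<lambda>y. (1 + norm (x - y)) ^ M * norm (?D (x - y))"
    have W: "0 < ?W" by (simp add: add_pos_nonneg)
    have a: "0 < ?a" "?a \<le> 1"
      using j power_int_increasing[of "- j" 0 "2::real"] by simp_all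
    have Ds: "?D \<in> schwartz" by (rule schwartz_dyadic_dilate[OF \<phi>s])
    note [measurable] = schwartz_measurable[OF Ds]
    have H: "?H (x + (- ?a) *\<^sub>R z) = (2 powi j) ^ CARD('n) * ((1 + norm (?a *\<^sub>R z)) ^ M * norm (\<phi> z))" for z
    proof -
      have "(2::real) powi j * ?a = 1" by (simp add: power_int_minus)
      then have "?D (?a *\<^sub>R z) = (2 powi j) ^ CARD('n) *\<^sub>R \<phi> z"
        by (simp add: dyadic_dilate_def power_int_mult)
      then show ?thesis by simp
    qed
    have le: "(1 + norm (?a *\<^sub>R z)) ^ M * norm (\<phi> z) \<le> ?h z" for z
      using a by (intro mult_right_mono power_mono add_left_mono) (auto simp: mult_left_le_one_le)
    have scaled_int: "integrable lborel (\<lambda>z. (1 + norm (?a *\<^sub>R z)) ^ M * norm (\<phi> z))"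
      by (rule Bochner_Integration.integrable_bound[OF h_int]) (use le in \<open>auto simp: abs_mult\<close>)
    have H_int: "integrable lborel ?H"
      using integrable_affine[OF schwartz_weighted_integrable[OF Ds, of M], of "-1" x] by simp
    have one: "\<bar>- ?a\<bar> ^ CARD('n) * (2 powi j) ^ CARD('n) = 1"
      using a by (simp add: power_int_minus flip: power_mult_distrib)
    have "(\<integral>y. ?H y \<partial>lborel) = \<bar>- ?a\<bar> ^ CARD('n) *\<^sub>R (\<integral>z. ?H (x + (- ?a) *\<^sub>R z) \<partial>lborel)"
      using a by (intro integral_affine) auto
    also have "\<dots> = (\<integral>z. (1 + norm (?a *\<^sub>R z)) ^ M * norm (\<phi> z) \<partial>lborel)"
      unfolding H integral_mult_right_zero real_scaleR_def
      by (simp only: mult.assoc[symmetric] one mult_1)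
    also have "\<dots> \<le> B"
      unfolding B_def by (intro integral_mono scaled_int h_int le)
    finally have H_le: "(\<integral>y. ?H y \<partial>lborel) \<le> B" .
    have pt: "norm (packet k c y * ?D (x - y)) \<le> A / ?W * ?H y" for y
    proof -
      have "norm (\<phi> (y - c)) * ?W \<le> norm (\<phi> (y - c)) * ((1 + norm (y - c)) ^ M * (1 + norm (x - y)) ^ M)"
        by (intro mult_left_mono weight_translate_le) simp
      also have "\<dots> \<le> A * (1 + norm (x - y)) ^ M"
        using mult_right_mono[OF A(2)[of "y - c"], of "(1 + norm (x - y)) ^ M"] by (simp add: ac_simps)
      finally have "norm (\<phi> (y - c)) \<le> A / ?W * (1 + norm (x - y)) ^ M"
        using W by (simp add: field_simps)
      from mult_right_mono[OF this, of "norm (?D (x - y))"] show ?thesis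
        by (simp add: packet_def norm_mult mult.assoc)
    qed
    have "norm (packet_piece k c j x) \<le>
        (\<integral>y. norm (packet k c y * ?D (x - y)) \<partial>lborel)"
      unfolding LP_piece_def distribution_of_def by (rule integral_norm_bound)
    also have "\<dots> \<le> (\<integral>y. A / ?W * ?H y \<partial>lborel)"
      by (intro integral_mono pt integrable_norm integrable_mult_right H_int schwartz_integrable
          schwartz_mult schwartz_packet schwartz_reflect_translate \<phi>s Ds)
    also have "\<dots> = A / ?W * (\<integral>y. ?H y \<partial>lborel)" by simp
    also have "\<dots> \<le> A / ?W * B" using A W by (intro mult_left_mono H_le) auto
    also have "\<dots> = A * B / ?W" by simp
    also have "\<dots> \<le> (A * B + 1) / ?W" using W by (intro divide_right_mono) auto
    finally show ?thesis .
  qed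
  show thesis by (rule that[of "A * B + 1"]) (use A B bound in \<open>auto intro: add_nonneg_pos\<close>)
qed

lemma LP_piece_linear:
  shows "sum_piece \<omega> c N j x =
    (\<Sum>k<N. \<omega> k * packet_piece k (c k) j x)"
proof -
  let ?D = "\<lambda>y. dyadic_dilate \<phi> j (x - y)"
  have int: "integrable lborel (\<lambda>y. \<omega> k * (packet k (c k) y * ?D y))" for k
    by (intro integrable_mult_right schwartz_integrable schwartz_mult schwartz_packet \<phi>s
        schwartz_reflect_translate schwartz_dyadic_dilate)
  have "sum_piece \<omega> c N j x =
      (\<integral>y. (\<Sum>k<N. \<omega> k * (packet k (c k) y * ?D y)) \<partial>lborel)"
    by (simp add: LP_piece_def distribution_of_def packet_sum_def sum_distrib_right mult.assoc)
  also have "\<dots> = (\<Sum>k<N. \<integral>y. \<omega> k * (packet k (c k) y * ?D y) \<partial>lborel)"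
    by (rule Bochner_Integration.integral_sum) (rule int)
  finally show ?thesis by (simp add: LP_piece_def distribution_of_def)
qed

text \<open>Base scales of different packets are at least 10 apart, so at a scale next to packet
  \<open>k\<close> every other packet is invisible.\<close>

lemma LP_piece_packet_sum_at:
  assumes k: "k < N" and i: "i \<in> {-1,0,1}"
  shows "sum_piece \<omega> c N (scale_index (k, i)) x =
    \<omega> k * packet_piece k (c k) (scale_index (k, i)) x"
proof -
  have zero: "\<omega> l * packet_piece l (c l) (scale_index (k, i)) x = 0" if "l \<noteq> k" for l
  proof -
    have "2 \<le> \<bar>scale_index (k, i) - int (10 * (l + 1))\<bar>"
      using that i by (auto simp: scale_index_def)
    then show ?thesis by (simp add: LP_piece_packet_zero)
  qed
  have "(\<Sum>l\<in>{..<N} - {k}. \<omega> l * packet_piece l (c l) (scale_index (k, i)) x) = 0"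
    by (intro sum.neutral ballI zero) auto
  then show ?thesis
    unfolding LP_piece_linear using k by (subst sum.remove[of _ k]) (simp_all del: mult_eq_0_iff)
qed

lemma LP_piece_packet_sum_zero:
  assumes j: "j \<notin> scale_index ` ({..<N} \<times> {-1,0,1})"
  shows "sum_piece \<omega> c N j x = 0"
proof -
  have "packet_piece k (c k) j x = 0" if "k < N" for k
  proof (rule LP_piece_packet_zero, rule ccontr)
    assume "\<not> 2 \<le> \<bar>j - int (10 * (k + 1))\<bar>"
    then have "j - int (10 * (k + 1)) \<in> {-1,0,1}" by auto
    then have "scale_index (k, j - int (10 * (k + 1))) \<in> scale_index ` ({..<N} \<times> {-1,0,1})"
      using that by (intro imageI) auto
    then show False using j by (simp add: scale_index_def)
  qed
  then show ?thesis unfolding LP_piece_linear by simp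
qed

text \<open>The sum over scales collapses to packets and offsets, and unimodular coefficients
  disappear. The set \<open>J\<close> is general for the sake of the cube averages, which start at a
  scale depending on the cube. Every active scale is positive, so a \<open>J\<close> that contains
  the nonnegative scales sees everything.\<close>

lemma infsum_LP_pieces:
  fixes c :: "nat \<Rightarrow> real^'n" and N :: nat and r :: real and x
  assumes \<omega>: "\<And>k. norm (\<omega> k) = 1"
  defines "S \<equiv> distribution_of (packet_sum \<omega> c N)"
    and "V \<equiv> \<Sum>k<N. \<Sum>i\<in>{-1,0,1}. norm (packet_piece k (c k) (scale_index (k, i)) x) powr r"
  shows "(\<Sum>\<^sub>\<infinity>j\<in>J. ennpowr (ennreal (norm (LP_piece \<phi> j S x))) r) \<le> ennreal V"
    and "{0..} \<subseteq> J \<Longrightarrow> (\<Sum>\<^sub>\<infinity>j\<in>J. ennpowr (ennreal (norm (LP_piece \<phi> j S x))) r) = ennreal V"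
proof -
  define h where "h j = norm (LP_piece \<phi> j S x) powr r" for j
  let ?I = "scale_index ` ({..<N} \<times> {-1,0,1})"
  have inj: "inj_on scale_index ({..<N} \<times> {-1,0,1})"
    by (rule inj_on_subset[OF inj_on_scale_index]) auto
  have "sum h ?I = (\<Sum>(k, i)\<in>{..<N} \<times> {-1,0,1}. h (scale_index (k, i)))"
    by (subst sum.reindex[OF inj]) (simp add: case_prod_unfold o_def)
  also have "\<dots> = (\<Sum>k<N. \<Sum>i\<in>{-1,0,1}. h (scale_index (k, i)))" by (rule sum.cartesian_product[symmetric])
  also have "\<dots> = V"
    unfolding V_def h_def S_def
    by (intro sum.cong refl) (simp add: LP_piece_packet_sum_at norm_mult \<omega>)
  finally have V: "sum h ?I = V" .
  have eq: "(\<Sum>\<^sub>\<infinity>j\<in>J. ennpowr (ennreal (norm (LP_piece \<phi> j S x))) r) = ennreal (sum h (?I \<inter> J))"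
  proof -
    have "(\<Sum>\<^sub>\<infinity>j\<in>J. ennpowr (ennreal (norm (LP_piece \<phi> j S x))) r) = (\<Sum>\<^sub>\<infinity>j\<in>?I \<inter> J. ennreal (h j))"
      using LP_piece_packet_sum_zero[of _ N \<omega> c x]
      by (intro infsum_cong_neutral) (auto simp: ennpowr_ennreal h_def S_def)
    also have "\<dots> = (\<Sum>j\<in>?I \<inter> J. ennreal (h j))" by (intro infsum_finite) auto
    also have "\<dots> = ennreal (sum h (?I \<inter> J))" by (intro sum_ennreal) (simp add: h_def)
    finally show ?thesis .
  qed
  show "(\<Sum>\<^sub>\<infinity>j\<in>J. ennpowr (ennreal (norm (LP_piece \<phi> j S x))) r) \<le> ennreal V"
    unfolding eq V[symmetric] by (intro ennreal_leI sum_mono2) (auto simp: h_def)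
  assume "{0..} \<subseteq> J"
  moreover have "?I \<subseteq> {0..}" by (auto simp: scale_index_def)
  ultimately have "?I \<inter> J = ?I" by blast
  then show "(\<Sum>\<^sub>\<infinity>j\<in>J. ennpowr (ennreal (norm (LP_piece \<phi> j S x))) r) = ennreal V"
    unfolding eq by (simp add: V)
qed

text \<open>Pigeonhole on the three pieces that add up to the packet; this is the origin of the
  thirds in the lower bounds.\<close>

lemma packet_le_three_max:
  obtains i where "i \<in> {-1,0,1}"
    "norm (\<phi> (x - c)) / 3 \<le> norm (packet_piece k c (scale_index (k, i)) x)"
proof -
  let ?a = "\<lambda>i. norm (packet_piece k c (scale_index (k, i)) x)"
  have "norm (\<phi> (x - c)) = norm (packet k c x)" by (simp add: packet_def norm_mult)
  also have "\<dots> \<le> (\<Sum>i\<in>{-1,0,1}. ?a i)"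
    unfolding LP_piece_packet_sum[of k c x, symmetric] scale_index_def case_prod_conv by (rule norm_sum)
  finally have le: "norm (\<phi> (x - c)) \<le> (\<Sum>i\<in>{-1,0,1}. ?a i)" .
  have "\<exists>i\<in>{-1,0,1}. norm (\<phi> (x - c)) / 3 \<le> ?a i"
  proof (rule ccontr)
    assume "\<not> ?thesis"
    then have "(\<Sum>i\<in>{-1,0,1}. ?a i) < (\<Sum>i\<in>{-1,0,1::int}. norm (\<phi> (x - c)) / 3)"
      by (intro sum_strict_mono) auto
    then show False using le by simp
  qed
  then show thesis using that by blast
qed

end

section \<open>The multiplier\<close>

text \<open>Multiplying a transform by \<open>wave (- a)\<close> translates the function by
  \<open>a\<close>, hence the sign.\<close>

definition shift_term :: "(real^'n::finite \<Rightarrow> real) \<Rightarrow> real^'n \<Rightarrow> nat \<Rightarrow> real^'n \<Rightarrow> complex" where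
  "shift_term \<eta> v k \<xi> = complex_of_real (\<eta> ((2 powi (- int (10 * (k + 1)))) *\<^sub>R \<xi>)) * wave (- (real k *\<^sub>R v)) \<xi>"

text \<open>The series only serves to pick out, at each \<open>\<xi>\<close>, the one term that can
  be nonzero there.\<close>

definition shift_multiplier :: "(real^'n::finite \<Rightarrow> real) \<Rightarrow> real^'n \<Rightarrow> real^'n \<Rightarrow> complex" where
  "shift_multiplier \<eta> v \<xi> = (\<Sum>k. shift_term \<eta> v k \<xi>)"

section \<open>Disjoint annuli and boundedness of the multiplier\<close>

lemma herz_cutoff_nonzero:
  assumes "herz_cutoff \<eta>" "\<eta> \<xi> \<noteq> 0" shows "1/4 \<le> norm \<xi>" "norm \<xi> \<le> 4"
proof -
  have "\<xi> \<in> supp \<eta>" using assms(2) closure_subset[of "{x. \<eta> x \<noteq> 0}"] unfolding supp_def by fast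
  then show "1/4 \<le> norm \<xi>" "norm \<xi> \<le> 4" using assms(1) unfolding herz_cutoff_def by auto
qed

lemma schwartz_herz_cutoff:
  fixes \<eta> :: "real^'n::finite \<Rightarrow> real"
  assumes "herz_cutoff \<eta>" shows "(\<lambda>x. complex_of_real (\<eta> x)) \<in> schwartz"
  using assms by (intro schwartz_of_real_smooth[of \<eta> 4]) (auto simp: herz_cutoff_def)

lemma norm_rescale: "norm ((2 powi (- int n)) *\<^sub>R x) = norm x / 2 ^ n"
  by (simp add: power_int_minus divide_inverse mult.commute)

lemma shift_term_nonzero:
  assumes "herz_cutoff \<eta>" "shift_term \<eta> v k \<xi> \<noteq> 0"
  shows "2 ^ (10 * (k + 1)) / 4 \<le> norm \<xi>" "norm \<xi> \<le> 4 * 2 ^ (10 * (k + 1))"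
proof -
  have "\<eta> ((2 powi (- int (10 * (k + 1)))) *\<^sub>R \<xi>) \<noteq> 0" using assms(2) by (simp add: shift_term_def)
  from herz_cutoff_nonzero[OF assms(1) this, unfolded norm_rescale] show "2 ^ (10 * (k + 1)) / 4 \<le> norm \<xi>" "norm \<xi> \<le> 4 * 2 ^ (10 * (k + 1))"
    by (simp_all add: field_simps)
qed

text \<open>A term lives where \<open>norm \<xi>\<close> is within a factor 4 of its frequency;
  consecutive frequencies differ by the factor 1024, which exceeds 16.\<close>

lemma shift_term_unique:
  assumes "herz_cutoff \<eta>" "shift_term \<eta> v k \<xi> \<noteq> 0" "shift_term \<eta> v l \<xi> \<noteq> 0"
  shows "k = l"
proof -
  have "\<not> k < l" if "shift_term \<eta> v k \<xi> \<noteq> 0" "shift_term \<eta> v l \<xi> \<noteq> 0" for k l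
  proof
    assume "k < l"
    then have "(2::real) ^ (10 * (k + 1) + 10) \<le> 2 ^ (10 * (l + 1))" by (intro power_increasing) auto
    then have "1024 * (2::real) ^ (10 * (k + 1)) \<le> 2 ^ (10 * (l + 1))" by (simp only: power_add) simp
    then show False
      using shift_term_nonzero[OF assms(1) that(1)] shift_term_nonzero[OF assms(1) that(2)] power_freq_ge[of k]
      by linarith
  qed
  then show ?thesis using assms(2,3) by (meson linorder_neqE_nat)
qed

lemma shift_multiplier_sums:
  assumes "\<And>l. l \<noteq> k \<Longrightarrow> shift_term \<eta> v l \<xi> = 0"
  shows "(\<lambda>k. shift_term \<eta> v k \<xi>) sums shift_term \<eta> v k \<xi>"
  using sums_finite[of "{k}" "\<lambda>k. shift_term \<eta> v k \<xi>"] assms by auto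

lemma shift_multiplier_eq:
  assumes "\<And>l. l \<noteq> k \<Longrightarrow> shift_term \<eta> v l \<xi> = 0"
  shows "shift_multiplier \<eta> v \<xi> = shift_term \<eta> v k \<xi>"
  unfolding shift_multiplier_def using sums_unique[OF shift_multiplier_sums[OF assms]] by simp

lemma shift_term_others_zero:
  assumes "herz_cutoff \<eta>"
  obtains k where "\<And>l. l \<noteq> k \<Longrightarrow> shift_term \<eta> v l \<xi> = 0"
  using shift_term_unique[OF assms, of v _ \<xi>] by metis

text \<open>Measurability comes from the partial sums, the bound 1 from the single active
  term.\<close>

lemma shift_multiplier_in_Linfty:
  fixes \<eta> :: "real^'n::finite \<Rightarrow> real"
  assumes \<eta>: "herz_cutoff \<eta>" shows "shift_multiplier \<eta> v \<in> Linfty"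
proof -
  have [measurable]: "\<eta> \<in> borel_measurable borel"
  proof -
    have "(\<lambda>x. Re (complex_of_real (\<eta> x))) \<in> borel_measurable borel"
      by (rule measurable_compose[OF schwartz_measurable[OF schwartz_herz_cutoff[OF \<eta>]]]) measurable
    then show ?thesis by simp
  qed
  have meas: "shift_multiplier \<eta> v \<in> borel_measurable borel"
  proof (rule borel_measurable_LIMSEQ_metric)
    show "(\<lambda>\<xi>. \<Sum>k<i. shift_term \<eta> v k \<xi>) \<in> borel_measurable borel" for i
      unfolding shift_term_def by measurable
    show "(\<lambda>i. \<Sum>k<i. shift_term \<eta> v k \<xi>) \<longlonglongrightarrow> shift_multiplier \<eta> v \<xi>" for \<xi>
    proof -
      obtain k where k: "\<And>l. l \<noteq> k \<Longrightarrow> shift_term \<eta> v l \<xi> = 0" by (rule shift_term_others_zero[OF \<eta>]) blast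
      have "(\<lambda>k. shift_term \<eta> v k \<xi>) sums shift_term \<eta> v k \<xi>"
        by (rule shift_multiplier_sums) (rule k)
      moreover have "shift_multiplier \<eta> v \<xi> = shift_term \<eta> v k \<xi>"
        by (rule shift_multiplier_eq) (rule k)
      ultimately show ?thesis by (simp only: sums_def)
    qed
  qed
  have "norm (shift_multiplier \<eta> v \<xi>) \<le> 1" for \<xi>
  proof -
    obtain k where k: "\<And>l. l \<noteq> k \<Longrightarrow> shift_term \<eta> v l \<xi> = 0" by (rule shift_term_others_zero[OF \<eta>]) blast
    have "0 \<le> \<eta> y \<and> \<eta> y \<le> 1" for y using \<eta> by (simp add: herz_cutoff_def)
    moreover have "shift_multiplier \<eta> v \<xi> = shift_term \<eta> v k \<xi>"
      by (rule shift_multiplier_eq) (rule k)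
    ultimately show ?thesis by (simp add: shift_term_def norm_mult)
  qed
  then have "esssup lborel (\<lambda>\<xi>. ennreal (norm (shift_multiplier \<eta> v \<xi>))) \<le> 1"
    using meas by (intro esssup_I AE_I2) auto
  then have "Lp_norm lborel \<infinity> (\<lambda>\<xi>. ennreal (norm (shift_multiplier \<eta> v \<xi>))) < \<infinity>"
    by (simp add: Lp_norm_def le_less_trans[OF _ ennreal_one_less_top])
  then show ?thesis using meas by (simp add: Linfty_def)
qed

section \<open>Herz norms of translates\<close>

lemma sets_herz_shell[measurable]: "(herz_shell k :: (real^'n::finite) set) \<in> sets borel"
proof -
  have "{x\<in>space borel. norm (x :: real^'n) \<le> 2} \<in> sets borel"
    "{x\<in>space borel. 2 ^ k < norm (x :: real^'n) \<and> norm x \<le> 2 ^ (k + 1)} \<in> sets borel"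
    by measurable
  then show ?thesis by (simp add: herz_shell_def)
qed

text \<open>Unless the shell radius and \<open>norm a\<close> are comparable, one of
  \<open>norm x\<close> and \<open>norm a\<close> exceeds the other by a factor 2, and the triangle
  inequality leaves half the shell radius.\<close>

lemma herz_shell_far:
  assumes "x \<in> herz_shell k" "\<not> (2 ^ k < 2 * norm a \<and> norm a < 2 ^ (k + 2))" "k \<noteq> 0"
  shows "2 ^ k / 2 \<le> norm (x - a)"
proof -
  have x: "2 ^ k < norm x" "norm x \<le> 2 * 2 ^ k" using assms(1,3) by (auto simp: herz_shell_def)
  have t: "norm x - norm a \<le> norm (x - a)" "norm a - norm x \<le> norm (x - a)"
    using norm_triangle_ineq2[of x a] norm_triangle_ineq2[of a x] by (simp_all add: norm_minus_commute)
  have p: "(0::real) < 2 ^ k" by simp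
  consider "2 * norm a \<le> 2 ^ k" | "4 * 2 ^ k \<le> norm a" using assms(2) by (force simp: not_less)
  then show ?thesis by cases (use x t p in linarith)+
qed

text \<open>The condition confines \<open>2 ^ k\<close> strictly between \<open>s / 4\<close> and
  \<open>2 * s\<close>, a range of ratio 8, so it holds for at most three consecutive
  \<open>k\<close>.\<close>

lemma dyadic_window:
  fixes s :: real
  obtains k0 where "{k::nat. 2 ^ k < 2 * s \<and> s < 2 ^ (k + 2)} \<subseteq> {k0..<k0 + 3}"
proof (cases "{k::nat. 2 ^ k < 2 * s \<and> s < 2 ^ (k + 2)} = {}")
  case True
  then show thesis using that by blast
next
  case False
  define P where "P k \<longleftrightarrow> 2 ^ k < 2 * s \<and> s < 2 ^ (k + 2)" for k :: nat
  define k0 where "k0 = (LEAST k. P k)"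
  have "\<exists>k. P k" using False by (auto simp: P_def)
  then have k0: "P k0" unfolding k0_def by (rule LeastI_ex)
  have "k < k0 + 3" if "P k" for k
  proof (rule ccontr)
    assume "\<not> k < k0 + 3"
    then have "(2::real) ^ (k0 + 3) \<le> 2 ^ k" by (intro power_increasing) auto
    then show False using that k0 by (simp add: P_def power_add)
  qed
  moreover have "k0 \<le> k" if "P k" for k unfolding k0_def using that by (rule Least_le)
  ultimately have "{k. P k} \<subseteq> {k0..<k0 + 3}" by auto
  then show thesis by (intro that[of k0]) (simp add: P_def)
qed

text \<open>Decay of order \<open>M\<close> with \<open>M * w \<ge> 2 * CARD('n) + w\<close> is
  split. The part \<open>2 * CARD('n)\<close> makes the integral finite uniformly in
  \<open>a\<close>; the part \<open>w\<close> gives \<open>(2 ^ k / 2) powr (- w)\<close> on shells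
  far from \<open>a\<close>, which the root \<open>1 / w\<close> turns into
  \<open>2 * (1/2) ^ k\<close>.\<close>

lemma Lp_norm_herz_shell_le:
  fixes f :: "real^'n::finite \<Rightarrow> complex"
  assumes decay: "\<And>N. \<exists>C. \<forall>x. (1 + norm x) ^ N * norm (f x) \<le> C" and w: "0 < w"
  obtains B where "B > 0" and "\<And>a k. ennpowr (\<integral>\<^sup>+x. ennpowr (ennreal (norm (f (x - a)))) w \<partial>restrict_space lborel (herz_shell k)) (1 / w)
    \<le> ennreal (B * (if 2 ^ k < 2 * norm a \<and> norm a < 2 ^ (k + 2) then 1 else (1/2) ^ k))"
proof -
  obtain M :: nat where M: "(real (2 * CARD('n)) + w) / w \<le> real M" using real_arch_simple by blast
  have Mw: "real (2 * CARD('n)) + w \<le> real M * w" using M w by (simp add: field_simps)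
  obtain C0 where C0: "\<And>x. (1 + norm x) ^ M * norm (f x) \<le> C0" using decay[of M] by blast
  define C where "C = max C0 1"
  have C: "C > 0" "\<And>x. (1 + norm x) ^ M * norm (f x) \<le> C"
    using C0 by (auto simp: C_def le_max_iff_disj)
  obtain I :: real where I: "0 \<le> I" and
    I_eq: "\<And>a::real^'n. (\<integral>\<^sup>+x. ennreal (1 / (1 + norm (x - a)) ^ (2 * CARD('n))) \<partial>lborel) = ennreal I"
    by (rule nn_integral_decay) blast
  have pt: "norm (f y) powr w \<le> (C powr w * (1 + norm y) powr (- w)) * (1 / (1 + norm y) ^ (2 * CARD('n)))" for y
  proof -
    have p: "0 < 1 + norm y" "1 \<le> 1 + norm y" by (simp_all add: add_pos_nonneg)
    have "norm (f y) \<le> C * (1 + norm y) powr (- real M)"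
      unfolding powr_minus_nat[OF p(1)] by (rule decay_le_weight[OF C(2)])
    then have "norm (f y) powr w \<le> (C * (1 + norm y) powr (- real M)) powr w"
      using w by (intro powr_mono2) auto
    also have "\<dots> = C powr w * (1 + norm y) powr (- (real M * w))"
      using C(1) p by (simp add: powr_mult powr_powr)
    also have "\<dots> \<le> C powr w * (1 + norm y) powr (- w - real (2 * CARD('n)))"
      using Mw p by (intro mult_left_mono powr_mono) auto
    also have "(1 + norm y) powr (- w - real (2 * CARD('n))) = (1 + norm y) powr (- w) * (1 / (1 + norm y) ^ (2 * CARD('n)))"
      using p by (simp only: powr_diff powr_realpow) simp
    finally show ?thesis by (simp add: mult.assoc)
  qed
  define B where "B = 2 * (C * (I powr (1 / w)) + 1)"
  have "B > 0" using C I by (auto simp: B_def intro!: add_nonneg_pos)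
  moreover have "ennpowr (\<integral>\<^sup>+x. ennpowr (ennreal (norm (f (x - a)))) w \<partial>restrict_space lborel (herz_shell k)) (1 / w)
    \<le> ennreal (B * (if 2 ^ k < 2 * norm a \<and> norm a < 2 ^ (k + 2) then 1 else (1/2) ^ k))" for a k
  proof -
    \<comment> \<open>The innermost shell is a full ball, on which \<open>norm (x - a)\<close> has
      no useful lower bound. It is treated like a near shell, at no loss since
      \<open>(1/2) ^ 0 = 1\<close>.\<close>
    define \<beta> where "\<beta> = (if 2 ^ k < 2 * norm a \<and> norm a < 2 ^ (k + 2) \<or> k = 0 then (1::real) else (2 ^ k / 2) powr (- w))"
    have \<beta>: "0 \<le> \<beta>" by (simp add: \<beta>_def)
    have far: "(1 + norm (x - a)) powr (- w) \<le> \<beta>" if "x \<in> herz_shell k" for x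
    proof (cases "2 ^ k < 2 * norm a \<and> norm a < 2 ^ (k + 2) \<or> k = 0")
      case True
      have "(1 + norm (x - a)) powr (- w) \<le> (1 + norm (x - a)) powr 0"
        using w by (intro powr_mono) auto
      also have "\<dots> = 1" by (simp add: add_nonneg_eq_0_iff)
      finally show ?thesis using True by (simp add: \<beta>_def)
    next
      case False
      then have "2 ^ k / 2 \<le> norm (x - a)" using herz_shell_far[OF that] by blast
      then have "(1 + norm (x - a)) powr (- w) \<le> (2 ^ k / 2) powr (- w)"
        using w by (intro powr_mono2') auto
      then show ?thesis using False by (auto simp: \<beta>_def)
    qed
    have "(\<integral>\<^sup>+x. ennpowr (ennreal (norm (f (x - a)))) w \<partial>restrict_space lborel (herz_shell k)) =
        (\<integral>\<^sup>+x. ennreal (norm (f (x - a)) powr w) * indicator (herz_shell k) x \<partial>lborel)"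
      by (subst nn_integral_restrict_space) (auto simp: ennpowr_ennreal)
    also have "\<dots> \<le> (\<integral>\<^sup>+x. ennreal (C powr w * \<beta>) * ennreal (1 / (1 + norm (x - a)) ^ (2 * CARD('n))) \<partial>lborel)"
    proof (rule nn_integral_mono)
      fix x
      show "ennreal (norm (f (x - a)) powr w) * indicator (herz_shell k) x \<le>
          ennreal (C powr w * \<beta>) * ennreal (1 / (1 + norm (x - a)) ^ (2 * CARD('n)))"
      proof (cases "x \<in> herz_shell k")
        case True
        have "(C powr w * (1 + norm (x - a)) powr (- w)) * (1 / (1 + norm (x - a)) ^ (2 * CARD('n)))
            \<le> (C powr w * \<beta>) * (1 / (1 + norm (x - a)) ^ (2 * CARD('n)))"
          by (intro mult_right_mono mult_left_mono far True) auto
        with pt[of "x - a"] have "norm (f (x - a)) powr w \<le> (C powr w * \<beta>) * (1 / (1 + norm (x - a)) ^ (2 * CARD('n)))"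
          by (rule order_trans)
        then show ?thesis using True \<beta> by (simp add: ennreal_leI flip: ennreal_mult)
      qed simp
    qed
    also have "\<dots> = ennreal (C powr w * \<beta> * I)"
      using \<beta> I by (subst nn_integral_cmult) (auto simp: I_eq ennreal_mult)
    finally have "ennpowr (\<integral>\<^sup>+x. ennpowr (ennreal (norm (f (x - a)))) w \<partial>restrict_space lborel (herz_shell k)) (1 / w)
        \<le> ennpowr (ennreal (C powr w * \<beta> * I)) (1 / w)"
      using w by (intro ennpowr_mono) auto
    also have "\<dots> = ennreal (C * \<beta> powr (1 / w) * I powr (1 / w))"
      using C \<beta> I w by (simp add: ennpowr_ennreal powr_mult powr_powr)
    also have "\<dots> \<le> ennreal (B * (if 2 ^ k < 2 * norm a \<and> norm a < 2 ^ (k + 2) then 1 else (1/2) ^ k))"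
    proof (rule ennreal_leI)
      have \<beta>w: "\<beta> powr (1 / w) \<le> 2 * (if 2 ^ k < 2 * norm a \<and> norm a < 2 ^ (k + 2) then 1 else (1/2) ^ k)"
      proof (cases "2 ^ k < 2 * norm a \<and> norm a < 2 ^ (k + 2) \<or> k = 0")
        case True
        then have "\<beta> = 1" by (simp add: \<beta>_def)
        then show ?thesis using True by auto
      next
        case False
        then have "\<beta> = (2 ^ k / 2) powr (- w)" by (auto simp: \<beta>_def)
        then have "\<beta> powr (1 / w) = (2 ^ k / 2) powr (- 1)"
          using w by (simp add: powr_powr)
        also have "\<dots> = 2 * (1/2) ^ k" by (simp add: powr_minus power_one_over field_simps)
        finally show ?thesis using False by auto
      qed
      have "C * \<beta> powr (1 / w) * I powr (1 / w) = (C * I powr (1 / w)) * \<beta> powr (1 / w)" by (simp add: ac_simps)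
      also have "\<dots> \<le> (C * I powr (1 / w) + 1) * (2 * (if 2 ^ k < 2 * norm a \<and> norm a < 2 ^ (k + 2) then 1 else (1/2) ^ k))"
        using C by (intro mult_mono \<beta>w) auto
      finally show "C * \<beta> powr (1 / w) * I powr (1 / w) \<le>
          B * (if 2 ^ k < 2 * norm a \<and> norm a < 2 ^ (k + 2) then 1 else (1/2) ^ k)"
        unfolding B_def by (simp only: ac_simps)
    qed
    finally show ?thesis .
  qed
  ultimately show thesis by (rule that)
qed

text \<open>Outside the window the terms decay geometrically, inside it there are at most three
  bounded ones. The total is therefore independent of the position \<open>s a\<close> of the
  window.\<close>

lemma lp_norm_geometric_window_le:
  fixes A :: "'b \<Rightarrow> nat \<Rightarrow> ennreal" and s :: "'b \<Rightarrow> real"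
  assumes t: "0 < t" and "B > 0"
    and A: "\<And>a k. A a k \<le> ennreal (B * (if 2 ^ k < 2 * s a \<and> s a < 2 ^ (k + 2) then 1 else (1/2) ^ k))"
  obtains D where "\<And>a. lp_norm t (A a) \<le> ennreal D"
proof (cases "t = \<infinity>")
  case True
  have "A a k \<le> ennreal B" for a k
  proof -
    have "B * (if 2 ^ k < 2 * s a \<and> s a < 2 ^ (k + 2) then 1 else (1/2) ^ k) \<le> B * 1"
      using \<open>B > 0\<close> by (intro mult_left_mono) (auto simp: power_le_one)
    then show ?thesis using A[of a k] by (auto intro: order_trans ennreal_leI)
  qed
  then have "lp_norm t (A a) \<le> ennreal B" for a
    using True by (auto simp: lp_norm_def intro!: SUP_least)
  then show thesis by (rule that)
next
  case False
  define \<tau> where "\<tau> = enn2real t"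
  have \<tau>: "\<tau> > 0" using t False by (simp add: \<tau>_def enn2real_positive_iff less_top)
  define \<rho> :: real where "\<rho> = (1/2) powr \<tau>"
  have \<rho>: "0 < \<rho>" "\<rho> < 1" using \<tau> powr_less_mono2[of \<tau> "1/2" 1] by (simp_all add: \<rho>_def)
  \<comment> \<open>The geometric series covers the far shells, the 3 counts the shells of the
    window.\<close>
  define D where "D = B powr \<tau> * ((\<Sum>k. \<rho> ^ k) + 3)"
  have D: "0 \<le> D" using \<rho> by (auto simp: D_def suminf_nonneg summable_geometric intro!: mult_nonneg_nonneg add_nonneg_nonneg)
  have "(\<Sum>\<^sub>\<infinity>k. ennpowr (A a k) \<tau>) \<le> ennreal D" for a
  proof (rule infsum_le_finite_sums)
    show "(\<lambda>k. ennpowr (A a k) \<tau>) summable_on UNIV" by (rule nonneg_summable_on_complete) simp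
    fix F :: "nat set" assume F: "finite F"
    let ?E = "{k::nat. 2 ^ k < 2 * s a \<and> s a < 2 ^ (k + 2)}"
    obtain k0 where k0: "?E \<subseteq> {k0..<k0 + 3}" by (rule dyadic_window)
    have le: "ennpowr (A a k) \<tau> \<le> ennreal (B powr \<tau> * (\<rho> ^ k + indicator {k0..<k0 + 3} k))" for k
    proof -
      have "ennpowr (A a k) \<tau> \<le> ennpowr (ennreal (B * (if k \<in> ?E then 1 else (1/2) ^ k))) \<tau>"
        using A[of a k] \<tau> by (intro ennpowr_mono) auto
      also have "\<dots> = ennreal (B powr \<tau> * (if k \<in> ?E then 1 else (1/2) ^ k) powr \<tau>)"
        using \<open>B > 0\<close> by (subst ennpowr_ennreal) (auto simp: powr_mult)
      also have "\<dots> \<le> ennreal (B powr \<tau> * (\<rho> ^ k + indicator {k0..<k0 + 3} k))"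
      proof (intro ennreal_leI mult_left_mono)
        have "((1/2) ^ k) powr \<tau> = \<rho> ^ k"
          unfolding \<rho>_def by (simp add: powr_powr mult.commute flip: powr_realpow)
        then show "(if k \<in> ?E then 1 else (1/2) ^ k) powr \<tau> \<le> \<rho> ^ k + indicator {k0..<k0 + 3} k"
          using k0 \<rho> by (auto simp: indicator_def)
      qed simp
      finally show ?thesis .
    qed
    have "(\<Sum>k\<in>F. ennpowr (A a k) \<tau>) \<le> (\<Sum>k\<in>F. ennreal (B powr \<tau> * (\<rho> ^ k + indicator {k0..<k0 + 3} k)))"
      by (intro sum_mono le)
    also have "\<dots> = ennreal (B powr \<tau> * ((\<Sum>k\<in>F. \<rho> ^ k) + (\<Sum>k\<in>F. indicator {k0..<k0 + 3} k)))"
      using \<rho> by (subst sum_ennreal) (auto simp: sum_distrib_left[symmetric] sum.distrib)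
    also have "\<dots> \<le> ennreal D"
      unfolding D_def
    proof (intro ennreal_leI mult_left_mono add_mono)
      show "(\<Sum>k\<in>F. \<rho> ^ k) \<le> (\<Sum>k. \<rho> ^ k)"
        using \<rho> F by (intro sum_le_suminf summable_geometric) auto
      have "(\<Sum>k\<in>F. indicator {k0..<k0 + 3} k) = real (card (F \<inter> {k0..<k0 + 3}))"
        unfolding real_of_card sum.inter_restrict[OF F] by (intro sum.cong) (auto simp: indicator_def)
      also have "\<dots> \<le> real (card {k0..<k0 + 3})"
        by (intro of_nat_mono card_mono) auto
      finally show "(\<Sum>k\<in>F. indicator {k0..<k0 + 3} k) \<le> (3::real)" by simp
    qed simp
    finally show "(\<Sum>k\<in>F. ennpowr (A a k) \<tau>) \<le> ennreal D" .
  qed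
  then have "lp_norm t (A a) \<le> ennreal (D powr (1 / \<tau>))" for a
    using False \<tau> D ennpowr_mono[of _ "ennreal D" "1 / \<tau>"]
    by (simp add: lp_norm_def \<tau>_def ennpowr_ennreal)
  then show thesis by (rule that)
qed

text \<open>Here the weight exponent 0 enters: the window of near shells contributes a bounded
  amount however far out \<open>a\<close> puts it.\<close>

lemma herz_norm_translates_bounded:
  fixes f :: "real^'n::finite \<Rightarrow> complex"
  assumes decay: "\<And>N. \<exists>C. \<forall>x. (1 + norm x) ^ N * norm (f x) \<le> C"
    and u: "0 < u" "u \<noteq> \<infinity>" and t: "0 < t"
  obtains D where "\<And>a. herz_norm u 0 t (\<lambda>x. f (x - a)) \<le> ennreal D"
proof -
  have w: "0 < enn2real u" using u by (simp add: enn2real_positive_iff less_top)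
  obtain B where B: "B > 0" "\<And>a k. ennpowr (\<integral>\<^sup>+x. ennpowr (ennreal (norm (f (x - a)))) (enn2real u)
      \<partial>restrict_space lborel (herz_shell k)) (1 / enn2real u)
    \<le> ennreal (B * (if 2 ^ k < 2 * norm a \<and> norm a < 2 ^ (k + 2) then 1 else (1/2) ^ k))"
    by (rule Lp_norm_herz_shell_le[OF decay w]) blast
  obtain D where D: "\<And>a. lp_norm t (\<lambda>k. Lp_norm (restrict_space lborel (herz_shell k)) u
      (\<lambda>x. ennreal (norm (f (x - a))))) \<le> ennreal D"
    by (rule lp_norm_geometric_window_le[OF t B(1),
          of "\<lambda>a k. Lp_norm (restrict_space lborel (herz_shell k)) u (\<lambda>x. ennreal (norm (f (x - a))))" norm])
       (use B(2) u in \<open>auto simp: Lp_norm_def\<close>)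
  show thesis by (rule that[of D]) (simp add: herz_norm_def D)
qed

section \<open>Dilates of the multiplier against the Herz cutoff\<close>

lemma inv_fourier_wave_mult: "inv_fourier (\<lambda>\<xi>. h \<xi> * wave (- a) \<xi>) x = inv_fourier h (x - a)"
proof -
  have diff: "x - a = - a + x" by simp
  have "h \<xi> * wave (- a) \<xi> * wave x \<xi> = h \<xi> * wave (x - a) \<xi>" for \<xi>
    unfolding diff wave_add_freq by (simp only: mult.assoc)
  then show ?thesis by (simp only: inv_fourier_wave)
qed

text \<open>Both cutoffs allow a factor 4 on either side, so \<open>2 powi j\<close> and
  \<open>2 ^ (10 * (l + 1))\<close> agree up to a factor 16, that is, up to four dyadic
  steps.\<close>

lemma shift_term_dilated_near:
  fixes \<eta> :: "real^'n::finite \<Rightarrow> real"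
  assumes \<eta>: "herz_cutoff \<eta>" and nz: "shift_term \<eta> v l ((2 powi j) *\<^sub>R \<xi>) \<noteq> 0" "\<eta> \<xi> \<noteq> 0"
  shows "\<bar>j - int (10 * (l + 1))\<bar> \<le> 4"
proof (rule ccontr)
  define A :: real where "A = 2 ^ (10 * (l + 1))"
  have A: "A > 0" by (simp add: A_def)
  have "A / 4 \<le> 2 powi j * norm \<xi>" "2 powi j * norm \<xi> \<le> 4 * A"
    using shift_term_nonzero[OF \<eta> nz(1)] by (simp_all add: A_def)
  moreover have "2 powi j * norm \<xi> \<le> 2 powi j * 4" "2 powi j * (1/4) \<le> 2 powi j * norm \<xi>"
    using herz_cutoff_nonzero[OF \<eta> nz(2)] by (intro mult_left_mono; simp)+
  ultimately have j: "A / 16 \<le> 2 powi j" "2 powi j \<le> 16 * A" by linarith+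
  have A_powi: "2 powi (int (10 * (l + 1)) + i) = A * 2 powi i" for i
    unfolding A_def by (rule power_int_add_nat)
  assume "\<not> \<bar>j - int (10 * (l + 1))\<bar> \<le> 4"
  then consider "j \<ge> int (10 * (l + 1)) + 5" | "j \<le> int (10 * (l + 1)) + (- 5)" by linarith
  then show False
  proof cases
    case 1
    have "(2::real) powi (int (10 * (l + 1)) + 5) \<le> 2 powi j" using 1 by (intro power_int_increasing) auto
    then have "A * 32 \<le> 2 powi j" unfolding A_powi by simp
    then show False using j A by linarith
  next
    case 2
    have "(2::real) powi j \<le> 2 powi (int (10 * (l + 1)) + (- 5))" using 2 by (intro power_int_increasing) auto
    then have "2 powi j \<le> A / 32" unfolding A_powi by (simp add: power_int_minus)
    then show False using j A by linarith
  qed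
qed

text \<open>Windows of radius 4 around multiples of 10 are disjoint, so the cutoff meets at most one
  term. Up to a modulation the product depends on \<open>j\<close> only through the offset
  \<open>i\<close>, which leaves nine functions.\<close>

lemma dilated_shift_multiplier_cases:
  fixes \<eta> :: "real^'n::finite \<Rightarrow> real"
  assumes \<eta>: "herz_cutoff \<eta>"
  obtains (zero) "\<And>\<xi>. shift_multiplier \<eta> v ((2 powi j) *\<^sub>R \<xi>) * complex_of_real (\<eta> \<xi>) = 0"
  | (shift) i a where "i \<in> {-4..4}"
    "\<And>\<xi>. shift_multiplier \<eta> v ((2 powi j) *\<^sub>R \<xi>) * complex_of_real (\<eta> \<xi>) =
      (complex_of_real (\<eta> ((2 powi i) *\<^sub>R \<xi>)) * complex_of_real (\<eta> \<xi>)) * wave (- a) \<xi>"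
proof (cases "\<exists>k. \<bar>j - int (10 * (k + 1))\<bar> \<le> 4")
  case True
  then obtain k where k: "\<bar>j - int (10 * (k + 1))\<bar> \<le> 4" by blast
  let ?i = "j + - int (10 * (k + 1))"
  show thesis
  \<comment> \<open>Dilating the frequency by \<open>2 powi j\<close> lengthens the translation by
    the same factor; the bound uniform over translates absorbs it.\<close>
  proof (rule shift[of ?i "(2 powi j) *\<^sub>R (real k *\<^sub>R v)"])
    show "?i \<in> {-4..4}" using k by auto
    fix \<xi>
    have eq: "shift_multiplier \<eta> v ((2 powi j) *\<^sub>R \<xi>) =
        complex_of_real (\<eta> ((2 powi ?i) *\<^sub>R \<xi>)) * wave (- ((2 powi j) *\<^sub>R (real k *\<^sub>R v))) \<xi>" if "\<eta> \<xi> \<noteq> 0"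
    proof -
      have "shift_term \<eta> v l ((2 powi j) *\<^sub>R \<xi>) = 0" if "l \<noteq> k" for l
        using shift_term_dilated_near[OF \<eta> _ \<open>\<eta> \<xi> \<noteq> 0\<close>, of v l j] that k by fastforce
      then have "shift_multiplier \<eta> v ((2 powi j) *\<^sub>R \<xi>) = shift_term \<eta> v k ((2 powi j) *\<^sub>R \<xi>)"
        by (rule shift_multiplier_eq)
      moreover have "(2 powi (- int (10 * (k + 1)))) *\<^sub>R (2 powi j) *\<^sub>R \<xi> = ((2::real) powi ?i) *\<^sub>R \<xi>"
        by (subst power_int_add) (simp_all add: mult.commute)
      moreover have "wave (- (real k *\<^sub>R v)) ((2 powi j) *\<^sub>R \<xi>) = wave (- ((2 powi j) *\<^sub>R (real k *\<^sub>R v))) \<xi>"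
        by (simp add: ac_simps)
      ultimately show ?thesis by (simp only: shift_term_def)
    qed
    show "shift_multiplier \<eta> v ((2 powi j) *\<^sub>R \<xi>) * complex_of_real (\<eta> \<xi>) =
      (complex_of_real (\<eta> ((2 powi ?i) *\<^sub>R \<xi>)) * complex_of_real (\<eta> \<xi>)) * wave (- ((2 powi j) *\<^sub>R (real k *\<^sub>R v))) \<xi>"
    proof (cases "\<eta> \<xi> = 0")
      case False
      show ?thesis unfolding eq[OF False] by (simp only: ac_simps)
    qed simp
  qed
next
  case False
  show thesis
  proof (rule zero)
    fix \<xi>
    have "shift_term \<eta> v l ((2 powi j) *\<^sub>R \<xi>) = 0" if "\<eta> \<xi> \<noteq> 0" for l
      using shift_term_dilated_near[OF \<eta> _ that, of v l j] False by blast
    then show "shift_multiplier \<eta> v ((2 powi j) *\<^sub>R \<xi>) * complex_of_real (\<eta> \<xi>) = 0"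
      by (cases "\<eta> \<xi> = 0") (simp_all add: shift_multiplier_def)
  qed
qed

lemma schwartz_inv_fourier_decay:
  fixes h :: "real^'n::finite \<Rightarrow> complex"
  assumes "h \<in> schwartz" shows "\<exists>C. \<forall>x. (1 + norm x) ^ N * norm (inv_fourier h x) \<le> C"
proof -
  obtain C where C: "\<And>\<xi>. (1 + norm \<xi>) ^ N * norm (fourier h \<xi>) \<le> C" using fourier_decay[OF assms, of N] by metis
  show ?thesis using C[of "- x" for x] by (auto simp: inv_fourier_eq_fourier)
qed

text \<open>Every inverse transform in the supremum is zero or a translate of one of nine rapidly
  decaying functions, each with a bound valid for all its translates.\<close>

lemma herz_multiplier_norm_shift_multiplier:
  fixes \<eta> :: "real^'n::finite \<Rightarrow> real"
  assumes \<eta>: "herz_cutoff \<eta>" and u: "0 < u" "u \<noteq> \<infinity>" and t: "0 < t"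
  shows "herz_multiplier_norm \<eta> u 0 t (shift_multiplier \<eta> v) < \<infinity>"
proof -
  define h where "h i \<xi> = complex_of_real (\<eta> ((2 powi i) *\<^sub>R \<xi>)) * complex_of_real (\<eta> \<xi>)" for i :: int and \<xi>
  have hs: "h i \<in> schwartz" for i
  proof -
    have "(\<lambda>\<xi>. complex_of_real (\<eta> ((2 powi i) *\<^sub>R \<xi> + 0))) \<in> schwartz"
      by (rule schwartz_affine[OF schwartz_herz_cutoff[OF \<eta>]]) simp
    then show ?thesis
      unfolding h_def[abs_def] using schwartz_mult[OF _ schwartz_herz_cutoff[OF \<eta>]] by simp
  qed
  have "\<exists>D. \<forall>a. herz_norm u 0 t (\<lambda>x. g (x - a)) \<le> ennreal D"
    if "\<And>N. \<exists>C. \<forall>x. (1 + norm x) ^ N * norm (g x) \<le> C" for g :: "real^'n \<Rightarrow> complex"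
    using herz_norm_translates_bounded[OF that u t] by blast
  note translates = this
  have "\<exists>D. \<forall>a. herz_norm u 0 t (\<lambda>x. inv_fourier (h i) (x - a)) \<le> ennreal D" for i
    by (intro translates schwartz_inv_fourier_decay hs)
  then obtain D where D: "\<And>i a. herz_norm u 0 t (\<lambda>x. inv_fourier (h i) (x - a)) \<le> ennreal (D i)" by metis
  obtain D0 where "\<And>a::real^'n. herz_norm u 0 t (\<lambda>x. (\<lambda>_::real^'n. 0) (x - a)) \<le> ennreal D0"
    using translates[of "\<lambda>_. 0"] by auto
  then have D0: "herz_norm u 0 t (\<lambda>_::real^'n. 0) \<le> ennreal D0" by simp
  \<comment> \<open>The sum of all ten constants is a bound in every case.\<close>
  let ?E = "ennreal D0 + (\<Sum>i\<in>{-4..4}. ennreal (D i))"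
  have "herz_norm u 0 t (inv_fourier (\<lambda>\<xi>. shift_multiplier \<eta> v ((2 powi j) *\<^sub>R \<xi>) * complex_of_real (\<eta> \<xi>))) \<le> ?E" for j
  proof (rule dilated_shift_multiplier_cases[OF \<eta>, of v j])
    assume "\<And>\<xi>. shift_multiplier \<eta> v ((2 powi j) *\<^sub>R \<xi>) * complex_of_real (\<eta> \<xi>) = 0"
    then have "inv_fourier (\<lambda>\<xi>. shift_multiplier \<eta> v ((2 powi j) *\<^sub>R \<xi>) * complex_of_real (\<eta> \<xi>)) = inv_fourier (\<lambda>_. 0)"
      by (simp only:)
    also have "\<dots> = (\<lambda>_. 0)" by (simp add: inv_fourier_def fun_eq_iff)
    finally have "inv_fourier (\<lambda>\<xi>. shift_multiplier \<eta> v ((2 powi j) *\<^sub>R \<xi>) * complex_of_real (\<eta> \<xi>)) = (\<lambda>_. 0)" .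
    then show ?thesis using D0 by (simp add: add_increasing2)
  next
    fix i a
    assume shift: "i \<in> {-4..4}" "\<And>\<xi>. shift_multiplier \<eta> v ((2 powi j) *\<^sub>R \<xi>) * complex_of_real (\<eta> \<xi>) =
      (complex_of_real (\<eta> ((2 powi i) *\<^sub>R \<xi>)) * complex_of_real (\<eta> \<xi>)) * wave (- a) \<xi>"
    have "inv_fourier (\<lambda>\<xi>. shift_multiplier \<eta> v ((2 powi j) *\<^sub>R \<xi>) * complex_of_real (\<eta> \<xi>)) =
        (\<lambda>x. inv_fourier (h i) (x - a))"
      unfolding shift(2) h_def[symmetric] using inv_fourier_wave_mult[of "h i" a] by (rule ext)
    then have "herz_norm u 0 t (inv_fourier (\<lambda>\<xi>. shift_multiplier \<eta> v ((2 powi j) *\<^sub>R \<xi>) * complex_of_real (\<eta> \<xi>)))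
        \<le> ennreal (D i)" using D by simp
    also have "\<dots> \<le> (\<Sum>i\<in>{-4..4}. ennreal (D i))" using shift(1) by (intro member_le_sum) auto
    finally show ?thesis by (simp add: add_increasing)
  qed
  then have "herz_multiplier_norm \<eta> u 0 t (shift_multiplier \<eta> v) \<le> ?E"
    unfolding herz_multiplier_norm_def by (rule SUP_least)
  also have "\<dots> < \<infinity>"
  proof -
    have "(\<Sum>i\<in>A. ennreal (D i)) < top" if "finite A" for A
      using that by induction auto
    then show ?thesis by simp
  qed
  finally show ?thesis .
qed

context wave_packets
begin

text \<open>On the frequency support of the packet the rescaled variable has norm between 1/2 and 2,
  where \<open>\<eta>\<close> is 1, so the multiplier is exactly
  \<open>wave (- (real k *\<^sub>R v))\<close> there. The leftover phase is due to the wave of the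
  packet, which does not move with its envelope.\<close>

lemma shift_multiplier_packet:
  assumes \<eta>: "herz_cutoff \<eta>"
  shows "shift_multiplier \<eta> v \<xi> * fourier (packet k c) \<xi> =
    wave (freq k) (- (real k *\<^sub>R v)) * fourier (packet k (c + real k *\<^sub>R v)) \<xi>"
proof (cases "fourier (packet k c) \<xi> = 0")
  case True
  from True have "fourier \<phi> (\<xi> - freq k) = 0" by (simp add: fourier_packet)
  then show ?thesis by (simp add: fourier_packet)
next
  case False
  let ?A = "2 ^ (10 * (k + 1)) :: real"
  note supp = fourier_packet_support[OF False] power_freq_ge[of k]
  note sc = norm_rescale[of "10 * (k + 1)" \<xi>]
  have "1/2 \<le> norm \<xi> / ?A" "norm \<xi> / ?A \<le> 2" using supp by (simp_all add: field_simps)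
  then have "\<eta> ((2 powi (- int (10 * (k + 1)))) *\<^sub>R \<xi>) = 1"
    using \<eta> unfolding sc[symmetric] herz_cutoff_def by blast
  then have at_k: "shift_term \<eta> v k \<xi> = wave (- (real k *\<^sub>R v)) \<xi>" by (simp add: shift_term_def)
  then have "shift_term \<eta> v k \<xi> \<noteq> 0" by simp
  then have "shift_term \<eta> v l \<xi> = 0" if "l \<noteq> k" for l
    using shift_term_unique[OF \<eta>] that by metis
  then have m: "shift_multiplier \<eta> v \<xi> = wave (- (real k *\<^sub>R v)) \<xi>"
    using shift_multiplier_eq at_k by metis
  let ?b = "real k *\<^sub>R v"
  have "wave (\<xi> - freq k) (- (c + ?b)) = wave (\<xi> - freq k) (- c) * wave (\<xi> + - freq k) (- ?b)"
    unfolding minus_add_distrib wave_add by simp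
  also have "\<dots> = wave (\<xi> - freq k) (- c) * (wave \<xi> (- ?b) * wave (- freq k) (- ?b))"
    unfolding wave_add_freq ..
  finally have eq: "wave (\<xi> - freq k) (- (c + ?b)) =
      wave (\<xi> - freq k) (- c) * (wave \<xi> (- ?b) * wave (- freq k) (- ?b))" .
  have one: "wave (freq k) (- ?b) * wave (- freq k) (- ?b) = 1"
    by (simp add: cis_mult)
  have flip: "wave (- ?b) \<xi> = wave \<xi> (- ?b)" by (simp add: inner_commute)
  have "wave (freq k) (- ?b) * fourier (packet k (c + ?b)) \<xi> =
      (wave (freq k) (- ?b) * wave (- freq k) (- ?b)) *
      (wave \<xi> (- ?b) * (wave (\<xi> - freq k) (- c) * fourier \<phi> (\<xi> - freq k)))"
    unfolding fourier_packet eq by (simp only: ac_simps)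
  then show ?thesis
    unfolding one m flip fourier_packet[of k c] by simp
qed

lemma multiplier_op_packet_sum:
  assumes \<eta>: "herz_cutoff \<eta>"
  shows "multiplier_op (shift_multiplier \<eta> v) (packet_sum \<omega> c N) =
    packet_sum (\<lambda>k. \<omega> k * wave (freq k) (- (real k *\<^sub>R v))) (\<lambda>k. c k + real k *\<^sub>R v) N"
    (is "_ = packet_sum ?\<omega> ?c N")
proof
  fix x
  have "shift_multiplier \<eta> v \<xi> * fourier (packet_sum \<omega> c N) \<xi> = fourier (packet_sum ?\<omega> ?c N) \<xi>" for \<xi>
  proof -
    have "shift_multiplier \<eta> v \<xi> * fourier (packet_sum \<omega> c N) \<xi> =
        (\<Sum>k<N. \<omega> k * (shift_multiplier \<eta> v \<xi> * fourier (packet k (c k)) \<xi>))"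
      unfolding fourier_packet_sum by (simp only: sum_distrib_left mult.left_commute)
    then show ?thesis
      unfolding fourier_packet_sum shift_multiplier_packet[OF assms] by (simp only: mult.assoc)
  qed
  then have "multiplier_op (shift_multiplier \<eta> v) (packet_sum \<omega> c N) x =
      inv_fourier (fourier (packet_sum ?\<omega> ?c N)) x"
    unfolding multiplier_op_def by presburger
  then show "multiplier_op (shift_multiplier \<eta> v) (packet_sum \<omega> c N) x = packet_sum ?\<omega> ?c N x"
    by (simp add: fourier_inversion schwartz_packet_sum)
qed

end

section \<open>Quasi-norms of aligned and separated packet sums\<close>

text \<open>\<open>N\<^bsup>1/q\<^esup>\<close> with the convention \<open>1/\<infinity> = 0\<close>.\<close>

definition npow :: "nat \<Rightarrow> ennreal \<Rightarrow> real" where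
  "npow N q = (if q = \<infinity> then 1 else real N powr (1 / enn2real q))"

lemma npow_nonneg: "0 \<le> npow N q"
  by (simp add: npow_def)

lemma enn2real_pos: "0 < q \<Longrightarrow> q \<noteq> \<infinity> \<Longrightarrow> 0 < enn2real q"
  by (simp add: enn2real_positive_iff less_top)

text \<open>The quotient of the two sides grows like \<open>N powr d\<close> with
  \<open>d = 1 / enn2real p - e > 0\<close>, where \<open>e\<close> is 1/q, read as 0 at infinity;
  an \<open>N\<close> of size \<open>(\<bar>B\<bar> + 1) powr (1 / d)\<close> suffices.\<close>

lemma npow_growth:
  assumes "0 < p" "p < q"
  obtains N where "0 < N" "B * npow N q < npow N p"
proof -
  have p: "p \<noteq> \<infinity>" using assms(2) by auto
  define e where "e = (if q = \<infinity> then 0 else 1 / enn2real q)"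
  have "e < 1 / enn2real p"
  proof (cases "q = \<infinity>")
    case True
    then show ?thesis using enn2real_pos[OF assms(1) p] by (simp add: e_def)
  next
    case False
    have "enn2real p < enn2real q"
      using assms(2) p False by (metis enn2real_mono ennreal_enn2real_if infinity_ennreal_def less_top not_le order_le_less)
    then show ?thesis using enn2real_pos[OF assms(1) p] False by (simp add: e_def frac_less2)
  qed
  then have d: "0 < 1 / enn2real p - e" by simp
  define d where "d = 1 / enn2real p - e"
  obtain N :: nat where N_ge: "(\<bar>B\<bar> + 1) powr (1 / d) \<le> real N" using real_arch_simple by blast
  have "0 < (\<bar>B\<bar> + 1) powr (1 / d)" by simp
  then have N0: "0 < N" using N_ge by linarith
  have "((\<bar>B\<bar> + 1) powr (1 / d)) powr d \<le> real N powr d"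
    using N_ge d by (intro powr_mono2) (auto simp: d_def)
  then have "\<bar>B\<bar> + 1 \<le> real N powr d" using d by (simp add: powr_powr d_def)
  then have N: "B < real N powr (1 / enn2real p - e)" "0 < N" using N0 by (simp_all add: d_def)
  have "npow N q = real N powr e" using N by (simp add: npow_def e_def)
  moreover have "npow N p = real N powr (1 / enn2real p - e) * real N powr e"
    using p by (simp add: npow_def flip: powr_add)
  ultimately have "B * npow N q < npow N p" using N by simp
  then show thesis using that N by blast
qed

section \<open>Bump, unit cube and summation tools for the norm estimates\<close>

lemma TL_norm_distribution_finite:
  assumes "p \<noteq> \<infinity>"
  shows "TL_norm_distribution \<phi> p q \<Lambda> =
    ennpowr (\<integral>\<^sup>+x. ennpowr (lp_norm q (\<lambda>k::int. ennreal (norm (LP_piece \<phi> k \<Lambda> x)))) (enn2real p) \<partial>lborel)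
      (1 / enn2real p)"
proof -
  have "p < \<infinity>" using assms by (simp add: less_top)
  then show ?thesis using assms by (simp add: TL_norm_distribution_def Lp_norm_def)
qed

text \<open>If \<open>\<phi>\<close> were zero, its dilates could not sum to 1; continuity then
  gives a ball. The bound \<open>\<rho> < 1/2\<close> makes balls around unit-spaced centres
  disjoint and lets one fit into the unit cube; the 3 matches
  \<open>packet_le_three_max\<close>.\<close>

lemma littlewood_paley_bump:
  fixes \<phi> :: "real^'n::finite \<Rightarrow> complex"
  assumes \<phi>: "littlewood_paley \<phi>"
  obtains x0 \<rho> \<delta> where "0 < \<rho>" "\<rho> < 1/2" "0 < \<delta>" "\<And>x. x \<in> ball x0 \<rho> \<Longrightarrow> \<delta> \<le> norm (\<phi> x) / 3"
proof -
  have \<phi>s: "\<phi> \<in> schwartz" using \<phi> by (simp add: littlewood_paley_def)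
  have "\<exists>x. \<phi> x \<noteq> 0"
  proof (rule ccontr)
    assume "\<not> (\<exists>x. \<phi> x \<noteq> 0)"
    then have "fourier (dyadic_dilate \<phi> k) \<xi> = 0" for k \<xi>
      by (simp add: fourier_def dyadic_dilate_def)
    moreover have "((\<lambda>k. fourier (dyadic_dilate \<phi> k) (axis undefined 1)) has_sum 1) UNIV"
      using \<phi> by (simp add: littlewood_paley_def axis_eq_0_iff)
    ultimately have "((\<lambda>k::int. 0) has_sum (1::complex)) UNIV" by simp
    moreover have "((\<lambda>k::int. 0) has_sum (0::complex)) UNIV" by simp
    ultimately have "(1::complex) = 0" by (rule has_sum_unique)
    then show False by simp
  qed
  then obtain x0 where x0: "\<phi> x0 \<noteq> 0" by blast
  have "continuous (at x0) (\<lambda>x. norm (\<phi> x))"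
    using schwartz_differentiable[OF \<phi>s, of x0] by (intro continuous_norm differentiable_imp_continuous_within)
  then have "((\<lambda>x. norm (\<phi> x)) \<longlongrightarrow> norm (\<phi> x0)) (nhds x0)"
    unfolding continuous_at by (rule tendsto_at_iff_tendsto_nhds[of "\<lambda>x. norm (\<phi> x)", THEN iffD1])
  from order_tendstoD(1)[OF this, of "norm (\<phi> x0) / 2"]
  have "\<forall>\<^sub>F x in nhds x0. norm (\<phi> x0) / 2 < norm (\<phi> x)" using x0 by simp
  then obtain d where d: "d > 0" "\<And>x. dist x x0 < d \<Longrightarrow> norm (\<phi> x0) / 2 < norm (\<phi> x)"
    unfolding eventually_nhds_metric by blast
  show thesis
  proof (rule that[of "min d (1/4)" "norm (\<phi> x0) / 6" x0])
    show "norm (\<phi> x0) / 6 \<le> norm (\<phi> x) / 3" if "x \<in> ball x0 (min d (1/4))" for x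
      using d(2)[of x] that by (simp add: dist_commute)
  qed (use d x0 in auto)
qed

lemma emeasure_unit_cube: "emeasure lborel (dyadic_cube 0 (\<lambda>_. 0) :: (real^'n::finite) set) = 1"
proof -
  have One: "(One :: real^'n) $ i = 1" for i
    by (simp only: cart_eq_inner_axis) (simp add: inner_sum_left_Basis axis_in_Basis_iff)
  have sub: "box 0 One \<subseteq> (dyadic_cube 0 (\<lambda>_. 0) :: (real^'n) set)" "dyadic_cube 0 (\<lambda>_. 0) \<subseteq> cbox 0 (One :: real^'n)"
    using One by (auto simp: dyadic_cube_def mem_box_cart less_imp_le)
  have "{x::real^'n. \<forall>i. 0 \<le> x $ i \<and> x $ i < 1} \<in> sets borel" by measurable
  then have "(dyadic_cube 0 (\<lambda>_. 0) :: (real^'n) set) \<in> sets borel" by (simp add: dyadic_cube_def)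
  then have "emeasure lborel (box 0 (One::real^'n)) \<le> emeasure lborel (dyadic_cube 0 (\<lambda>_. 0) :: (real^'n) set)"
    by (intro emeasure_mono[OF sub(1)]) simp
  moreover have "emeasure lborel (dyadic_cube 0 (\<lambda>_. 0) :: (real^'n) set) \<le> emeasure lborel (cbox 0 (One::real^'n))"
    by (intro emeasure_mono[OF sub(2)]) simp
  ultimately show ?thesis by (simp add: emeasure_lborel_box_eq emeasure_lborel_cbox_eq)
qed

text \<open>Split at the floor of \<open>s\<close>. On either side the distances from
  \<open>s\<close> dominate distinct natural numbers, so each half is at most the full series of
  inverse squares.\<close>

lemma uniform_inverse_squares:
  obtains A :: real where "A > 0" "\<And>N s. (\<Sum>k<N. 1 / (1 + \<bar>s - real k\<bar>) ^ 2) \<le> A"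
proof -
  define g :: "nat \<Rightarrow> real" where "g i = 1 / (real i + 1)\<^sup>2" for i
  have summ: "summable g"
    using summable_ignore_initial_segment[OF inverse_power_summable[of 2, where 'a=real], of 1]
    by (simp add: g_def[abs_def] inverse_eq_divide add.commute)
  have g: "0 \<le> g i" for i by (simp add: g_def)
  have le: "(\<Sum>k<N. 1 / (1 + \<bar>s - real k\<bar>) ^ 2) \<le> 2 * suminf g" for N s
  proof -
    let ?lo = "{k. k < N \<and> int k \<le> \<lfloor>s\<rfloor>}" and ?hi = "{k. k < N \<and> \<not> int k \<le> \<lfloor>s\<rfloor>}"
    have term_le: "1 / (1 + \<bar>s - real k\<bar>) ^ 2 \<le> g i" if "real i \<le> \<bar>s - real k\<bar>" for i k
      unfolding g_def using that by (intro divide_left_mono power_mono) (auto intro!: mult_pos_pos)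
    have part: "(\<Sum>k\<in>K. 1 / (1 + \<bar>s - real k\<bar>) ^ 2) \<le> suminf g"
      if "finite K" "inj_on h K" "\<And>k. k \<in> K \<Longrightarrow> real (h k) \<le> \<bar>s - real k\<bar>" for K :: "nat set" and h :: "nat \<Rightarrow> nat"
    proof -
      have "(\<Sum>k\<in>K. 1 / (1 + \<bar>s - real k\<bar>) ^ 2) \<le> (\<Sum>k\<in>K. g (h k))"
        by (intro sum_mono term_le that)
      also have "\<dots> = sum g (h ` K)" by (simp add: sum.reindex[OF that(2)])
      also have "\<dots> \<le> suminf g" using that(1) g by (intro sum_le_suminf summ) auto
      finally show ?thesis .
    qed
    have "(\<Sum>k\<in>?lo. 1 / (1 + \<bar>s - real k\<bar>) ^ 2) \<le> suminf g"
      by (rule part[where h="\<lambda>k. nat (\<lfloor>s\<rfloor> - int k)"]) (auto simp: inj_on_def; linarith)+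
    \<comment> \<open>Above the floor, the distance to \<open>s\<close> is only guaranteed to exceed
      the distance to the floor minus 1.\<close>
    moreover have "(\<Sum>k\<in>?hi. 1 / (1 + \<bar>s - real k\<bar>) ^ 2) \<le> suminf g"
      by (rule part[where h="\<lambda>k. nat (int k - \<lfloor>s\<rfloor> - 1)"]) (auto simp: inj_on_def; linarith)+
    moreover have "(\<Sum>k<N. 1 / (1 + \<bar>s - real k\<bar>) ^ 2) =
        (\<Sum>k\<in>?lo. 1 / (1 + \<bar>s - real k\<bar>) ^ 2) + (\<Sum>k\<in>?hi. 1 / (1 + \<bar>s - real k\<bar>) ^ 2)"
      by (subst sum.union_disjoint[symmetric]) (auto intro!: sum.cong)
    ultimately show ?thesis by simp
  qed
  have "0 \<le> suminf g" by (intro suminf_nonneg summ g)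
  then show thesis by (intro that[of "2 * suminf g + 1"] order_trans[OF le]) auto
qed

text \<open>Projection onto the unit vector \<open>v\<close> bounds the distances to the centres
  below by the one-dimensional distances \<open>\<bar>s - real k\<bar>\<close>.\<close>

lemma separated_weights_le:
  fixes v c0 :: "real^'n::finite"
  assumes v: "norm v = 1" and a: "2 \<le> a"
    and A: "\<And>N s. (\<Sum>k<N. 1 / (1 + \<bar>s - real k\<bar>) ^ 2) \<le> A"
  shows "(\<Sum>k<N. (1 + norm (x - (c0 - real k *\<^sub>R v))) powr (- a)) \<le> A"
proof -
  define s where "s = - ((x - c0) \<bullet> v)"
  have "(1 + norm (x - (c0 - real k *\<^sub>R v))) powr (- a) \<le> 1 / (1 + \<bar>s - real k\<bar>) ^ 2" for k
  proof -
    let ?W = "1 + norm (x - (c0 - real k *\<^sub>R v))"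
    have "(x - (c0 - real k *\<^sub>R v)) \<bullet> v = real k - s"
      using v by (simp add: s_def inner_diff_left inner_add_left dot_square_norm)
    then have le: "\<bar>s - real k\<bar> \<le> norm (x - (c0 - real k *\<^sub>R v))"
      using Cauchy_Schwarz_ineq2[of "x - (c0 - real k *\<^sub>R v)" v] v by (simp add: abs_minus_commute)
    have W: "0 < ?W" "1 \<le> ?W" by (simp_all add: add_pos_nonneg)
    have "?W powr (- a) \<le> ?W powr (- real 2)" using a W by (intro powr_mono) auto
    also have "\<dots> = 1 / ?W ^ 2" by (rule powr_minus_nat[OF W(1)])
    also have "\<dots> \<le> 1 / (1 + \<bar>s - real k\<bar>) ^ 2"
      using le by (intro divide_left_mono power_mono) (auto intro!: mult_pos_pos add_pos_nonneg)
    finally show ?thesis .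
  qed
  then have "(\<Sum>k<N. (1 + norm (x - (c0 - real k *\<^sub>R v))) powr (- a)) \<le> (\<Sum>k<N. 1 / (1 + \<bar>s - real k\<bar>) ^ 2)"
    by (rule sum_mono)
  with A[of s N] show ?thesis by (rule order_trans[rotated])
qed

text \<open>One inequality for all \<open>\<sigma> > 0\<close>, where subadditivity of the power
  would only cover \<open>\<sigma> \<le> 1\<close>. Each \<open>a k\<close> is at most
  \<open>(\<Sum>k<N. a k powr \<sigma>) powr (1 / \<sigma>)\<close>; this bounds one factor of the
  square, and \<open>A\<close> bounds the sum of the other.\<close>

lemma powr_sum_squares_le:
  fixes a :: "nat \<Rightarrow> real"
  assumes a: "\<And>k. 0 \<le> a k" and A: "(\<Sum>k<N. a k) \<le> A" and \<sigma>: "0 < \<sigma>"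
  shows "(\<Sum>k<N. (a k)\<^sup>2) powr \<sigma> \<le> A powr \<sigma> * (\<Sum>k<N. a k powr \<sigma>)"
proof -
  define S where "S = (\<Sum>k<N. a k powr \<sigma>)"
  have S: "0 \<le> S" by (simp add: S_def sum_nonneg)
  have A0: "0 \<le> A" using A a by (meson order_trans sum_nonneg)
  have "a k \<le> S powr (1 / \<sigma>)" if "k < N" for k
  proof -
    have "a k = (a k powr \<sigma>) powr (1 / \<sigma>)" using a \<sigma> by (simp add: powr_powr)
    also have "\<dots> \<le> S powr (1 / \<sigma>)"
      unfolding S_def using that \<sigma> by (intro powr_mono2 member_le_sum) auto
    finally show ?thesis .
  qed
  then have "(\<Sum>k<N. (a k)\<^sup>2) \<le> (\<Sum>k<N. S powr (1 / \<sigma>) * a k)"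
    using a by (intro sum_mono) (auto simp: power2_eq_square intro: mult_right_mono)
  also have "\<dots> = S powr (1 / \<sigma>) * (\<Sum>k<N. a k)" by (rule sum_distrib_left[symmetric])
  also have "\<dots> \<le> S powr (1 / \<sigma>) * A" using A by (intro mult_left_mono) auto
  finally have "(\<Sum>k<N. (a k)\<^sup>2) powr \<sigma> \<le> (S powr (1 / \<sigma>) * A) powr \<sigma>"
    using \<sigma> by (intro powr_mono2 sum_nonneg) auto
  also have "\<dots> = A powr \<sigma> * S" using S A0 \<sigma> by (simp add: powr_mult powr_powr)
  finally show ?thesis by (simp add: S_def)
qed

lemma ennreal_mult_divide_le: "(a :: ennreal) * e / e \<le> a"
proof (cases "e = 0 \<or> e = top")
  case False
  then show ?thesis by (simp add: ennreal_times_divide[symmetric] ennreal_divide_self less_top)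
qed (auto simp: divide_ennreal_def)

context wave_packets
begin

section \<open>Upper and lower bounds for aligned and separated packets\<close>

abbreviation sum_norm ::
  "ennreal \<Rightarrow> ennreal \<Rightarrow> (nat \<Rightarrow> complex) \<Rightarrow> (nat \<Rightarrow> real^'n) \<Rightarrow> nat \<Rightarrow> ennreal"
  where "sum_norm p q \<omega> c N \<equiv> TL_norm_distribution \<phi> p q (distribution_of (packet_sum \<omega> c N))"

abbreviation pieces_norm ::
  "ennreal \<Rightarrow> (nat \<Rightarrow> complex) \<Rightarrow> (nat \<Rightarrow> real^'n) \<Rightarrow> nat \<Rightarrow> real^'n \<Rightarrow> ennreal"
  where "pieces_norm q \<omega> c N x \<equiv> lp_norm q (\<lambda>j::int. ennreal (norm (sum_piece \<omega> c N j x)))"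

text \<open>The factor 3 counts the scales of one packet; these are nonnegative, as
  \<open>bound\<close> demands.\<close>

lemma lp_norm_LP_pieces_le:
  fixes c :: "nat \<Rightarrow> real^'n"
  assumes \<omega>: "\<And>k. norm (\<omega> k) = 1" and r: "0 < r"
    and bound: "\<And>k j c x. 0 \<le> j \<Longrightarrow> norm (packet_piece k c j x) \<le> C / (1 + norm (x - c)) ^ M"
    and C: "C > 0"
  shows "(\<Sum>\<^sub>\<infinity>j\<in>J. ennpowr (ennreal (norm (sum_piece \<omega> c N j x))) r)
    \<le> ennreal (\<Sum>k<N. 3 * (C / (1 + norm (x - c k)) ^ M) powr r)"
proof (rule order_trans[OF infsum_LP_pieces(1)[OF \<omega>]], intro ennreal_leI sum_mono)
  fix k
  let ?g = "\<lambda>i. norm (packet_piece k (c k) (scale_index (k, i)) x) powr r"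
  have "?g i \<le> (C / (1 + norm (x - c k)) ^ M) powr r" if "i \<in> {-1,0,1}" for i
    using that r by (intro powr_mono2 bound) (auto simp: scale_index_def)
  then have "(\<Sum>i\<in>{-1,0,1}. ?g i) \<le> (\<Sum>i\<in>{-1,0,1::int}. (C / (1 + norm (x - c k)) ^ M) powr r)"
    by (rule sum_mono)
  then show "(\<Sum>i\<in>{-1,0,1}. ?g i) \<le> 3 * (C / (1 + norm (x - c k)) ^ M) powr r" by simp
qed

text \<open>All packets obey the same bound at \<open>x\<close>, so summing over scales counts them
  and the root gives the power 1/q of \<open>N\<close>. For q infinite the supremum sees one piece
  at a time.\<close>

lemma aligned_lp_norm_le:
  assumes q: "0 < q"
  obtains C where "C > 0" "\<And>\<omega> N x. (\<And>k. norm (\<omega> k) = 1) \<Longrightarrow>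
    pieces_norm q \<omega> (\<lambda>_. 0) N x
    \<le> ennreal (C * npow N q * (1 / (1 + norm x) ^ M))"
proof -
  obtain C where C: "C > 0" and bound: "\<And>k j c x. 0 \<le> j \<Longrightarrow>
    norm (packet_piece k c j x) \<le> C / (1 + norm (x - c)) ^ M"
    by (rule LP_piece_packet_bound[of M]) blast
  show thesis
  proof (cases "q = \<infinity>")
    case True
    have "norm (sum_piece \<omega> (\<lambda>_. 0) N j x) \<le> C * (1 / (1 + norm x) ^ M)"
      if \<omega>: "\<And>k. norm (\<omega> k) = 1" for \<omega> N x j
    proof (cases "j \<in> scale_index ` ({..<N} \<times> {-1,0,1})")
      case True
      then obtain k i where j: "j = scale_index (k, i)" "k < N" "i \<in> {-1,0,1}" by auto
      then have "0 \<le> j" by (auto simp: scale_index_def)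
      from bound[OF this, of k 0 x] show ?thesis
        using LP_piece_packet_sum_at[OF j(2,3)] by (simp add: j(1) norm_mult \<omega>)
    next
      case False
      then show ?thesis using LP_piece_packet_sum_zero[OF False] C by simp
    qed
    then show thesis
      using that[OF C] True by (simp add: lp_norm_def npow_def SUP_least ennreal_leI)
  next
    case False
    define r where "r = enn2real q"
    have r: "0 < r" using enn2real_pos[OF q False] by (simp add: r_def)
    show thesis
    proof (rule that[of "3 powr (1 / r) * C"])
      fix \<omega> :: "nat \<Rightarrow> complex" and N and x :: "real^'n" assume \<omega>: "\<And>k. norm (\<omega> k) = 1"
      let ?W = "(1 + norm x) ^ M"
      have W: "0 < ?W" by (simp add: add_pos_nonneg)
      have "pieces_norm q \<omega> (\<lambda>_. 0) N x
        \<le> ennpowr (ennreal (\<Sum>k<N. 3 * (C / (1 + norm (x - 0)) ^ M) powr r)) (1 / r)"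
        using r lp_norm_LP_pieces_le[OF \<omega> r bound C, where J=UNIV and c="\<lambda>_. 0" and N=N and x=x] False
        unfolding lp_norm_def r_def[symmetric] by (auto intro: ennpowr_mono)
      also have "\<dots> = ennreal ((real N * (3 * (C / ?W) powr r)) powr (1 / r))"
        by (simp add: ennpowr_ennreal)
      also have "(real N * (3 * (C / ?W) powr r)) powr (1 / r) = 3 powr (1 / r) * C * npow N q * (1 / ?W)"
        using r C W False by (simp add: powr_mult powr_powr npow_def r_def[symmetric])
      finally show "pieces_norm q \<omega> (\<lambda>_. 0) N x
        \<le> ennreal (3 powr (1 / r) * C * npow N q * (1 / ?W))" .
    qed (use C in simp)
  qed
qed

lemma aligned_TL_norm_le:
  assumes p: "0 < p" "p \<noteq> \<infinity>" and q: "0 < q"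
  obtains K where "K > 0" "\<And>\<omega> N. (\<And>k. norm (\<omega> k) = 1) \<Longrightarrow>
    sum_norm p q \<omega> (\<lambda>_. 0) N \<le> ennreal (K * npow N q)"
proof -
  define P where "P = enn2real p"
  have P: "0 < P" using enn2real_pos[OF p] by (simp add: P_def)
  \<comment> \<open>\<open>M\<close> is so large that the p-th power of the decay is dominated by
    the integrable weight.\<close>
  obtain M :: nat where M: "real (2 * CARD('n)) / P \<le> real M" using real_arch_simple by blast
  then have MP: "real (2 * CARD('n)) \<le> real M * P" using P by (simp add: field_simps)
  obtain C where C: "C > 0" and le: "\<And>\<omega> N x. (\<And>k. norm (\<omega> k) = 1) \<Longrightarrow>
    pieces_norm q \<omega> (\<lambda>_. 0) N x
    \<le> ennreal (C * npow N q * (1 / (1 + norm x) ^ M))"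
    by (rule aligned_lp_norm_le[OF q, of M]) blast
  obtain I :: real where I: "0 \<le> I" and
    I_eq: "\<And>a::real^'n. (\<integral>\<^sup>+x. ennreal (1 / (1 + norm (x - a)) ^ (2 * CARD('n))) \<partial>lborel) = ennreal I"
    by (rule nn_integral_decay) blast
  show thesis
  proof (rule that[of "C * I powr (1 / P) + 1"])
    fix \<omega> :: "nat \<Rightarrow> complex" and N assume \<omega>: "\<And>k. norm (\<omega> k) = 1"
    let ?F = "\<lambda>x. pieces_norm q \<omega> (\<lambda>_. 0) N x"
    let ?L = "C * npow N q"
    have L: "0 \<le> ?L" using C by (simp add: npow_nonneg)
    have "ennpowr (?F x) P \<le> ennreal (?L powr P) * ennreal (1 / (1 + norm x) ^ (2 * CARD('n)))" for x
    proof -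
      have W: "0 < 1 + norm x" "1 \<le> 1 + norm x" by (simp_all add: add_pos_nonneg)
      have "ennpowr (?F x) P \<le> ennpowr (ennreal (?L * (1 / (1 + norm x) ^ M))) P"
        using P by (intro ennpowr_mono le \<omega>) auto
      also have "\<dots> = ennreal ((?L * (1 / (1 + norm x) ^ M)) powr P)"
        using L by (intro ennpowr_ennreal) simp
      also have "\<dots> \<le> ennreal (?L powr P * (1 / (1 + norm x) ^ (2 * CARD('n))))"
      proof (rule ennreal_leI)
        have "(1 / (1 + norm x) ^ M) powr P = (1 + norm x) powr (- (real M * P))"
          using W(1) by (simp add: powr_minus powr_powr inverse_eq_divide powr_divide flip: powr_realpow)
        also have "\<dots> \<le> (1 + norm x) powr (- real (2 * CARD('n)))"
          using MP W by (intro powr_mono) auto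
        also have "\<dots> = 1 / (1 + norm x) ^ (2 * CARD('n))"
          by (rule powr_minus_nat[OF W(1)])
        finally have "?L powr P * (1 / (1 + norm x) ^ M) powr P \<le> ?L powr P * (1 / (1 + norm x) ^ (2 * CARD('n)))"
          by (rule mult_left_mono) simp
        moreover have "(?L * (1 / (1 + norm x) ^ M)) powr P = ?L powr P * (1 / (1 + norm x) ^ M) powr P"
          by (rule powr_mult)
        ultimately show "(?L * (1 / (1 + norm x) ^ M)) powr P \<le> ?L powr P * (1 / (1 + norm x) ^ (2 * CARD('n)))"
          by simp
      qed
      also have "\<dots> = ennreal (?L powr P) * ennreal (1 / (1 + norm x) ^ (2 * CARD('n)))"
        by (intro ennreal_mult) auto
      finally show ?thesis .
    qed
    then have "(\<integral>\<^sup>+x. ennpowr (?F x) P \<partial>lborel) \<le>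
        (\<integral>\<^sup>+(x::real^'n). ennreal (?L powr P) * ennreal (1 / (1 + norm x) ^ (2 * CARD('n))) \<partial>lborel)"
      by (intro nn_integral_mono)
    also have "\<dots> = ennreal (?L powr P * I)"
      using I by (subst nn_integral_cmult) (auto simp: I_eq[of 0, simplified] ennreal_mult)
    finally have "ennpowr (\<integral>\<^sup>+x. ennpowr (?F x) P \<partial>lborel) (1 / P) \<le> ennpowr (ennreal (?L powr P * I)) (1 / P)"
      using P by (intro ennpowr_mono) auto
    also have "\<dots> = ennreal (?L * I powr (1 / P))"
      using P C L I by (simp add: ennpowr_ennreal powr_mult powr_powr npow_nonneg)
    also have "\<dots> \<le> ennreal ((C * I powr (1 / P) + 1) * npow N q)"
      using npow_nonneg[of N q] by (intro ennreal_leI) (simp add: algebra_simps)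
    finally show "sum_norm p q \<omega> (\<lambda>_. 0) N
        \<le> ennreal ((C * I powr (1 / P) + 1) * npow N q)"
      by (simp only: TL_norm_distribution_finite[OF p(2)] P_def)
  qed (use C in \<open>auto intro!: add_nonneg_pos\<close>)
qed

text \<open>Of each packet only the largest of its three pieces is kept.\<close>

lemma norm_le_lp_norm_LP_pieces:
  assumes \<omega>: "\<And>k. norm (\<omega> k) = 1" and r: "0 < r" and J: "{0..} \<subseteq> J"
  shows "ennreal (\<Sum>k<N. (norm (\<phi> (x - c k)) / 3) powr r) \<le>
    (\<Sum>\<^sub>\<infinity>j\<in>J. ennpowr (ennreal (norm (sum_piece \<omega> c N j x))) r)"
  unfolding infsum_LP_pieces(2)[OF \<omega> J]
proof (intro ennreal_leI sum_mono)
  fix k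
  let ?g = "\<lambda>i. norm (packet_piece k (c k) (scale_index (k, i)) x)"
  obtain i where i: "i \<in> {-1,0,1}" "norm (\<phi> (x - c k)) / 3 \<le> ?g i" by (rule packet_le_three_max)
  have "(norm (\<phi> (x - c k)) / 3) powr r \<le> ?g i powr r" using i r by (intro powr_mono2) auto
  also have "\<dots> \<le> (\<Sum>i\<in>{-1,0,1}. ?g i powr r)" by (rule member_le_sum[OF i(1)]) auto
  finally show "(norm (\<phi> (x - c k)) / 3) powr r \<le> (\<Sum>i\<in>{-1,0,1}. ?g i powr r)" .
qed

text \<open>Different packets occupy different scales, so they cannot cancel and one packet alone
  bounds the norm from below.\<close>

lemma bump_le_lp_norm:
  assumes \<omega>: "\<And>k. norm (\<omega> k) = 1" and q: "0 < q" and k: "k < N"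
  shows "ennreal (norm (\<phi> (x - c k)) / 3) \<le>
    pieces_norm q \<omega> c N x"
proof (cases "q = \<infinity>")
  case True
  obtain i where i: "i \<in> {-1,0,1}" "norm (\<phi> (x - c k)) / 3 \<le>
      norm (packet_piece k (c k) (scale_index (k, i)) x)"
    by (rule packet_le_three_max)
  then have "norm (\<phi> (x - c k)) / 3 \<le> norm (sum_piece \<omega> c N (scale_index (k, i)) x)"
    by (simp add: LP_piece_packet_sum_at[OF k] norm_mult \<omega>)
  then show ?thesis using True
    by (auto simp: lp_norm_def intro!: SUP_upper2[of "scale_index (k, i)"] ennreal_leI)
next
  case False
  define r where "r = enn2real q"
  have r: "0 < r" using enn2real_pos[OF q False] by (simp add: r_def)
  have "ennreal (norm (\<phi> (x - c k)) / 3) = ennpowr (ennreal ((norm (\<phi> (x - c k)) / 3) powr r)) (1 / r)"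
    using r by (simp add: ennpowr_ennreal powr_powr)
  also have "\<dots> \<le> ennpowr (ennreal (\<Sum>k<N. (norm (\<phi> (x - c k)) / 3) powr r)) (1 / r)"
    using r k by (intro ennpowr_mono ennreal_leI member_le_sum) auto
  also have "\<dots> \<le> ennpowr (\<Sum>\<^sub>\<infinity>j. ennpowr (ennreal (norm (sum_piece \<omega> c N j x))) r) (1 / r)"
    using r by (intro ennpowr_mono norm_le_lp_norm_LP_pieces[OF \<omega>]) auto
  finally show ?thesis using False by (simp add: lp_norm_def r_def)
qed

text \<open>There is one ball per packet, all disjoint and of equal volume, and on each ball its own
  packet has a fixed size. The p-th powers add up to a multiple of \<open>N\<close>.\<close>

lemma separated_TL_norm_ge:
  assumes p: "0 < p" "p \<noteq> \<infinity>" and q: "0 < q"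
  obtains \<kappa> where "\<kappa> > 0" "\<And>\<omega> N. (\<And>k. norm (\<omega> k) = 1) \<Longrightarrow>
    ennreal (\<kappa> * npow N p) \<le> sum_norm p q \<omega> (\<lambda>k. real k *\<^sub>R v) N"
proof -
  define P where "P = enn2real p"
  have P: "0 < P" using enn2real_pos[OF p] by (simp add: P_def)
  obtain x0 \<rho> \<delta> where \<rho>: "0 < \<rho>" "\<rho> < 1/2" and \<delta>: "0 < \<delta>"
    and bump: "\<And>x. x \<in> ball x0 \<rho> \<Longrightarrow> \<delta> \<le> norm (\<phi> x) / 3"
    by (rule littlewood_paley_bump[OF \<phi>]) blast
  define V where "V = unit_ball_vol (real CARD('n)) * \<rho> ^ CARD('n)"
  have V: "0 < V" using \<rho> by (simp add: V_def)
  have ball_V: "emeasure lborel (ball y \<rho>) = ennreal V" for y :: "real^'n"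
    using \<rho> by (simp add: V_def emeasure_ball)
  show thesis
  proof (rule that[of "\<delta> * V powr (1 / P)"])
    fix \<omega> :: "nat \<Rightarrow> complex" and N assume \<omega>: "\<And>k. norm (\<omega> k) = 1"
    let ?c = "\<lambda>k::nat. real k *\<^sub>R v"
    let ?F = "\<lambda>x. pieces_norm q \<omega> ?c N x"
    have disj: "k = l" if "x \<in> ball (?c k + x0) \<rho>" "x \<in> ball (?c l + x0) \<rho>" for k l x
    proof -
      have "dist (?c k + x0) (?c l + x0) < 1"
        using that \<rho> dist_triangle2[of "?c k + x0" "?c l + x0" x] by (auto simp: dist_commute)
      moreover have "dist (?c k + x0) (?c l + x0) = \<bar>real k - real l\<bar>"
        by (simp add: dist_norm v flip: scaleR_left_diff_distrib)
      ultimately show "k = l" by linarith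
    qed
    have pt: "(\<Sum>k<N. ennreal (\<delta> powr P) * indicator (ball (?c k + x0) \<rho>) x) \<le> ennpowr (?F x) P" for x
    proof (cases "\<exists>k<N. x \<in> ball (?c k + x0) \<rho>")
      case True
      then obtain k where k: "k < N" "x \<in> ball (?c k + x0) \<rho>" by blast
      have "(\<Sum>l<N. ennreal (\<delta> powr P) * indicator (ball (?c l + x0) \<rho>) x) =
          (\<Sum>l\<in>{k}. ennreal (\<delta> powr P) * indicator (ball (?c l + x0) \<rho>) x)"
        using k disj by (intro sum.mono_neutral_right) (auto simp: indicator_def)
      also have "\<dots> = ennpowr (ennreal \<delta>) P" using k \<delta> by (simp add: ennpowr_ennreal)
      also have "\<dots> \<le> ennpowr (?F x) P"
      proof (rule ennpowr_mono)
        have "x - ?c k \<in> ball x0 \<rho>" using k(2) by (simp add: dist_norm algebra_simps)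
        from ennreal_leI[OF bump[OF this]] bump_le_lp_norm[OF \<omega> q k(1), of x ?c]
        show "ennreal \<delta> \<le> ?F x" by (rule order_trans)
      qed (use P in simp)
      finally show ?thesis .
    next
      case False
      then have zero: "(\<Sum>l<N. ennreal (\<delta> powr P) * indicator (ball (?c l + x0) \<rho>) x) = 0"
        by (intro sum.neutral) (auto simp: indicator_def)
      show ?thesis unfolding zero by simp
    qed
    have "ennreal (real N * (\<delta> powr P * V)) = (\<Sum>k<N. ennreal (\<delta> powr P) * ennreal V)"
      using V by (simp add: ennreal_mult ennreal_of_nat_eq_real_of_nat)
    also have "\<dots> = (\<integral>\<^sup>+x. (\<Sum>k<N. ennreal (\<delta> powr P) * indicator (ball (?c k + x0) \<rho>) x) \<partial>lborel)"
    proof -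
      have int: "(\<integral>\<^sup>+x. ennreal (\<delta> powr P) * indicator (ball (?c k + x0) \<rho>) x \<partial>lborel) = ennreal (\<delta> powr P) * ennreal V" for k
        unfolding ball_V[of "?c k + x0", symmetric] by (rule nn_integral_cmult_indicator) simp
      have "(\<integral>\<^sup>+x. (\<Sum>k<N. ennreal (\<delta> powr P) * indicator (ball (?c k + x0) \<rho>) x) \<partial>lborel) =
          (\<Sum>k<N. \<integral>\<^sup>+x. ennreal (\<delta> powr P) * indicator (ball (?c k + x0) \<rho>) x \<partial>lborel)"
      proof (rule nn_integral_sum)
        fix k
        have "ball (?c k + x0) \<rho> \<in> sets lborel" by simp
        then show "(\<lambda>x. ennreal (\<delta> powr P) * indicator (ball (?c k + x0) \<rho>) x) \<in> borel_measurable lborel"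
          by (rule borel_measurable_times_ennreal[OF borel_measurable_const borel_measurable_indicator])
      qed
      then show ?thesis by (simp only: int)
    qed
    also have "\<dots> \<le> (\<integral>\<^sup>+x. ennpowr (?F x) P \<partial>lborel)" by (intro nn_integral_mono pt)
    finally have "ennpowr (ennreal (real N * (\<delta> powr P * V))) (1 / P) \<le> ennpowr (\<integral>\<^sup>+x. ennpowr (?F x) P \<partial>lborel) (1 / P)"
      using P by (intro ennpowr_mono) auto
    also have "ennpowr (ennreal (real N * (\<delta> powr P * V))) (1 / P) = ennreal (\<delta> * V powr (1 / P) * npow N p)"
      using P V \<delta> p by (simp add: ennpowr_ennreal powr_mult powr_powr npow_def P_def[symmetric] ac_simps)
    finally show "ennreal (\<delta> * V powr (1 / P) * npow N p) \<le>
        sum_norm p q \<omega> ?c N"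
      by (simp only: TL_norm_distribution_finite[OF p(2)] P_def)
  qed (use \<delta> V in simp)
qed

text \<open>On one fixed ball all the bumps are large at once, so the inner norm counts them. The
  centre \<open>c0\<close> is adapted to p infinite, where that ball has to lie in a dyadic
  cube.\<close>

lemma aligned_TL_norm_ge:
  assumes p: "0 < p" and q: "0 < q" "q \<noteq> \<infinity>"
  obtains c0 \<kappa> where "\<kappa> > 0" "\<And>\<omega> N. (\<And>k. norm (\<omega> k) = 1) \<Longrightarrow>
    ennreal (\<kappa> * npow N q) \<le> sum_norm p q \<omega> (\<lambda>_. c0) N"
proof -
  define r where "r = enn2real q"
  have r: "0 < r" using enn2real_pos[OF q] by (simp add: r_def)
  obtain x0 \<rho> \<delta> where \<rho>: "0 < \<rho>" "\<rho> < 1/2" and \<delta>: "0 < \<delta>"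
    and bump: "\<And>x. x \<in> ball x0 \<rho> \<Longrightarrow> \<delta> \<le> norm (\<phi> x) / 3"
    by (rule littlewood_paley_bump[OF \<phi>]) blast
  define V where "V = unit_ball_vol (real CARD('n)) * \<rho> ^ CARD('n)"
  have V: "0 < V" using \<rho> by (simp add: V_def)
  have ball_V: "emeasure lborel (ball y \<rho>) = ennreal V" for y :: "real^'n"
    using \<rho> by (simp add: V_def emeasure_ball)
  \<comment> \<open>The centre of the unit cube: a ball of radius below 1/2 fits there, and the
    average over this cube sums the scales from 0 on, hence all active ones.\<close>
  define z :: "real^'n" where "z = (\<chi> i. 1/2)"
  let ?c0 = "z - x0"
  have pt: "ennreal (real N * \<delta> powr r) \<le>
      (\<Sum>\<^sub>\<infinity>j\<in>J. ennpowr (ennreal (norm (sum_piece \<omega> (\<lambda>_. ?c0) N j x))) r)"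
    if \<omega>: "\<And>k. norm (\<omega> k) = 1" and J: "{0..} \<subseteq> J" and x: "x \<in> ball z \<rho>" for \<omega> N x J
  proof -
    have "x - ?c0 \<in> ball x0 \<rho>" using x by (simp add: dist_norm algebra_simps)
    then have "\<delta> powr r \<le> (norm (\<phi> (x - ?c0)) / 3) powr r"
      using r \<delta> by (intro powr_mono2 bump) auto
    then have "real N * \<delta> powr r \<le> (\<Sum>k<N. (norm (\<phi> (x - ?c0)) / 3) powr r)"
      by (simp add: mult_left_mono)
    then show ?thesis
      using norm_le_lp_norm_LP_pieces[where N=N and x=x and c="\<lambda>_. ?c0" and \<omega>=\<omega>, OF \<omega> r J] by (auto intro: order_trans ennreal_leI)
  qed
  show thesis
  proof (cases "p = \<infinity>")
    case True
    show thesis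
    proof (rule that[of "\<delta> * V powr (1 / r)" ?c0])
      fix \<omega> :: "nat \<Rightarrow> complex" and N assume \<omega>: "\<And>k. norm (\<omega> k) = 1"
      let ?G = "\<lambda>j x. \<Sum>\<^sub>\<infinity>k\<in>{-j..}. ennpowr (ennreal (norm (sum_piece \<omega> (\<lambda>_. ?c0) N k x))) r"
      let ?Q = "dyadic_cube 0 (\<lambda>_. 0) :: (real^'n) set"
      have sub: "x \<in> ?Q" if "x \<in> ball z \<rho>" for x
      proof -
        have "0 \<le> x $ i \<and> x $ i < 1" for i
        proof -
          have "\<bar>(z - x) $ i\<bar> \<le> norm (z - x)" by (rule component_le_norm_cart)
          also have "\<dots> < 1/2" using that \<rho> by (simp add: dist_norm)
          finally have "\<bar>1/2 - x $ i\<bar> < 1/2" by (simp add: z_def)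
          then show ?thesis by linarith
        qed
        then show ?thesis by (simp add: dyadic_cube_def)
      qed
      have "ennreal (real N * \<delta> powr r * V) = (\<integral>\<^sup>+x. ennreal (real N * \<delta> powr r) * indicator (ball z \<rho>) x \<partial>lborel)"
        using V by (subst nn_integral_cmult_indicator) (auto simp: ball_V ennreal_mult)
      also have "\<dots> \<le> (\<integral>\<^sup>+x\<in>?Q. ?G 0 x \<partial>lborel)"
      proof (rule nn_integral_mono)
        fix x
        show "ennreal (real N * \<delta> powr r) * indicator (ball z \<rho>) x \<le> ?G 0 x * indicator ?Q x"
        proof (cases "x \<in> ball z \<rho>")
          case True
          then show ?thesis using pt[OF \<omega> _ True, of "{- 0..}"] sub[OF True] by (simp del: mem_ball)
        qed simp
      qed
      finally have "ennpowr (ennreal (real N * \<delta> powr r * V)) (1 / r) \<le>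
          ennpowr ((\<integral>\<^sup>+x\<in>?Q. ?G 0 x \<partial>lborel) / emeasure lborel ?Q) (1 / r)"
        using r by (intro ennpowr_mono) (auto simp: emeasure_unit_cube divide_ennreal_def)
      also have "\<dots> \<le> (SUP (j, n)\<in>UNIV. ennpowr ((\<integral>\<^sup>+x\<in>dyadic_cube j n. ?G j x \<partial>lborel)
            / emeasure lborel (dyadic_cube j n :: (real^'n) set)) (1 / r))"
        by (rule SUP_upper2[of "(0, \<lambda>_. 0)"]) auto
      also have "\<dots> = sum_norm p q \<omega> (\<lambda>_. ?c0) N"
        using True q by (simp add: TL_norm_distribution_def r_def)
      also have "ennpowr (ennreal (real N * \<delta> powr r * V)) (1 / r) = ennreal (\<delta> * V powr (1 / r) * npow N q)"
        using r V \<delta> q by (simp add: ennpowr_ennreal powr_mult powr_powr npow_def r_def[symmetric] ac_simps)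
      finally show "ennreal (\<delta> * V powr (1 / r) * npow N q) \<le>
          sum_norm p q \<omega> (\<lambda>_. ?c0) N" .
    qed (use \<delta> V in simp)
  next
    case False
    define P where "P = enn2real p"
    have P: "0 < P" using enn2real_pos[OF p False] by (simp add: P_def)
    show thesis
    proof (rule that[of "\<delta> * V powr (1 / P)" ?c0])
      fix \<omega> :: "nat \<Rightarrow> complex" and N assume \<omega>: "\<And>k. norm (\<omega> k) = 1"
      let ?F = "\<lambda>x. pieces_norm q \<omega> (\<lambda>_. ?c0) N x"
      let ?L = "npow N q * \<delta>"
      have L: "0 \<le> ?L" using \<delta> by (simp add: npow_nonneg)
      have F: "ennreal ?L \<le> ?F x" if "x \<in> ball z \<rho>" for x
      proof -
        have "ennreal ?L = ennpowr (ennreal (real N * \<delta> powr r)) (1 / r)"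
          using r \<delta> q by (simp add: ennpowr_ennreal powr_mult powr_powr npow_def r_def[symmetric])
        also have "\<dots> \<le> ennpowr (\<Sum>\<^sub>\<infinity>j. ennpowr (ennreal (norm (sum_piece \<omega> (\<lambda>_. ?c0) N j x))) r) (1 / r)"
          using r by (intro ennpowr_mono pt \<omega> that) auto
        finally show ?thesis using q by (simp add: lp_norm_def r_def)
      qed
      have "ennreal (?L powr P * V) = (\<integral>\<^sup>+x. ennreal (?L powr P) * indicator (ball z \<rho>) x \<partial>lborel)"
        using V by (subst nn_integral_cmult_indicator) (auto simp: ball_V ennreal_mult)
      also have "\<dots> \<le> (\<integral>\<^sup>+x. ennpowr (?F x) P \<partial>lborel)"
      proof (rule nn_integral_mono)
        fix x
        show "ennreal (?L powr P) * indicator (ball z \<rho>) x \<le> ennpowr (?F x) P"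
          using ennpowr_mono[OF F, of x P] P L by (simp add: ennpowr_ennreal indicator_def del: mem_ball)
      qed
      finally have "ennpowr (ennreal (?L powr P * V)) (1 / P) \<le> ennpowr (\<integral>\<^sup>+x. ennpowr (?F x) P \<partial>lborel) (1 / P)"
        using P by (intro ennpowr_mono) auto
      also have "ennpowr (ennreal (?L powr P * V)) (1 / P) = ennreal (\<delta> * V powr (1 / P) * npow N q)"
        using P V L \<delta> by (simp add: ennpowr_ennreal powr_mult powr_powr npow_nonneg ac_simps)
      finally show "ennreal (\<delta> * V powr (1 / P) * npow N q) \<le>
          sum_norm p q \<omega> (\<lambda>_. ?c0) N"
        by (simp only: TL_norm_distribution_finite[OF False] P_def)
    qed (use \<delta> V in simp)
  qed
qed

text \<open>The tails of all packets are felt at every \<open>x\<close>. Half of the decay,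
  \<open>a\<close>, makes the sum over \<open>k\<close> bounded, and its square is the full decay.
  For finite p, \<open>powr_sum_squares_le\<close> turns the outer power into a sum over
  \<open>k\<close> that is integrated term by term; for p infinite the pointwise bound
  suffices.\<close>

lemma separated_TL_norm_le:
  assumes p: "0 < p" and q: "0 < q" "q \<noteq> \<infinity>"
  obtains K where "K > 0" "\<And>\<omega> N. (\<And>k. norm (\<omega> k) = 1) \<Longrightarrow>
    sum_norm p q \<omega> (\<lambda>k. c0 - real k *\<^sub>R v) N \<le> ennreal (K * npow N p)"
proof -
  define r where "r = enn2real q"
  have r: "0 < r" using enn2real_pos[OF q] by (simp add: r_def)
  define P where "P = enn2real p"
  have P: "p \<noteq> \<infinity> \<Longrightarrow> 0 < P" using enn2real_pos[OF p] by (simp add: P_def)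
  obtain A where A: "A > 0" "\<And>N s. (\<Sum>k<N. 1 / (1 + \<bar>s - real k\<bar>) ^ 2) \<le> A"
    by (rule uniform_inverse_squares) blast
  \<comment> \<open>The first summand makes the decay exponent of \<open>a\<close> at least 2, the
    second makes the relevant power of \<open>a\<close> integrable. For p infinite \<open>P\<close>
    is 0, and the second summand is 0 by the convention for division by zero.\<close>
  obtain M :: nat where M: "4 / r + 4 * real CARD('n) / P \<le> real M" using real_arch_simple by blast
  have "4 * real CARD('n) / P \<ge> 0" "4 / r \<ge> 0" using r by (simp_all add: P_def)
  with M have "4 / r \<le> real M" and M2: "4 * real CARD('n) / P \<le> real M" by linarith+
  then have Mr: "2 \<le> real M * r / 2" using r by (simp add: field_simps)
  obtain C where C: "C > 0" and bound: "\<And>k j c x. 0 \<le> j \<Longrightarrow>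
    norm (packet_piece k c j x) \<le> C / (1 + norm (x - c)) ^ M"
    by (rule LP_piece_packet_bound[of M]) blast
  let ?c = "\<lambda>k::nat. c0 - real k *\<^sub>R v"
  \<comment> \<open>The square root of the r-th power of the packet bound, without its
    constant.\<close>
  define a where "a x k = (1 + norm (x - ?c k)) powr (- (real M * r / 2))" for x k
  have a0: "0 \<le> a x k" for x k by (simp add: a_def)
  have a1: "a x k \<le> 1" for x k
  proof -
    have "a x k \<le> (1 + norm (x - ?c k)) powr 0" unfolding a_def using Mr by (intro powr_mono) auto
    then show ?thesis by (simp add: add_nonneg_eq_0_iff split: if_splits)
  qed
  have aA: "(\<Sum>k<N. a x k) \<le> A" for x N
    unfolding a_def by (rule separated_weights_le[OF v Mr A(2)])
  have sq: "(C / (1 + norm (x - ?c k)) ^ M) powr r = C powr r * (a x k)\<^sup>2" for x k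
  proof -
    have W: "0 < 1 + norm (x - ?c k)" by (simp add: add_pos_nonneg)
    have "C / (1 + norm (x - ?c k)) ^ M = C * (1 + norm (x - ?c k)) powr (- real M)"
      unfolding powr_minus_nat[OF W] by simp
    then have "(C / (1 + norm (x - ?c k)) ^ M) powr r = C powr r * (1 + norm (x - ?c k)) powr (- (real M * r))"
      by (simp add: powr_mult powr_powr)
    also have "(1 + norm (x - ?c k)) powr (- (real M * r)) = (a x k)\<^sup>2"
      unfolding a_def power2_eq_square powr_add[symmetric] by (simp add: mult.commute)
    finally show ?thesis .
  qed
  have pieces: "(\<Sum>\<^sub>\<infinity>j\<in>J. ennpowr (ennreal (norm (sum_piece \<omega> ?c N j x))) r)
    \<le> ennreal (3 * C powr r * (\<Sum>k<N. (a x k)\<^sup>2))" if \<omega>: "\<And>k. norm (\<omega> k) = 1" for \<omega> J N x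
    using lp_norm_LP_pieces_le[where J=J and c="?c" and N=N and x=x, OF \<omega> r bound C]
    unfolding sq by (simp only: sum_distrib_left mult.assoc)
  show thesis
  proof (cases "p = \<infinity>")
    case True
    show thesis
    proof (rule that[of "(3 * C powr r * A) powr (1 / r)"])
      fix \<omega> :: "nat \<Rightarrow> complex" and N assume \<omega>: "\<And>k. norm (\<omega> k) = 1"
      let ?G = "\<lambda>j x. \<Sum>\<^sub>\<infinity>k\<in>{-j..}. ennpowr (ennreal (norm (sum_piece \<omega> ?c N k x))) r"
      \<comment> \<open>The bound holds at every point and for every starting scale, so the averages
        over all cubes inherit it.\<close>
      have G: "?G j x \<le> ennreal (3 * C powr r * A)" for j x
      proof (rule order_trans[OF pieces[OF \<omega>]], intro ennreal_leI mult_left_mono)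
        have "(\<Sum>k<N. (a x k)\<^sup>2) \<le> (\<Sum>k<N. a x k)"
          unfolding power2_eq_square using a0 a1 by (intro sum_mono mult_left_le) auto
        with aA show "(\<Sum>k<N. (a x k)\<^sup>2) \<le> A" by (rule order_trans[rotated])
      qed simp
      have avg: "ennpowr ((\<integral>\<^sup>+x\<in>dyadic_cube j n. ?G j x \<partial>lborel) / emeasure lborel (dyadic_cube j n :: (real^'n) set)) (1 / r)
          \<le> ennreal ((3 * C powr r * A) powr (1 / r))" for j and n :: "'n \<Rightarrow> int"
      proof -
        let ?Q = "dyadic_cube j n :: (real^'n) set"
        have "{x::real^'n. \<forall>i. 2 powi j * of_int (n i) \<le> x $ i \<and> x $ i < 2 powi j * (of_int (n i) + 1)} \<in> sets borel"
          by measurable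
        then have Q: "?Q \<in> sets lborel" by (simp add: dyadic_cube_def)
        have "(\<integral>\<^sup>+x\<in>?Q. ?G j x \<partial>lborel) \<le> (\<integral>\<^sup>+x. ennreal (3 * C powr r * A) * indicator ?Q x \<partial>lborel)"
          by (intro nn_integral_mono mult_right_mono G) simp
        also have "\<dots> = ennreal (3 * C powr r * A) * emeasure lborel ?Q"
          by (rule nn_integral_cmult_indicator[OF Q])
        finally have "(\<integral>\<^sup>+x\<in>?Q. ?G j x \<partial>lborel) / emeasure lborel ?Q \<le> ennreal (3 * C powr r * A)"
          by (rule order_trans[OF divide_right_mono_ennreal ennreal_mult_divide_le])
        from ennpowr_mono[OF this, of "1 / r"] show ?thesis
          using r A by (simp add: ennpowr_ennreal)
      qed
      have "sum_norm p q \<omega> ?c N =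
          (SUP (j, n)\<in>UNIV. ennpowr ((\<integral>\<^sup>+x\<in>dyadic_cube j n. ?G j x \<partial>lborel)
            / emeasure lborel (dyadic_cube j n :: (real^'n) set)) (1 / r))"
        using True q by (simp add: TL_norm_distribution_def r_def)
      also have "\<dots> \<le> ennreal ((3 * C powr r * A) powr (1 / r))"
        by (rule SUP_least) (use avg in auto)
      finally show "sum_norm p q \<omega> ?c N
          \<le> ennreal ((3 * C powr r * A) powr (1 / r) * npow N p)"
        using True by (simp add: npow_def)
    qed (use C A in simp)
  next
    case False
    note P = P[OF False]
    obtain I :: real where I: "0 \<le> I" and
      I_eq: "\<And>a::real^'n. (\<integral>\<^sup>+x. ennreal (1 / (1 + norm (x - a)) ^ (2 * CARD('n))) \<partial>lborel) = ennreal I"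
      by (rule nn_integral_decay) blast
    have MP: "real (2 * CARD('n)) \<le> real M * r / 2 * (P / r)"
      using M2 P r by (simp add: field_simps)
    have decay: "a x k powr (P / r) \<le> 1 / (1 + norm (x - ?c k)) ^ (2 * CARD('n))" for x k
    proof -
      let ?W = "1 + norm (x - ?c k)"
      have W: "0 < ?W" "1 \<le> ?W" by (simp_all add: add_pos_nonneg)
      have "a x k powr (P / r) = ?W powr (- (real M * r / 2 * (P / r)))"
        unfolding a_def powr_powr by simp
      also have "\<dots> \<le> ?W powr (- real (2 * CARD('n)))"
        using MP W by (intro powr_mono) auto
      also have "\<dots> = 1 / ?W ^ (2 * CARD('n))"
        by (rule powr_minus_nat[OF W(1)])
      finally show ?thesis .
    qed
    define B where "B = (3 * C powr r * A) powr (P / r)"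
    have B: "0 \<le> B" by (simp add: B_def)
    show thesis
    proof (rule that[of "(B * I) powr (1 / P) + 1"])
      fix \<omega> :: "nat \<Rightarrow> complex" and N assume \<omega>: "\<And>k. norm (\<omega> k) = 1"
      let ?F = "\<lambda>x. pieces_norm q \<omega> ?c N x"
      have "ennpowr (?F x) P \<le> ennreal B * (\<Sum>k<N. ennreal (1 / (1 + norm (x - ?c k)) ^ (2 * CARD('n))))" for x
      proof -
        let ?S = "\<Sum>k<N. (a x k)\<^sup>2"
        have S: "0 \<le> ?S" by (simp add: sum_nonneg)
        have "?F x \<le> ennpowr (ennreal (3 * C powr r * ?S)) (1 / r)"
          using q r ennpowr_mono[OF pieces[where J=UNIV and N=N and x=x, OF \<omega>], of "1 / r"] by (simp add: lp_norm_def r_def)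
        also have "\<dots> = ennreal ((3 * C powr r * ?S) powr (1 / r))" using S by (intro ennpowr_ennreal) simp
        finally have "ennpowr (?F x) P \<le> ennpowr (ennreal ((3 * C powr r * ?S) powr (1 / r))) P"
          using P by (intro ennpowr_mono) auto
        also have "\<dots> = ennreal ((3 * C powr r * ?S) powr (P / r))"
          by (simp add: ennpowr_ennreal powr_powr)
        also have "\<dots> \<le> ennreal (B * (\<Sum>k<N. 1 / (1 + norm (x - ?c k)) ^ (2 * CARD('n))))"
        proof (rule ennreal_leI)
          have "(3 * C powr r * ?S) powr (P / r) = (3 * C powr r) powr (P / r) * ?S powr (P / r)" by (rule powr_mult)
          also have "\<dots> \<le> (3 * C powr r) powr (P / r) * (A powr (P / r) * (\<Sum>k<N. a x k powr (P / r)))"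
            using P r by (intro mult_left_mono powr_sum_squares_le a0 aA) auto
          also have "\<dots> = B * (\<Sum>k<N. a x k powr (P / r))" unfolding B_def by (simp add: powr_mult)
          also have "\<dots> \<le> B * (\<Sum>k<N. 1 / (1 + norm (x - ?c k)) ^ (2 * CARD('n)))"
            using B by (intro mult_left_mono sum_mono decay)
          finally show "(3 * C powr r * ?S) powr (P / r) \<le> B * (\<Sum>k<N. 1 / (1 + norm (x - ?c k)) ^ (2 * CARD('n)))" .
        qed
        also have "\<dots> = ennreal B * ennreal (\<Sum>k<N. 1 / (1 + norm (x - ?c k)) ^ (2 * CARD('n)))"
          using B by (intro ennreal_mult sum_nonneg) auto
        also have "ennreal (\<Sum>k<N. 1 / (1 + norm (x - ?c k)) ^ (2 * CARD('n))) =
            (\<Sum>k<N. ennreal (1 / (1 + norm (x - ?c k)) ^ (2 * CARD('n))))"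
          by (intro sum_ennreal[symmetric]) simp
        finally show ?thesis .
      qed
      then have "(\<integral>\<^sup>+x. ennpowr (?F x) P \<partial>lborel) \<le>
          (\<integral>\<^sup>+x. ennreal B * (\<Sum>k<N. ennreal (1 / (1 + norm (x - ?c k)) ^ (2 * CARD('n)))) \<partial>lborel)"
        by (intro nn_integral_mono)
      also have "\<dots> = ennreal B * (\<Sum>k<N. \<integral>\<^sup>+x. ennreal (1 / (1 + norm (x - ?c k)) ^ (2 * CARD('n))) \<partial>lborel)"
        by (subst nn_integral_cmult, measurable, subst nn_integral_sum) measurable
      also have "\<dots> = ennreal (B * I * real N)"
        unfolding I_eq using B I by (simp add: ennreal_mult ennreal_of_nat_eq_real_of_nat ac_simps)
      finally have "ennpowr (\<integral>\<^sup>+x. ennpowr (?F x) P \<partial>lborel) (1 / P) \<le> ennpowr (ennreal (B * I * real N)) (1 / P)"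
        using P by (intro ennpowr_mono) auto
      also have "\<dots> = ennreal ((B * I) powr (1 / P) * npow N p)"
        using B I False by (simp add: ennpowr_ennreal powr_mult npow_def P_def[symmetric])
      also have "\<dots> \<le> ennreal (((B * I) powr (1 / P) + 1) * npow N p)"
        using npow_nonneg[of N p] by (intro ennreal_leI mult_right_mono) auto
      finally show "sum_norm p q \<omega> ?c N
          \<le> ennreal (((B * I) powr (1 / P) + 1) * npow N p)"
        by (simp only: TL_norm_distribution_finite[OF False] P_def)
    qed (auto intro!: add_nonneg_pos)
  qed
qed

section \<open>Admissibility of the test functions and the contradiction\<close>

lemma packet_sum_vanishing_moments:
  shows "packet_sum \<omega> c N \<in> schwartz_vanishing_moments"
proof -
  \<comment> \<open>The transforms of all packets live at norms of at least 1024 - 2.\<close>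
  have "fourier (packet k (c k)) \<xi> = 0" if "norm \<xi> < 1" for k \<xi>
    using fourier_packet_support(1)[of k "c k" \<xi>] power_freq_ge[of k] that by linarith
  then show ?thesis
    by (intro schwartz_vanishing_momentsI[of _ 1] schwartz_packet_sum)
       (auto simp: fourier_packet_sum)
qed

text \<open>The exponents \<open>a < b\<close> are abstract so that both directions are covered: the
  input grows at most like \<open>npow N b\<close>, the output at least like the larger
  \<open>npow N a\<close>. The input has coefficients 1, but the output carries phases, so the lower
  bound has to be uniform in \<open>\<omega>\<close>.\<close>

lemma not_TL_bounded_shift_multiplier:
  fixes \<eta> :: "real^'n::finite \<Rightarrow> real"
  assumes \<eta>: "herz_cutoff \<eta>"
    and a: "0 < a" "a < b" and "K > 0" "\<kappa> > 0"
    and upper: "\<And>\<omega> N. (\<And>k. norm (\<omega> k) = 1) \<Longrightarrow>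
      sum_norm p q \<omega> c N \<le> ennreal (K * npow N b)"
    and lower: "\<And>\<omega> N. (\<And>k. norm (\<omega> k) = 1) \<Longrightarrow>
      ennreal (\<kappa> * npow N a) \<le>
        sum_norm p q \<omega> (\<lambda>k. c k + real k *\<^sub>R v) N"
  shows "\<not> TL_bounded \<phi> p q (shift_multiplier \<eta> v)"
proof
  assume "TL_bounded \<phi> p q (shift_multiplier \<eta> v)"
  then obtain C where C: "0 \<le> C" "\<And>f. f \<in> schwartz_vanishing_moments \<Longrightarrow>
     TL_norm \<phi> p q (class_of (multiplier_op (shift_multiplier \<eta> v) f)) \<le> ennreal C * TL_norm \<phi> p q (class_of f)"
    unfolding TL_bounded_def by blast
  obtain N where N: "0 < N" "(C * K / \<kappa>) * npow N b < npow N a" by (rule npow_growth[OF a])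
  let ?f = "packet_sum (\<lambda>_. 1) c N"
  let ?\<omega> = "\<lambda>k. 1 * wave (freq k) (- (real k *\<^sub>R v))"
  have "ennreal (\<kappa> * npow N a) \<le>
      sum_norm p q ?\<omega> (\<lambda>k. c k + real k *\<^sub>R v) N"
    by (rule lower) simp
  also have "\<dots> = TL_norm \<phi> p q (class_of (multiplier_op (shift_multiplier \<eta> v) ?f))"
    unfolding multiplier_op_packet_sum[OF \<eta>]
    by (rule TL_norm_class_of[OF \<phi> schwartz_packet_sum, symmetric])
  also have "\<dots> \<le> ennreal C * TL_norm \<phi> p q (class_of ?f)"
    by (rule C(2)[OF packet_sum_vanishing_moments])
  also have "\<dots> \<le> ennreal C * ennreal (K * npow N b)"
    unfolding TL_norm_class_of[OF \<phi> schwartz_packet_sum] by (intro mult_left_mono upper) auto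
  also have "\<dots> = ennreal (C * (K * npow N b))"
    using C(1) \<open>K > 0\<close> by (intro ennreal_mult[symmetric]) (auto simp: npow_nonneg)
  finally have "\<kappa> * npow N a \<le> C * (K * npow N b)"
    using C(1) \<open>K > 0\<close> by (subst (asm) ennreal_le_iff) (auto simp: npow_nonneg)
  then show False using N(2) \<open>\<kappa> > 0\<close> by (simp add: field_simps)
qed

end

theorem theorem3p2:
  fixes \<eta> :: "real^'n::finite \<Rightarrow> real" and \<phi> :: "real^'n \<Rightarrow> complex"
    and p q u t :: ennreal
  assumes "herz_cutoff \<eta>" and "littlewood_paley \<phi>"
    and "0 < p" and "0 < q" and "p \<noteq> q"
    and "0 < u" and "u \<le> min 1 (min p q)"
    and "0 < t"
  shows "\<exists>m\<in>Linfty. herz_multiplier_norm \<eta> u 0 t m < \<infinity> \<and> \<not> TL_bounded \<phi> p q m"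
proof (intro bexI conjI)
  define v :: "real^'n" where "v = axis undefined 1"
  have v: "norm v = 1" by (simp add: v_def norm_axis_1)
  interpret W: wave_packets \<phi> v by unfold_locales (fact assms(2) v)+
  show "shift_multiplier \<eta> v \<in> Linfty" by (rule shift_multiplier_in_Linfty) fact
  have "u \<le> 1" using assms(7) by simp
  then have "u \<noteq> \<infinity>" by (auto simp: top_unique)
  then show "herz_multiplier_norm \<eta> u 0 t (shift_multiplier \<eta> v) < \<infinity>"
    by (intro herz_multiplier_norm_shift_multiplier assms)
  consider "p < q" | "q < p" using assms(5) by (meson linorder_neqE)
  then show "\<not> TL_bounded \<phi> p q (shift_multiplier \<eta> v)"
  proof cases
    case 1
    then have p: "p \<noteq> \<infinity>" by auto
    obtain K where K: "K > 0" "\<And>\<omega> N. (\<And>k. norm (\<omega> k) = 1) \<Longrightarrow>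
        W.sum_norm p q \<omega> (\<lambda>_. 0) N \<le> ennreal (K * npow N q)"
      by (rule W.aligned_TL_norm_le[OF assms(3) p assms(4)]) blast
    obtain \<kappa> where \<kappa>: "\<kappa> > 0" "\<And>\<omega> N. (\<And>k. norm (\<omega> k) = 1) \<Longrightarrow> ennreal (\<kappa> * npow N p) \<le>
        W.sum_norm p q \<omega> (\<lambda>k. real k *\<^sub>R v) N"
      by (rule W.separated_TL_norm_ge[OF assms(3) p assms(4)]) blast
    \<comment> \<open>Stacked packets are spread out, with \<open>a = p\<close> and
      \<open>b = q\<close>.\<close>
    show ?thesis
      by (rule W.not_TL_bounded_shift_multiplier[OF assms(1) assms(3) 1 K(1) \<kappa>(1), of p q "\<lambda>_. 0"])
         (use K(2) \<kappa>(2) in auto)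
  next
    case 2
    then have q: "q \<noteq> \<infinity>" by auto
    obtain c0 \<kappa> where \<kappa>: "\<kappa> > 0" "\<And>\<omega> N. (\<And>k. norm (\<omega> k) = 1) \<Longrightarrow>
        ennreal (\<kappa> * npow N q) \<le> W.sum_norm p q \<omega> (\<lambda>_. c0) N"
      by (rule W.aligned_TL_norm_ge[OF assms(3,4) q]) blast
    obtain K where K: "K > 0" "\<And>\<omega> N. (\<And>k. norm (\<omega> k) = 1) \<Longrightarrow> W.sum_norm p q \<omega> (\<lambda>k. c0 - real k *\<^sub>R v) N \<le> ennreal (K * npow N p)"
      by (rule W.separated_TL_norm_le[OF assms(3,4) q, of c0]) blast
    \<comment> \<open>Packets centred at \<open>c0 - real k *\<^sub>R v\<close> are all moved to
      \<open>c0\<close>, with \<open>a = q\<close> and \<open>b = p\<close>.\<close>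
    show ?thesis
      by (rule W.not_TL_bounded_shift_multiplier[OF assms(1) assms(4) 2 K(1) \<kappa>(1), of p q "\<lambda>k. c0 - real k *\<^sub>R v"])
         (use K(2) \<kappa>(2) in auto)
  qed
qed

end
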